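(* The exponential plethystic bialgebra in two variables $\mathcal P^2_{\mathrm{exp}}$ is isomorphic to the homotopy cardinality of the incidence bialgebra of the simplicial groupoid $\mathcal B\,\mathcal T_{\mathsf S^{\mathrm r}}(\mathsf{Ass}_2)$.
   Context: Monads and operads. $\mathsf{M}^{\mathrm r}$ is the monad on the category of groupoids sending $A$ to $\bigsqcup_{n\ge 1}A^n$ (nonempty tuples, morphisms componentwise), unit $a\mapsto (a)$, multiplication $\mu$ concatenation. $\mathsf{S}^{\mathrm r}$ sends $A$ to $\bigsqcup_{n\ge1}A^n/\!/\mathfrak S_n$ (same objects, with additional isomorphisms $(a_1,\dots,a_n)\to(a_{\sigma(1)},\dots,a_{\sigma(n)})$), same unit and multiplication. For $\mathsf P\in\{\mathsf M^{\mathrm r},\mathsf S^{\mathrm r}\}$ a $\mathsf P$-operad $Q$ consists of groupoids $Q_0$ (colours), $Q_1$ (operations), functors $s\colon Q_1\to\mathsf PQ_0$, $t\colon Q_1\to Q_0$, composition $m\colon\mathsf PQ_1\times_{\mathsf PQ_0}Q_1\to Q_1$ (the $Q_1$ factor the root) and units $e$, with the usual laws. $\mathsf{Ass}_2$ is the terminal $\mathsf M^{\mathrm r}$-operad on the discrete colour set $K=\{1,2\}$: $Q_0=K$, $Q_1=\mathsf M^{\mathrm r}K\times K$, $s,t$ projections, composition induced by $\mu$. $\mathcal T$-construction. (i) For a category $C$ internal to groupoids with discrete $C_0$, $\mathcal T_{\mathsf S^{\mathrm r}}(C)$ is the $\mathsf S^{\mathrm r}$-operad with colours $C_0$ whose operations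 are the pullback of $\mathsf S^{\mathrm r}(\text{target})$ along $C_0\times\mathsf S^{\mathrm r}1\to\mathsf S^{\mathrm r}C_0$, $(c,(\ast,\dots,\ast))\mapsto(c,\dots,c)$: nonempty tuples $(f_1,\dots,f_n)$ of arrows with common target $c$ (inputs the sources, output $c$) with the morphisms of $\mathsf S^{\mathrm r}C_1$; composition $(f_1,\dots,f_k)\circ((g^1_j)_j,\dots,(g^k_j)_j)=(f_1g^1_1,\dots,f_1g^1_{n_1},\dots,f_kg^k_{n_k})$; units identities. (ii) For an $\mathsf M^{\mathrm r}$-operad $Q$ with discrete $Q_0$, $\mathcal T^{\mathsf M^{\mathrm r}}(Q)$ is the category with objects $Q_0$, arrows $c\to d$ the operations with all inputs $c$ and output $d$, composition $y\circ x=m((x,\dots,x);y)$, identities $e$. (iii) $\mathcal T_{\mathsf S^{\mathrm r}}(Q):=\mathcal T_{\mathsf S^{\mathrm r}}(\mathcal T^{\mathsf M^{\mathrm r}}(Q))$. Bar construction. For an $\mathsf S^{\mathrm r}$-operad $Q$, $Q_n:=\mathsf S^{\mathrm r}Q_{n-1}\times_{\mathsf S^{\mathrm r}Q_0}Q_1$ ($n\ge2$). $\mathcal BQ$ has $n$-simplices $\mathsf S^{\mathrm r}Q_n$; $d_0$ discards the top (leafward) level keeping outputs, $d_n$ discards the root level and flattens via $\mu$, inner faces compose adjacent levels via $m$, degeneracies insert units. Incidence bialgebra. $|G|=\sum_{[x]}1/|\mathrm{Aut}(x)|$. For $X=\mathcal BQ$, $\mathbb Q_{\pi_0X_1}$ has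 basis $\delta_a$; $\Delta(\delta_f)=\sum_{a,b}\frac{|\Phi_{f;a,b}|}{|\mathrm{Aut}(a)||\mathrm{Aut}(b)|}\delta_a\otimes\delta_b$ with $\Phi_{f;a,b}$ the homotopy fibre over $(a,b)$ of $(d_2,d_0)$ restricted to the homotopy fibre of $d_1$ over $f$; $\epsilon(\delta_f)=$ cardinality of the homotopy fibre of $s_0$ over $f$; product by juxtaposition (unit adjoined). The bialgebra. $\Lambda$ is the set of sequences $(\lambda_1,\lambda_2,\dots)$ of natural numbers with $\lambda_i=0$ for $i$ large; for two sets of variables $\mathbf x=(x_1,x_2,\dots)$, $\mathbf y=(y_1,y_2,\dots)$ and $\lambda=(\lambda^1,\lambda^2)\in\Lambda^2$ not both zero, $\mathbf X^\lambda=\mathbf x^{\lambda^1}\mathbf y^{\lambda^2}$ and $\lambda!=\prod_i\lambda^1_i!\prod_i\lambda^2_i!$. Power series without constant term are written $F=\sum_\lambda F_\lambda\mathbf X^\lambda/\lambda!$; $F_k(\mathbf x,\mathbf y)=F(x_k,x_{2k},\dots;y_k,y_{2k},\dots)$. Pairs form a monoid under plethystic substitution $(G^1,G^2)\circledast(F^1,F^2)=(G^1(F^1,F^2),G^2(F^1,F^2))$, where $G(F^1,F^2)$ substitutes $x_k\mapsto F^1_k$, $y_k\mapsto F^2_k$. $\mathcal P^2_{\mathrm{exp}}$ is the polynomial algebra on the maps $a^i_\lambda(F^1,F^2)=F^i_\lambda$ ($i=1,2$), with $\Delta(a^i_\lambda)((F^1,F^2),(G^1,G^2))=a^i_\lambda((G^1,G^2)\circledast(F^1,F^2))$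 and counit $\epsilon(a^i_\lambda)=a^i_\lambda(x_1,y_1)$. *)

theory Defs
  imports
    "HOL-Library.Poly_Mapping"
    "HOL-Library.Product_Plus"
    "HOL-Combinatorics.Multiset_Permutations"
begin

section \<open>Groupoids\<close>

text \<open>
  Groupoids and functors are given by their data; hom-sets of different pairs of objects need not
  be disjoint.  The laws are not part of the types; the constructions below preserve them.  Composition is written in the usual order:
  \<open>Comp G g f\<close> is \<open>g\<close> after \<open>f\<close>.
\<close>

record ('o, 'm) groupoid =
  Obj :: "'o set"
  Hom :: "'o \<Rightarrow> 'o \<Rightarrow> 'm set"
  Id :: "'o \<Rightarrow> 'm"
  Comp :: "'m \<Rightarrow> 'm \<Rightarrow> 'm"

record ('o, 'm, 'p, 'n) gfunctor =
  ob :: "'o \<Rightarrow> 'p"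
  ar :: "'m \<Rightarrow> 'n"

definition compF :: "('p, 'n, 'r, 's) gfunctor \<Rightarrow> ('o, 'm, 'p, 'n) gfunctor \<Rightarrow> ('o, 'm, 'r, 's) gfunctor"
    (infixl "\<odot>" 75) where
  "G \<odot> F = \<lparr>ob = ob G \<circ> ob F, ar = ar G \<circ> ar F\<rparr>"

definition fstF :: "('o \<times> 'p, 'm \<times> 'n, 'o, 'm) gfunctor" where
  "fstF = \<lparr>ob = fst, ar = fst\<rparr>"

definition sndF :: "('o \<times> 'p, 'm \<times> 'n, 'p, 'n) gfunctor" where
  "sndF = \<lparr>ob = snd, ar = snd\<rparr>"

definition pairF :: "('o, 'm, 'p, 'n) gfunctor \<Rightarrow> ('o, 'm, 'r, 's) gfunctor
    \<Rightarrow> ('o, 'm, 'p \<times> 'r, 'n \<times> 's) gfunctor" where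
  "pairF F G = \<lparr>ob = (\<lambda>x. (ob F x, ob G x)), ar = (\<lambda>f. (ar F f, ar G f))\<rparr>"

definition discrete :: "'o set \<Rightarrow> ('o, 'o) groupoid" where
  "discrete A = \<lparr>Obj = A, Hom = (\<lambda>x y. {z. z = x \<and> z = y}), Id = (\<lambda>x. x), Comp = (\<lambda>g f. f)\<rparr>"

definition full_subgroupoid :: "'o set \<Rightarrow> ('o, 'm) groupoid \<Rightarrow> ('o, 'm) groupoid" where
  "full_subgroupoid A G = G\<lparr>Obj := Obj G \<inter> A\<rparr>"

definition prod_groupoid :: "('o, 'm) groupoid \<Rightarrow> ('p, 'n) groupoid \<Rightarrow> ('o \<times> 'p, 'm \<times> 'n) groupoid" where
  "prod_groupoid G H = \<lparr>
     Obj = Obj G \<times> Obj H,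
     Hom = (\<lambda>(x, y) (x', y'). Hom G x x' \<times> Hom H y y'),
     Id = (\<lambda>(x, y). (Id G x, Id H y)),
     Comp = (\<lambda>(g, g') (f, f'). (Comp G g f, Comp H g' f'))\<rparr>"

text \<open>The strict pullback of \<open>F : G \<rightarrow> B\<close> and \<open>F' : H \<rightarrow> B\<close>.\<close>

definition pullback :: "('o, 'm, 'r, 's) gfunctor \<Rightarrow> ('p, 'n, 'r, 's) gfunctor
    \<Rightarrow> ('o, 'm) groupoid \<Rightarrow> ('p, 'n) groupoid \<Rightarrow> ('o \<times> 'p, 'm \<times> 'n) groupoid" where
  "pullback F F' G H = (prod_groupoid G H)\<lparr>
     Obj := {(x, y) \<in> Obj G \<times> Obj H. ob F x = ob F' y},
     Hom := (\<lambda>(x, y) (x', y'). {(f, g) \<in> Hom G x x' \<times> Hom H y y'. ar F f = ar F' g})\<rparr>"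

text \<open>Relabelling along a functor that is injective on the types of objects and arrows.\<close>

definition inv_functor :: "('o, 'm, 'p, 'n) gfunctor \<Rightarrow> ('p, 'n, 'o, 'm) gfunctor" where
  "inv_functor F = \<lparr>ob = inv (ob F), ar = inv (ar F)\<rparr>"

definition relabel :: "('o, 'm, 'p, 'n) gfunctor \<Rightarrow> ('o, 'm) groupoid \<Rightarrow> ('p, 'n) groupoid" where
  "relabel F G = \<lparr>
     Obj = ob F ` Obj G,
     Hom = (\<lambda>x y. ar F ` Hom G (inv (ob F) x) (inv (ob F) y)),
     Id = (\<lambda>x. ar F (Id G (inv (ob F) x))),
     Comp = (\<lambda>g f. ar F (Comp G (inv (ar F) g) (inv (ar F) f)))\<rparr>"


subsection \<open>Homotopy fibres and homotopy cardinality\<close>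

definition hofibre :: "('o, 'm, 'p, 'n) gfunctor \<Rightarrow> ('o, 'm) groupoid \<Rightarrow> ('p, 'n) groupoid \<Rightarrow> 'p
    \<Rightarrow> ('o \<times> 'n, 'm) groupoid" where
  "hofibre F G H y = \<lparr>
     Obj = {(x, \<phi>). x \<in> Obj G \<and> \<phi> \<in> Hom H (ob F x) y},
     Hom = (\<lambda>(x, \<phi>) (x', \<phi>'). {f \<in> Hom G x x'. Comp H \<phi>' (ar F f) = \<phi>}),
     Id = (\<lambda>(x, \<phi>). Id G x),
     Comp = Comp G\<rparr>"

definition pi0 :: "('o, 'm) groupoid \<Rightarrow> 'o set set" where
  "pi0 G = Obj G // {(x, y). x \<in> Obj G \<and> y \<in> Obj G \<and> Hom G x y \<noteq> {}}"

definition repr :: "'o set \<Rightarrow> 'o" where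
  "repr c = (SOME x. x \<in> c)"

definition aut_card :: "('o, 'm) groupoid \<Rightarrow> 'o \<Rightarrow> rat" where
  "aut_card G x = of_nat (card (Hom G x x))"

text \<open>Only meaningful for groupoids with finitely many components and finite automorphism groups.\<close>

definition hcard :: "('o, 'm) groupoid \<Rightarrow> rat" where
  "hcard G = (\<Sum>c\<in>pi0 G. 1 / aut_card G (repr c))"


section \<open>The monads \<open>M\<^sup>r\<close> and \<open>S\<^sup>r\<close>\<close>

text \<open>
  Both monads have the nonempty tuples as objects.  An arrow from \<open>as\<close> to \<open>bs\<close>, both of length
  \<open>n\<close>, is a pair \<open>(\<sigma>, fs)\<close> of a permutation \<open>\<sigma>\<close> of \<open>{..<n}\<close>, written as the list of its values,
  and arrows \<open>fs ! i : as ! (\<sigma> ! i) \<rightarrow> bs ! i\<close>.  The arrow with all \<open>fs ! i\<close> identities is the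
  isomorphism from \<open>as\<close> to \<open>(as ! (\<sigma> ! 0), as ! (\<sigma> ! 1), \<dots>)\<close>.  The parameter \<open>W n\<close> is the
  set of permutations that are allowed in length \<open>n\<close>.
\<close>

type_synonym 'm tuple_arrow = "nat list \<times> 'm list"

definition tuples :: "(nat \<Rightarrow> nat list set) \<Rightarrow> ('o, 'm) groupoid \<Rightarrow> ('o list, 'm tuple_arrow) groupoid" where
  "tuples W G = \<lparr>
     Obj = {as. as \<noteq> [] \<and> set as \<subseteq> Obj G},
     Hom = (\<lambda>as bs. {(\<sigma>, fs). length as = length bs \<and> length fs = length bs
              \<and> \<sigma> \<in> W (length bs) \<and> (\<forall>i<length bs. fs ! i \<in> Hom G (as ! (\<sigma> ! i)) (bs ! i))}),
     Id = (\<lambda>as. ([0..<length as], map (Id G) as)),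
     Comp = (\<lambda>(\<tau>, gs) (\<sigma>, fs). (map ((!) \<sigma>) \<tau>, map2 (\<lambda>g i. Comp G g (fs ! i)) gs \<tau>))\<rparr>"

definition Mr :: "('o, 'm) groupoid \<Rightarrow> ('o list, 'm tuple_arrow) groupoid" where
  "Mr = tuples (\<lambda>n. {[0..<n]})"

definition Sr :: "('o, 'm) groupoid \<Rightarrow> ('o list, 'm tuple_arrow) groupoid" where
  "Sr = tuples (\<lambda>n. permutations_of_set {..<n})"

text \<open>The action on functors, unit and multiplication are given by the same formulas for both monads.\<close>

definition mapT :: "('o, 'm, 'p, 'n) gfunctor \<Rightarrow> ('o list, 'm tuple_arrow, 'p list, 'n tuple_arrow) gfunctor" where
  "mapT F = \<lparr>ob = map (ob F), ar = (\<lambda>(\<sigma>, fs). (\<sigma>, map (ar F) fs))\<rparr>"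

definition unitT :: "('o, 'm, 'o list, 'm tuple_arrow) gfunctor" where
  "unitT = \<lparr>ob = (\<lambda>a. [a]), ar = (\<lambda>f. ([0], [f]))\<rparr>"

text \<open>
  On arrows the multiplication forms block permutations: for \<open>(\<pi>, ts)\<close> from \<open>ass\<close> to \<open>bss\<close> with
  \<open>ts ! i : ass ! (\<pi> ! i) \<rightarrow> bss ! i\<close>, the block \<open>ass ! p\<close> starts in \<open>concat ass\<close> at position
  \<open>block_offset \<pi> ts p\<close>.
\<close>

definition block_offset :: "nat list \<Rightarrow> 'm tuple_arrow list \<Rightarrow> nat \<Rightarrow> nat" where
  "block_offset \<pi> ts p = (\<Sum>(q, (\<sigma>, fs)) \<leftarrow> zip \<pi> ts. if q < p then length fs else 0)"

definition multT :: "('o list list, 'm tuple_arrow tuple_arrow, 'o list, 'm tuple_arrow) gfunctor" where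
  "multT = \<lparr>
     ob = concat,
     ar = (\<lambda>(\<pi>, ts). (concat (map2 (\<lambda>p (\<sigma>, fs). map (\<lambda>j. block_offset \<pi> ts p + j) \<sigma>) \<pi> ts),
                      concat (map snd ts)))\<rparr>"


section \<open>Operads\<close>

text \<open>
  The data of a \<open>P\<close>-operad, for either of the two monads \<open>P\<close>: \<open>colours\<close> is $Q_0$, \<open>operations\<close> is
  $Q_1$, and \<open>composeO\<close> is a functor on the pullback of \<open>P\<close>$(t)$ and $s$, the second component
  being the root.
\<close>

record ('c, 'd, 'q, 'r) operad =
  colours :: "('c, 'd) groupoid"
  operations :: "('q, 'r) groupoid"
  sourceO :: "('q, 'r, 'c list, 'd tuple_arrow) gfunctor"
  targetO :: "('q, 'r, 'c, 'd) gfunctor"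
  composeO :: "('q list \<times> 'q, 'r tuple_arrow \<times> 'r, 'q, 'r) gfunctor"
  unitO :: "('c, 'd, 'q, 'r) gfunctor"

datatype two = One | Two

definition Ass2 :: "(two, two, two list \<times> two, two tuple_arrow \<times> two) operad" where
  "Ass2 = \<lparr>
     colours = discrete {One, Two},
     operations = prod_groupoid (Mr (discrete {One, Two})) (discrete {One, Two}),
     sourceO = fstF,
     targetO = sndF,
     composeO = pairF (multT \<odot> mapT fstF \<odot> fstF) (sndF \<odot> sndF),
     unitO = pairF unitT \<lparr>ob = (\<lambda>c. c), ar = (\<lambda>f. f)\<rparr>\<rparr>"


section \<open>The \<open>T\<close>-construction\<close>

text \<open>
  The data of a category internal to groupoids; \<open>composeC\<close> is a functor on the pullback of the
  target and the source, \<open>(x, y)\<close> being sent to \<open>y\<close> after \<open>x\<close>.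
\<close>

record ('c, 'd, 'q, 'r) int_category =
  objects :: "('c, 'd) groupoid"
  arrows :: "('q, 'r) groupoid"
  sourceC :: "('q, 'r, 'c, 'd) gfunctor"
  targetC :: "('q, 'r, 'c, 'd) gfunctor"
  composeC :: "('q \<times> 'q, 'r \<times> 'r, 'q, 'r) gfunctor"
  identC :: "('c, 'd, 'q, 'r) gfunctor"

text \<open>
  \<open>T^M(Q)\<close> for an \<open>M\<^sup>r\<close>-operad \<open>Q\<close> with discrete colours.  As the colours are discrete, the
  operations all of whose inputs agree form a full subgroupoid.
\<close>

definition T_M :: "('c, 'd, 'q, 'r) operad \<Rightarrow> ('c, 'd, 'q, 'r) int_category" where
  "T_M Q = \<lparr>
     objects = colours Q,
     arrows = full_subgroupoid {x. \<exists>c. set (ob (sourceO Q) x) = {c}} (operations Q),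
     sourceC = \<lparr>ob = (\<lambda>x. hd (ob (sourceO Q) x)), ar = (\<lambda>f. hd (snd (ar (sourceO Q) f)))\<rparr>,
     targetC = targetO Q,
     composeC = composeO Q \<odot> \<lparr>
       ob = (\<lambda>(x, y). (replicate (length (ob (sourceO Q) y)) x, y)),
       ar = (\<lambda>(f, g). let n = length (snd (ar (sourceO Q) g)) in (([0..<n], replicate n f), g))\<rparr>,
     identC = unitO Q\<rparr>"

text \<open>
  \<open>T_S(C)\<close> for \<open>C\<close> with discrete objects; again the nonempty tuples of arrows with common target
  form a full subgroupoid.  Composition is the composite of distributing each root arrow over the
  tuple grafted onto it, flattening, and composing in \<open>C\<close>.
\<close>

definition distribute :: "('q list list \<times> 'q list, 'r tuple_arrow tuple_arrow \<times> 'r tuple_arrow,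
    ('q \<times> 'q) list list, ('r \<times> 'r) tuple_arrow tuple_arrow) gfunctor" where
  "distribute = \<lparr>
     ob = (\<lambda>(gss, fs). map2 (\<lambda>gs f. map (\<lambda>g. (g, f)) gs) gss fs),
     ar = (\<lambda>((\<pi>, ts), (\<rho>, \<beta>s)). (\<pi>, map2 (\<lambda>(\<sigma>, \<alpha>s) \<beta>. (\<sigma>, map (\<lambda>\<alpha>. (\<alpha>, \<beta>)) \<alpha>s)) ts \<beta>s))\<rparr>"

definition T_S :: "('c, 'd, 'q, 'r) int_category \<Rightarrow> ('c, 'd, 'q list, 'r tuple_arrow) operad" where
  "T_S C = \<lparr>
     colours = objects C,
     operations = full_subgroupoid {fs. \<exists>c. set (map (ob (targetC C)) fs) = {c}} (Sr (arrows C)),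
     sourceO = mapT (sourceC C),
     targetO = targetC C \<odot> \<lparr>ob = hd, ar = (\<lambda>(\<sigma>, fs). hd fs)\<rparr>,
     composeO = mapT (composeC C) \<odot> multT \<odot> distribute,
     unitO = unitT \<odot> identC C\<rparr>"


section \<open>The bar construction of an \<open>S\<^sup>r\<close>-operad\<close>

record ('o, 'm) simplicial_groupoid =
  level :: "nat \<Rightarrow> ('o, 'm) groupoid"
  face :: "nat \<Rightarrow> nat \<Rightarrow> ('o, 'm, 'o, 'm) gfunctor"  \<comment> \<open>\<open>face n i\<close> is $d_i : X_n \to X_{n-1}$\<close>
  degen :: "nat \<Rightarrow> nat \<Rightarrow> ('o, 'm, 'o, 'm) gfunctor"  \<comment> \<open>\<open>degen n i\<close> is $s_i : X_n \to X_{n+1}$\<close>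

text \<open>
  The objects of all the groupoids $Q_0, Q_1, Q_2, \dots$ live in one type, and so do their arrows:
  \<open>Colour\<close> and \<open>Oper\<close> embed $Q_0$ and $Q_1$, and \<open>Graft\<close> embeds the pullbacks $Q_n$ for $n \ge 2$.
\<close>

datatype ('c, 'q) cell =
  Colour 'c | Oper 'q | Graft "('c, 'q) cell list \<times> 'q"

datatype ('d, 'r) cell_arrow =
  ColourA 'd | OperA 'r | GraftA "(nat list \<times> ('d, 'r) cell_arrow list) \<times> 'r"

definition colourF :: "('c, 'd, ('c, 'q) cell, ('d, 'r) cell_arrow) gfunctor" where
  "colourF = \<lparr>ob = Colour, ar = ColourA\<rparr>"

definition operF :: "('q, 'r, ('c, 'q) cell, ('d, 'r) cell_arrow) gfunctor" where
  "operF = \<lparr>ob = Oper, ar = OperA\<rparr>"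

definition graftF :: "(('c, 'q) cell list \<times> 'q, ('d, 'r) cell_arrow tuple_arrow \<times> 'r,
    ('c, 'q) cell, ('d, 'r) cell_arrow) gfunctor" where
  "graftF = \<lparr>ob = Graft, ar = GraftA\<rparr>"

text \<open>The functor $Q_n \to Q_0$ taking the output colour, for every \<open>n\<close>.\<close>

definition outputF :: "('c, 'd, 'q, 'r) operad \<Rightarrow> (('c, 'q) cell, ('d, 'r) cell_arrow, 'c, 'd) gfunctor" where
  "outputF Q = \<lparr>
     ob = (\<lambda>x. case x of Colour c \<Rightarrow> c | Oper q \<Rightarrow> ob (targetO Q) q
                       | Graft (xs, q) \<Rightarrow> ob (targetO Q) q),
     ar = (\<lambda>f. case f of ColourA d \<Rightarrow> d | OperA r \<Rightarrow> ar (targetO Q) r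
                       | GraftA (fs, r) \<Rightarrow> ar (targetO Q) r)\<rparr>"

fun cells :: "('c, 'd, 'q, 'r) operad \<Rightarrow> nat \<Rightarrow> (('c, 'q) cell, ('d, 'r) cell_arrow) groupoid" where
  "cells Q 0 = relabel colourF (colours Q)"
| "cells Q (Suc 0) = relabel operF (operations Q)"
| "cells Q (Suc (Suc n)) = relabel graftF
     (pullback (mapT (outputF Q)) (sourceO Q) (Sr (cells Q (Suc n))) (operations Q))"

text \<open>
  \<open>cell_face Q n i : Q\<^sub>n \<rightarrow> Q\<^sub>n\<^sub>-\<^sub>1\<close> for \<open>n \<ge> 1\<close> and \<open>i < n\<close>.  Levels are numbered from the leaves
  to the root, so that \<open>i = 0\<close> discards the top level and \<open>i > 0\<close> composes the levels \<open>i\<close> and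
  \<open>i + 1\<close>; for \<open>i = n - 1 > 0\<close> these are the two levels next to the root.
\<close>

fun cell_face :: "('c, 'd, 'q, 'r) operad \<Rightarrow> nat \<Rightarrow> nat
    \<Rightarrow> (('c, 'q) cell, ('d, 'r) cell_arrow, ('c, 'q) cell, ('d, 'r) cell_arrow) gfunctor" where
  "cell_face Q 0 i = undefined"
| "cell_face Q (Suc 0) i = colourF \<odot> targetO Q \<odot> inv_functor operF"
| "cell_face Q (Suc (Suc 0)) i =
     (if i = 0 then operF \<odot> sndF \<odot> inv_functor graftF
      else operF \<odot> composeO Q \<odot> pairF (mapT (inv_functor operF) \<odot> fstF) sndF \<odot> inv_functor graftF)"
| "cell_face Q (Suc (Suc (Suc n))) i =
     (if i < Suc (Suc n)
      then graftF \<odot> pairF (mapT (cell_face Q (Suc (Suc n)) i) \<odot> fstF) sndF \<odot> inv_functor graftF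
      else graftF
        \<odot> pairF (multT \<odot> mapT (fstF \<odot> inv_functor graftF) \<odot> fstF)
                (composeO Q \<odot> pairF (mapT (sndF \<odot> inv_functor graftF) \<odot> fstF) sndF)
        \<odot> inv_functor graftF)"

text \<open>
  \<open>cell_last_face Q n : Q\<^sub>n \<rightarrow> S\<^sup>r Q\<^sub>n\<^sub>-\<^sub>1\<close> for \<open>n \<ge> 1\<close> discards the root level.
\<close>

definition cell_last_face :: "('c, 'd, 'q, 'r) operad \<Rightarrow> nat
    \<Rightarrow> (('c, 'q) cell, ('d, 'r) cell_arrow, ('c, 'q) cell list, ('d, 'r) cell_arrow tuple_arrow) gfunctor" where
  "cell_last_face Q n =
     (if n = 1 then mapT colourF \<odot> sourceO Q \<odot> inv_functor operF
      else fstF \<odot> inv_functor graftF)"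

text \<open>
  \<open>cell_degen Q n i : Q\<^sub>n \<rightarrow> Q\<^sub>n\<^sub>+\<^sub>1\<close> for \<open>i \<le> n\<close>; units are inserted at the leaves for \<open>i = 0\<close>
  and at the root for \<open>i = n\<close>.
\<close>

fun cell_degen :: "('c, 'd, 'q, 'r) operad \<Rightarrow> nat \<Rightarrow> nat
    \<Rightarrow> (('c, 'q) cell, ('d, 'r) cell_arrow, ('c, 'q) cell, ('d, 'r) cell_arrow) gfunctor" where
  "cell_degen Q 0 i = operF \<odot> unitO Q \<odot> inv_functor colourF"
| "cell_degen Q (Suc n) i =
     (if i = Suc n then graftF \<odot> pairF unitT (unitO Q \<odot> outputF Q)
      else if n = 0 then graftF \<odot> pairF (mapT (operF \<odot> unitO Q) \<odot> sourceO Q) (\<lparr>ob = (\<lambda>q. q), ar = (\<lambda>r. r)\<rparr>)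
        \<odot> inv_functor operF
      else graftF \<odot> pairF (mapT (cell_degen Q n i) \<odot> fstF) sndF \<odot> inv_functor graftF)"

definition bar :: "('c, 'd, 'q, 'r) operad
    \<Rightarrow> (('c, 'q) cell list, ('d, 'r) cell_arrow tuple_arrow) simplicial_groupoid" where
  "bar Q = \<lparr>
     level = (\<lambda>n. Sr (cells Q n)),
     face = (\<lambda>n i. if i < n then mapT (cell_face Q n i) else multT \<odot> mapT (cell_last_face Q n)),
     degen = (\<lambda>n i. mapT (cell_degen Q n i))\<rparr>"


section \<open>Bialgebras over the rationals with a chosen basis\<close>

text \<open>
  The underlying vector space is the space of finitely supported functions on \<open>basis\<close>, and its
  tensor square is the space of finitely supported functions on \<open>basis \<times> basis\<close>.
\<close>

record 'b based_bialgebra =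
  basis :: "'b set"
  multB :: "('b \<Rightarrow>\<^sub>0 rat) \<Rightarrow> ('b \<Rightarrow>\<^sub>0 rat) \<Rightarrow> ('b \<Rightarrow>\<^sub>0 rat)"
  oneB :: "'b \<Rightarrow>\<^sub>0 rat"
  comultB :: "('b \<Rightarrow>\<^sub>0 rat) \<Rightarrow> ('b \<times> 'b \<Rightarrow>\<^sub>0 rat)"
  counitB :: "('b \<Rightarrow>\<^sub>0 rat) \<Rightarrow> rat"

definition vectors :: "'b based_bialgebra \<Rightarrow> ('b \<Rightarrow>\<^sub>0 rat) set" where
  "vectors A = {v. Poly_Mapping.keys v \<subseteq> basis A}"

definition scale :: "rat \<Rightarrow> ('b \<Rightarrow>\<^sub>0 rat) \<Rightarrow> ('b \<Rightarrow>\<^sub>0 rat)" where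
  "scale r v = Poly_Mapping.map ((*) r) v"

definition lin_ext :: "('b \<Rightarrow> ('c \<Rightarrow>\<^sub>0 rat)) \<Rightarrow> ('b \<Rightarrow>\<^sub>0 rat) \<Rightarrow> ('c \<Rightarrow>\<^sub>0 rat)" where
  "lin_ext f v = (\<Sum>b\<in>Poly_Mapping.keys v. scale (Poly_Mapping.lookup v b) (f b))"

definition tensor :: "('b \<Rightarrow>\<^sub>0 rat) \<Rightarrow> ('c \<Rightarrow>\<^sub>0 rat) \<Rightarrow> ('b \<times> 'c \<Rightarrow>\<^sub>0 rat)" where
  "tensor v w = lin_ext (\<lambda>b. lin_ext (\<lambda>c. Poly_Mapping.single (b, c) 1) w) v"

definition tensor_map :: "(('b \<Rightarrow>\<^sub>0 rat) \<Rightarrow> ('c \<Rightarrow>\<^sub>0 rat)) \<Rightarrow> ('b \<times> 'b \<Rightarrow>\<^sub>0 rat) \<Rightarrow> ('c \<times> 'c \<Rightarrow>\<^sub>0 rat)" where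
  "tensor_map \<phi> =
     lin_ext (\<lambda>(b, b'). tensor (\<phi> (Poly_Mapping.single b 1)) (\<phi> (Poly_Mapping.single b' 1)))"

definition bialgebra_iso :: "'b based_bialgebra \<Rightarrow> 'c based_bialgebra
    \<Rightarrow> (('b \<Rightarrow>\<^sub>0 rat) \<Rightarrow> ('c \<Rightarrow>\<^sub>0 rat)) \<Rightarrow> bool" where
  "bialgebra_iso A B \<phi> \<longleftrightarrow>
     bij_betw \<phi> (vectors A) (vectors B) \<and>
     (\<forall>u\<in>vectors A. \<forall>v\<in>vectors A. \<phi> (u + v) = \<phi> u + \<phi> v) \<and>
     (\<forall>r. \<forall>v\<in>vectors A. \<phi> (scale r v) = scale r (\<phi> v)) \<and>
     (\<forall>u\<in>vectors A. \<forall>v\<in>vectors A. \<phi> (multB A u v) = multB B (\<phi> u) (\<phi> v)) \<and>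
     \<phi> (oneB A) = oneB B \<and>
     (\<forall>v\<in>vectors A. comultB B (\<phi> v) = tensor_map \<phi> (comultB A v)) \<and>
     (\<forall>v\<in>vectors A. counitB B (\<phi> v) = counitB A v)"

definition bialgebra_isomorphic :: "'b based_bialgebra \<Rightarrow> 'c based_bialgebra \<Rightarrow> bool" where
  "bialgebra_isomorphic A B \<longleftrightarrow> (\<exists>\<phi>. bialgebra_iso A B \<phi>)"


section \<open>The incidence bialgebra\<close>

definition faces20 :: "('o, 'm) simplicial_groupoid \<Rightarrow> ('o \<times> 'n, 'm, 'o \<times> 'o, 'm \<times> 'm) gfunctor" where
  "faces20 X = \<lparr>
     ob = (\<lambda>(x, \<phi>). (ob (face X 2 2) x, ob (face X 2 0) x)),
     ar = (\<lambda>f. (ar (face X 2 2) f, ar (face X 2 0) f))\<rparr>"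

definition incidence_fibre :: "('o, 'm) simplicial_groupoid \<Rightarrow> 'o \<Rightarrow> 'o \<Rightarrow> 'o
    \<Rightarrow> (('o \<times> 'm) \<times> ('m \<times> 'm), 'm) groupoid" where
  "incidence_fibre X f a b =
     hofibre (faces20 X) (hofibre (face X 2 1) (level X 2) (level X 1) f)
       (prod_groupoid (level X 1) (level X 1)) (a, b)"

definition incidence_coeff :: "('o, 'm) simplicial_groupoid \<Rightarrow> 'o \<Rightarrow> 'o \<Rightarrow> 'o \<Rightarrow> rat" where
  "incidence_coeff X f a b =
     hcard (incidence_fibre X f a b) / (aut_card (level X 1) a * aut_card (level X 1) b)"

text \<open>The basis element \<open>None\<close> is the adjoined unit.\<close>

definition incidence_comult :: "('o, 'm) simplicial_groupoid \<Rightarrow> 'o set option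
    \<Rightarrow> ('o set option \<times> 'o set option \<Rightarrow>\<^sub>0 rat)" where
  "incidence_comult X c = (case c of
     None \<Rightarrow> Poly_Mapping.single (None, None) 1
   | Some f \<Rightarrow> Abs_poly_mapping (\<lambda>(a, b). case (a, b) of
       (Some a, Some b) \<Rightarrow>
         (if a \<in> pi0 (level X 1) \<and> b \<in> pi0 (level X 1)
          then incidence_coeff X (repr f) (repr a) (repr b) else 0)
     | _ \<Rightarrow> 0))"

definition incidence_counit :: "('o, 'm) simplicial_groupoid \<Rightarrow> 'o set option \<Rightarrow> rat" where
  "incidence_counit X c = (case c of
     None \<Rightarrow> 1
   | Some f \<Rightarrow> hcard (hofibre (degen X 0 0) (level X 0) (level X 1) (repr f)))"

definition juxtapose :: "('x list, 'm) simplicial_groupoid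
    \<Rightarrow> 'x list set option \<Rightarrow> 'x list set option \<Rightarrow> 'x list set option" where
  "juxtapose X c d = (case (c, d) of
     (None, _) \<Rightarrow> d
   | (_, None) \<Rightarrow> c
   | (Some a, Some b) \<Rightarrow>
       Some {z \<in> Obj (level X 1). \<exists>x\<in>a. \<exists>y\<in>b. Hom (level X 1) (x @ y) z \<noteq> {}})"

definition incidence_bialgebra :: "('x list, 'm) simplicial_groupoid
    \<Rightarrow> 'x list set option based_bialgebra" where
  "incidence_bialgebra X = \<lparr>
     basis = insert None (Some ` pi0 (level X 1)),
     multB = (\<lambda>u v. lin_ext (\<lambda>(c, d). Poly_Mapping.single (juxtapose X c d) 1) (tensor u v)),
     oneB = Poly_Mapping.single None 1,
     comultB = lin_ext (incidence_comult X),
     counitB = (\<lambda>v. \<Sum>c\<in>Poly_Mapping.keys v. Poly_Mapping.lookup v c * incidence_counit X c)\<rparr>"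


section \<open>Power series in arbitrarily many variables\<close>

text \<open>
  \<open>mcoeff F \<nu>\<close> is the ordinary coefficient of the monomial with exponents \<open>\<nu>\<close>, without the
  factorials of the exponential normalisation.
\<close>

typedef 'v mseries = "UNIV :: (('v \<Rightarrow>\<^sub>0 nat) \<Rightarrow> rat) set"
  morphisms mcoeff Abs_mseries ..

setup_lifting type_definition_mseries

lemma mseries_eqI: "(\<And>\<nu>. mcoeff F \<nu> = mcoeff G \<nu>) \<Longrightarrow> F = G"
  by (metis ext mcoeff_inject)

lemma finite_splittings: "finite {(\<alpha>, \<beta>). \<alpha> + \<beta> = (\<nu> :: 'v \<Rightarrow>\<^sub>0 nat)}"
proof -
  let ?A = "{\<alpha>. \<exists>\<beta>. \<alpha> + \<beta> = \<nu>}"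
  let ?K = "Poly_Mapping.keys \<nu>"
  let ?r = "\<lambda>\<alpha>. restrict (Poly_Mapping.lookup \<alpha>) ?K"
  have le: "Poly_Mapping.lookup \<alpha> v \<le> Poly_Mapping.lookup \<nu> v" if "\<alpha> \<in> ?A" for \<alpha> v
    using that by (auto simp: lookup_add)
  have "inj_on ?r ?A"
  proof (rule inj_onI)
    fix \<alpha> \<alpha>' assume a: "\<alpha> \<in> ?A" "\<alpha>' \<in> ?A" "?r \<alpha> = ?r \<alpha>'"
    show "\<alpha> = \<alpha>'"
    proof (rule poly_mapping_eqI)
      fix v
      show "Poly_Mapping.lookup \<alpha> v = Poly_Mapping.lookup \<alpha>' v"
      proof (cases "v \<in> ?K")
        case True
        then show ?thesis using fun_cong[OF a(3), of v] by simp
      next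
        case False
        then show ?thesis using le[OF a(1), of v] le[OF a(2), of v]
          by (simp add: not_in_keys_iff_lookup_eq_zero)
      qed
    qed
  qed
  moreover have "?r ` ?A \<subseteq> (\<Pi>\<^sub>E v\<in>?K. {..Poly_Mapping.lookup \<nu> v})"
    using le by auto
  then have "finite (?r ` ?A)"
    by (rule finite_subset) (auto intro: finite_PiE)
  ultimately have fin: "finite ?A"
    using finite_imageD by blast
  have "{(\<alpha>, \<beta>). \<alpha> + \<beta> = \<nu>} \<subseteq> (\<lambda>\<alpha>. (\<alpha>, \<nu> - \<alpha>)) ` ?A"
    by auto
  then show ?thesis
    using fin finite_surj by blast
qed

instantiation mseries :: (type) comm_monoid_mult
begin

lift_definition one_mseries :: "'a mseries" is "\<lambda>\<nu>. if \<nu> = 0 then 1 else 0" .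

lift_definition times_mseries :: "'a mseries \<Rightarrow> 'a mseries \<Rightarrow> 'a mseries" is
  "\<lambda>F G \<nu>. \<Sum>(\<alpha>, \<beta>)\<in>{(\<alpha>, \<beta>). \<alpha> + \<beta> = \<nu>}. F \<alpha> * G \<beta>" .

instance
proof
  fix F G H :: "'a mseries"
  let ?S = "\<lambda>\<nu> :: 'a \<Rightarrow>\<^sub>0 nat. {(\<alpha>, \<beta>). \<alpha> + \<beta> = \<nu>}"
  let ?T = "\<lambda>\<nu> :: 'a \<Rightarrow>\<^sub>0 nat. {(\<alpha>, \<beta>, \<gamma>). \<alpha> + \<beta> + \<gamma> = \<nu>}"
  show "F * G * H = F * (G * H)"
  proof (rule mseries_eqI)
    fix \<nu>
    have "mcoeff (F * G * H) \<nu>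
        = (\<Sum>(\<delta>, \<gamma>)\<in>?S \<nu>. \<Sum>(\<alpha>, \<beta>)\<in>?S \<delta>. mcoeff F \<alpha> * mcoeff G \<beta> * mcoeff H \<gamma>)"
      by (simp add: times_mseries.rep_eq sum_distrib_right case_prod_beta)
    also have "\<dots> = (\<Sum>(x, y)\<in>(SIGMA x:?S \<nu>. ?S (fst x)).
        mcoeff F (fst y) * mcoeff G (snd y) * mcoeff H (snd x))"
      by (simp add: sum.Sigma finite_splittings case_prod_beta)
    also have "\<dots> = (\<Sum>(\<alpha>, \<beta>, \<gamma>)\<in>?T \<nu>. mcoeff F \<alpha> * mcoeff G \<beta> * mcoeff H \<gamma>)"
      by (rule sum.reindex_bij_witness[where i = "\<lambda>(\<alpha>, \<beta>, \<gamma>). ((\<alpha> + \<beta>, \<gamma>), (\<alpha>, \<beta>))"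
            and j = "\<lambda>(x, y). (fst y, snd y, snd x)"]) auto
    also have "\<dots> = (\<Sum>(x, y)\<in>(SIGMA x:?S \<nu>. ?S (snd x)).
        mcoeff F (fst x) * (mcoeff G (fst y) * mcoeff H (snd y)))"
      by (rule sum.reindex_bij_witness[where j = "\<lambda>(\<alpha>, \<beta>, \<gamma>). ((\<alpha>, \<beta> + \<gamma>), (\<beta>, \<gamma>))"
            and i = "\<lambda>(x, y). (fst x, fst y, snd y)"]) (auto simp: add.assoc)
    also have "\<dots> = (\<Sum>(\<alpha>, \<delta>)\<in>?S \<nu>. \<Sum>(\<beta>, \<gamma>)\<in>?S \<delta>. mcoeff F \<alpha> * (mcoeff G \<beta> * mcoeff H \<gamma>))"
      by (simp add: sum.Sigma finite_splittings case_prod_beta)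
    also have "\<dots> = mcoeff (F * (G * H)) \<nu>"
      by (simp add: times_mseries.rep_eq sum_distrib_left case_prod_beta)
    finally show "mcoeff (F * G * H) \<nu> = mcoeff (F * (G * H)) \<nu>" .
  qed
  show "F * G = G * F"
  proof (rule mseries_eqI)
    fix \<nu>
    show "mcoeff (F * G) \<nu> = mcoeff (G * F) \<nu>"
      unfolding times_mseries.rep_eq
      by (rule sum.reindex_bij_witness[where i = prod.swap and j = prod.swap])
         (auto simp: add.commute)
  qed
  show "1 * F = F"
  proof (rule mseries_eqI)
    fix \<nu>
    have "mcoeff (1 * F) \<nu> = (\<Sum>(\<alpha>, \<beta>)\<in>?S \<nu>. (if \<alpha> = 0 then 1 else 0) * mcoeff F \<beta>)"
      by (simp add: times_mseries.rep_eq one_mseries.rep_eq)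
    also have "\<dots> = (\<Sum>(\<alpha>, \<beta>)\<in>{(0 :: 'a \<Rightarrow>\<^sub>0 nat, \<nu>)}. (if \<alpha> = 0 then 1 else 0) * mcoeff F \<beta>)"
      by (rule sum.mono_neutral_right) (auto simp: finite_splittings split: if_splits)
    finally show "mcoeff (1 * F) \<nu> = mcoeff F \<nu>" by simp
  qed
qed

end

lift_definition mvar :: "'v \<Rightarrow> 'v mseries" is
  "\<lambda>v \<nu>. if \<nu> = Poly_Mapping.single v 1 then 1 else 0" .

text \<open>
  Substitution of \<open>H v\<close> for the variable \<open>v\<close>.  \<open>Sum_any\<close> is the sum over the exponents \<open>\<mu>\<close> with
  nonzero summand; there are finitely many of these in all the uses below.
\<close>

lift_definition msubst :: "'v mseries \<Rightarrow> ('v \<Rightarrow> 'w mseries) \<Rightarrow> 'w mseries" is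
  "\<lambda>G H \<nu>. Sum_any (\<lambda>\<mu>. G \<mu> *
     mcoeff (\<Prod>v\<in>Poly_Mapping.keys \<mu>. H v ^ Poly_Mapping.lookup \<mu> v) \<nu>)" .


section \<open>The exponential plethystic bialgebra in two variables\<close>

text \<open>
  The variable \<open>(One, k)\<close> is $x_k$ and \<open>(Two, k)\<close> is $y_k$, for \<open>k \<ge> 1\<close>.  A pair
  $\lambda = (\lambda^1, \lambda^2)$ is one finitely supported function on these variables.
\<close>

type_synonym pvar = "two \<times> nat"
type_synonym pexp = "pvar \<Rightarrow>\<^sub>0 nat"

definition exponents :: "pexp set" where
  "exponents = {\<mu>. \<mu> \<noteq> 0 \<and> Poly_Mapping.keys \<mu> \<subseteq> UNIV \<times> {1..}}"

definition exp_factorial :: "pexp \<Rightarrow> rat" where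
  "exp_factorial \<mu> = (\<Prod>v\<in>Poly_Mapping.keys \<mu>. fact (Poly_Mapping.lookup \<mu> v))"

definition series :: "pvar mseries set" where
  "series = {F. \<forall>\<nu>. mcoeff F \<nu> \<noteq> 0 \<longrightarrow> \<nu> \<in> exponents}"

text \<open>Pairs of power series without constant term; the component at \<open>One\<close> is $F^1$.\<close>

type_synonym series_pair = "two \<Rightarrow> pvar mseries"

definition series_pairs :: "series_pair set" where
  "series_pairs = {F. \<forall>i. F i \<in> series}"

definition dilate :: "nat \<Rightarrow> pvar mseries \<Rightarrow> pvar mseries" where
  "dilate k F = msubst F (\<lambda>(c, j). mvar (c, k * j))"

definition plethysm :: "series_pair \<Rightarrow> series_pair \<Rightarrow> series_pair"  (infixl "\<circledast>" 70) where
  "G \<circledast> F = (\<lambda>i. msubst (G i) (\<lambda>(c, k). dilate k (F c)))"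

definition unit_pair :: series_pair where
  "unit_pair = (\<lambda>i. mvar (i, 1))"

text \<open>The generator $a^i_\lambda$ is represented by the pair \<open>(i, \<lambda>)\<close>, its value at \<open>F\<close> by \<open>gen_value\<close>.\<close>

type_synonym generator = "two \<times> pexp"
type_synonym gen_monomial = "generator \<Rightarrow>\<^sub>0 nat"

definition gen_value :: "generator \<Rightarrow> series_pair \<Rightarrow> rat" where
  "gen_value = (\<lambda>(i, \<mu>) F. exp_factorial \<mu> * mcoeff (F i) \<mu>)"

definition gen_monomials :: "gen_monomial set" where
  "gen_monomials = {M. Poly_Mapping.keys M \<subseteq> UNIV \<times> exponents}"

definition monomial_value :: "gen_monomial \<Rightarrow> series_pair \<Rightarrow> rat" where
  "monomial_value M F = (\<Prod>g\<in>Poly_Mapping.keys M. gen_value g F ^ Poly_Mapping.lookup M g)"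

definition poly_value :: "(gen_monomial \<Rightarrow>\<^sub>0 rat) \<Rightarrow> series_pair \<Rightarrow> rat" where
  "poly_value p F = (\<Sum>M\<in>Poly_Mapping.keys p. Poly_Mapping.lookup p M * monomial_value M F)"

definition tensor_value :: "(gen_monomial \<times> gen_monomial \<Rightarrow>\<^sub>0 rat) \<Rightarrow> series_pair \<Rightarrow> series_pair \<Rightarrow> rat" where
  "tensor_value T F G = (\<Sum>(M, N)\<in>Poly_Mapping.keys T.
     Poly_Mapping.lookup T (M, N) * (monomial_value M F * monomial_value N G))"

definition gen_comult :: "generator \<Rightarrow> (gen_monomial \<times> gen_monomial \<Rightarrow>\<^sub>0 rat)" where
  "gen_comult g = (THE T. Poly_Mapping.keys T \<subseteq> gen_monomials \<times> gen_monomials \<and>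
     (\<forall>F\<in>series_pairs. \<forall>G\<in>series_pairs. tensor_value T F G = gen_value g (G \<circledast> F)))"

text \<open>
  Products and powers are those of the convolution ring of finitely supported functions on a
  monoid: the polynomial ring for \<open>multB\<close>, and its tensor square in the comultiplication, which is thus the algebra map
  extending \<open>gen_comult\<close>.
\<close>

definition P2exp :: "gen_monomial based_bialgebra" where
  "P2exp = \<lparr>
     basis = gen_monomials,
     multB = (*),
     oneB = 1,
     comultB = lin_ext (\<lambda>M. \<Prod>g\<in>Poly_Mapping.keys M. gen_comult g ^ Poly_Mapping.lookup M g),
     counitB = (\<lambda>p. poly_value p unit_pair)\<rparr>"

end

theory Submission
  imports Defs
begin

text \<open>
  The homotopy cardinality of a finite groupoid is the sum, over its objects \<open>x\<close>, of the inverse of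
  the number of arrows leaving \<open>x\<close>, and in a homotopy fibre an object has as many outgoing arrows
  as the object of the total groupoid underlying it.  So the structure constants of $\delta_f$ are sums
  over the 2-simplices \<open>x\<close> with $d_1 x \cong f$, weighted by $|Hom(d_1 x, f)|$ over the number of arrows
  leaving \<open>x\<close>.  The permutations in the arrows of \<open>S\<^sup>r\<close> make this weighted sum multiplicative in the
  entries of \<open>f\<close>.  For a single operation it is the expansion of a coefficient of \<open>G \<circledast> F\<close>
  over two-level trees: a monomial with exponents \<open>\<mu>\<close> and \<open>n\<close> factors is replaced by the
  $n!/\mu!$ words that spell it, and the numbers of arrows leaving the trees are the factorials in the
  denominators.  As a tensor of polynomials is determined by its values on pairs of series, this
  identifies the two comultiplications.
\<close>

section \<open>Groupoids and homotopy fibres\<close>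

text \<open>The groupoid of operations of \<open>Ass2\<close> has only identity arrows, so an
  operation of \<open>T_S (T_M Ass2)\<close> is a word with an output colour, and its only
  symmetries permute letters. Isomorphism classes of operations are therefore the generators, and
  classes of tuples of operations are the nonconstant monomials in them: the isomorphism merely
  renames a basis, and all the content lies in the structure constants. The obstacle is that both
  sides are normalised by orbits. The order of an automorphism group, like the factorial \<lambda>!,
  depends on coincidences among the letters, and coincidences behave badly under grafting and
  composing. The number of arrows leaving a word of length n is n! whatever its repetitions, and for
  a tree it depends only on the lengths of its words; hence the preference for sums over labelled
  objects. A second obstacle is that \<open>gen_comult\<close> is a definite description. No
  explicit formula is derived for it: the tensor that the bar construction assigns to a one-entry
  tuple serves as the witness.\<close>

locale is_groupoid =
  fixes G :: "('o, 'm) groupoid"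
  assumes Id_in: "x \<in> Obj G \<Longrightarrow> Id G x \<in> Hom G x x"
    and Comp_in: "\<lbrakk>x \<in> Obj G; y \<in> Obj G; z \<in> Obj G; f \<in> Hom G x y; g \<in> Hom G y z\<rbrakk>
      \<Longrightarrow> Comp G g f \<in> Hom G x z"
    and Comp_assoc: "\<lbrakk>w \<in> Obj G; x \<in> Obj G; y \<in> Obj G; z \<in> Obj G;
        f \<in> Hom G w x; g \<in> Hom G x y; h \<in> Hom G y z\<rbrakk>
      \<Longrightarrow> Comp G (Comp G h g) f = Comp G h (Comp G g f)"
    and Comp_Id_left: "\<lbrakk>x \<in> Obj G; y \<in> Obj G; f \<in> Hom G x y\<rbrakk> \<Longrightarrow> Comp G (Id G y) f = f"
    and left_inverse: "\<lbrakk>x \<in> Obj G; y \<in> Obj G; f \<in> Hom G x y\<rbrakk>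
      \<Longrightarrow> \<exists>g\<in>Hom G y x. Comp G g f = Id G x"
begin

text \<open>As in a group axiomatised from the left: if \<open>h\<close> is a left inverse of
  \<open>g\<close>, then fg = (hg)(fg) = h(gf)g = hg is the identity. Right units and both
  cancellation laws follow from two-sided inverses.\<close>

lemma inverse:
  assumes "x \<in> Obj G" "y \<in> Obj G" "f \<in> Hom G x y"
  shows "\<exists>g\<in>Hom G y x. Comp G g f = Id G x \<and> Comp G f g = Id G y"
proof -
  obtain g where g: "g \<in> Hom G y x" "Comp G g f = Id G x"
    using left_inverse assms by blast
  obtain h where h: "h \<in> Hom G x y" "Comp G h g = Id G y"
    using left_inverse assms g(1) by blast
  have fg: "Comp G f g \<in> Hom G y y"
    using Comp_in assms g(1) by blast
  have "Comp G f g = Comp G (Comp G h g) (Comp G f g)"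
    using h(2) Comp_Id_left assms(2) fg by simp
  also have "\<dots> = Comp G h (Comp G g (Comp G f g))"
    using Comp_assoc[OF assms(2,2,1,2) fg g(1) h(1)] .
  also have "Comp G g (Comp G f g) = g"
    using Comp_assoc[OF assms(2,1,2,1) g(1) assms(3) g(1)] g Comp_Id_left assms by simp
  finally show ?thesis using g h by auto
qed

lemma Comp_Id_right:
  assumes "x \<in> Obj G" "y \<in> Obj G" "f \<in> Hom G x y"
  shows "Comp G f (Id G x) = f"
proof -
  obtain g where g: "g \<in> Hom G y x" "Comp G g f = Id G x" "Comp G f g = Id G y"
    using inverse assms by blast
  show ?thesis
    using Comp_assoc[OF assms(1,2,1,2) assms(3) g(1) assms(3)] g Comp_Id_left assms by simp
qed

lemma Comp_cancel_right:
  assumes "x \<in> Obj G" "y \<in> Obj G" "z \<in> Obj G" "f \<in> Hom G x y" "g \<in> Hom G y z" "h \<in> Hom G y z"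
    and "Comp G g f = Comp G h f"
  shows "g = h"
proof -
  obtain i where i: "i \<in> Hom G y x" "Comp G f i = Id G y"
    using inverse assms(1,2,4) by blast
  show ?thesis
    using Comp_assoc[OF assms(2,1,2,3) i(1) assms(4,5)] Comp_assoc[OF assms(2,1,2,3) i(1) assms(4,6)]
      assms i Comp_Id_right by metis
qed

lemma Comp_cancel_left:
  assumes "x \<in> Obj G" "y \<in> Obj G" "z \<in> Obj G" "f \<in> Hom G x y" "g \<in> Hom G x y" "h \<in> Hom G y z"
    and "Comp G h f = Comp G h g"
  shows "f = g"
proof -
  obtain i where i: "i \<in> Hom G z y" "Comp G i h = Id G y"
    using inverse assms(2,3,6) by blast
  show ?thesis
    using Comp_assoc[OF assms(1,2,3,2,4,6) i(1)] Comp_assoc[OF assms(1,2,3,2,5,6) i(1)]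
      assms i Comp_Id_left by metis
qed

lemma divide_right:
  assumes "x \<in> Obj G" "y \<in> Obj G" "z \<in> Obj G" "f \<in> Hom G x y" "h \<in> Hom G x z"
  shows "\<exists>g\<in>Hom G y z. Comp G g f = h"
proof -
  obtain i where i: "i \<in> Hom G y x" "Comp G i f = Id G x"
    using inverse assms(1,2,4) by blast
  have "Comp G (Comp G h i) f = h"
    using Comp_assoc[OF assms(1,2,1,3,4) i(1) assms(5)] i Comp_Id_right assms by simp
  then show ?thesis using Comp_in assms i by blast
qed

lemma card_Hom_eq:
  assumes "x \<in> Obj G" "y \<in> Obj G" "z \<in> Obj G" "Hom G y z \<noteq> {}"
  shows "card (Hom G x y) = card (Hom G x z)"
proof -
  obtain g where g: "g \<in> Hom G y z" using assms by blast
  obtain h where h: "h \<in> Hom G z y" "Comp G g h = Id G z" using inverse assms g by blast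
  have "bij_betw (Comp G g) (Hom G x y) (Hom G x z)"
  proof (rule bij_betw_imageI)
    show "inj_on (Comp G g) (Hom G x y)"
      using Comp_cancel_left[OF assms(1-3)] g by (auto intro: inj_onI)
    show "Comp G g ` Hom G x y = Hom G x z"
    proof
      show "Comp G g ` Hom G x y \<subseteq> Hom G x z" using Comp_in assms g by blast
      show "Hom G x z \<subseteq> Comp G g ` Hom G x y"
      proof
        fix k assume k: "k \<in> Hom G x z"
        have "k = Comp G g (Comp G h k)"
          using Comp_assoc[OF assms(1,3,2,3) k h(1) g] h Comp_Id_left assms k by simp
        then show "k \<in> Comp G g ` Hom G x y" using Comp_in assms k h by blast
      qed
    qed
  qed
  then show ?thesis by (rule bij_betw_same_card)
qed

lemma card_Hom_eq':
  assumes "x \<in> Obj G" "y \<in> Obj G" "z \<in> Obj G" "Hom G y z \<noteq> {}"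
  shows "card (Hom G z x) = card (Hom G y x)"
proof -
  obtain g where g: "g \<in> Hom G y z" using assms by blast
  have "bij_betw (\<lambda>f. Comp G f g) (Hom G z x) (Hom G y x)"
  proof (rule bij_betw_imageI)
    show "inj_on (\<lambda>f. Comp G f g) (Hom G z x)"
      using Comp_cancel_right[OF assms(2,3,1) g] by (auto intro: inj_onI)
    show "(\<lambda>f. Comp G f g) ` Hom G z x = Hom G y x"
      using Comp_in[OF assms(2,3,1) g] divide_right[OF assms(2,3,1) g] by blast
  qed
  then show ?thesis by (rule bij_betw_same_card)
qed

lemma Hom_sym: "\<lbrakk>x \<in> Obj G; y \<in> Obj G; Hom G x y \<noteq> {}\<rbrakk> \<Longrightarrow> Hom G y x \<noteq> {}"
  using left_inverse by blast

lemma Hom_trans: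
  "\<lbrakk>x \<in> Obj G; y \<in> Obj G; z \<in> Obj G; Hom G x y \<noteq> {}; Hom G y z \<noteq> {}\<rbrakk> \<Longrightarrow> Hom G x z \<noteq> {}"
  using Comp_in by blast

lemma equiv_iso: "equiv (Obj G) {(x, y). x \<in> Obj G \<and> y \<in> Obj G \<and> Hom G x y \<noteq> {}}"
proof (rule equivI)
  show "refl_on (Obj G) {(x, y). x \<in> Obj G \<and> y \<in> Obj G \<and> Hom G x y \<noteq> {}}"
    using Id_in by (auto simp: refl_on_def)
  show "sym {(x, y). x \<in> Obj G \<and> y \<in> Obj G \<and> Hom G x y \<noteq> {}}"
    using Hom_sym by (auto simp: sym_def)
  show "trans {(x, y). x \<in> Obj G \<and> y \<in> Obj G \<and> Hom G x y \<noteq> {}}"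
    using Hom_trans unfolding trans_def by blast
qed auto

end

text \<open>Arrows are tagged by their targets, because hom-sets of different pairs of objects may
  overlap.\<close>

definition outs :: "('o, 'm) groupoid \<Rightarrow> 'o \<Rightarrow> ('o \<times> 'm) set" where
  "outs G x = (SIGMA y:Obj G. Hom G x y)"

definition component :: "('o, 'm) groupoid \<Rightarrow> 'o \<Rightarrow> 'o set" where
  "component G x = {y \<in> Obj G. Hom G x y \<noteq> {}}"

lemma pi0_eq: "pi0 G = component G ` Obj G"
  by (auto simp: pi0_def quotient_def component_def)

lemma (in is_groupoid) component_self: "x \<in> Obj G \<Longrightarrow> x \<in> component G x"
  using Id_in by (auto simp: component_def)

lemma (in is_groupoid) component_eq:
  "\<lbrakk>x \<in> Obj G; y \<in> component G x\<rbrakk> \<Longrightarrow> component G y = component G x"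
  by (auto simp: component_def dest: Hom_trans[of y x] Hom_trans[of x y] Hom_sym[of x y])

lemma (in is_groupoid) repr_in:
  assumes "c \<in> pi0 G"
  shows "repr c \<in> c" "repr c \<in> Obj G" "component G (repr c) = c"
proof -
  obtain x where x: "x \<in> Obj G" "c = component G x" using assms by (auto simp: pi0_eq)
  show r: "repr c \<in> c" unfolding repr_def by (rule someI[of _ x]) (use x component_self in auto)
  then show "repr c \<in> Obj G" using x by (auto simp: component_def)
  show "component G (repr c) = c" using r x component_eq by simp
qed

lemma (in is_groupoid) card_outs:
  assumes "x \<in> Obj G" "finite (component G x)"
  shows "card (outs G x) = card (component G x) * card (Hom G x x)"
proof -
  have fin: "finite (Hom G x y)" if "y \<in> Obj G" "finite (Hom G x x)" for y
    using card_Hom_eq[OF assms(1,1) that(1)] that Id_in[OF assms(1)]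
    by (metis card_gt_0_iff empty_iff finite.emptyI)
  have eq: "outs G x = (SIGMA y:component G x. Hom G x y)"
    by (auto simp: outs_def component_def)
  show ?thesis
  proof (cases "finite (Hom G x x)")
    case True
    have "card (outs G x) = (\<Sum>y\<in>component G x. card (Hom G x y))"
      unfolding eq by (rule card_SigmaI) (use assms fin True in \<open>auto simp: component_def\<close>)
    also have "\<dots> = (\<Sum>y\<in>component G x. card (Hom G x x))"
    proof (rule sum.cong[OF refl])
      fix y assume "y \<in> component G x"
      then show "card (Hom G x y) = card (Hom G x x)"
        using card_Hom_eq[OF assms(1,1), of y] by (simp add: component_def)
    qed
    finally show ?thesis by simp
  next
    \<comment> \<open>With infinitely many automorphisms both sides are 0, since \<open>card\<close>
      is 0 on infinite sets.\<close>
    case False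
    have "Pair x ` Hom G x x \<subseteq> outs G x" using assms by (auto simp: outs_def)
    moreover have "infinite (Pair x ` Hom G x x)"
      using False finite_imageD[of "Pair x" "Hom G x x"] by (auto simp: inj_on_def)
    ultimately have "infinite (outs G x)" by (rule infinite_super)
    then show ?thesis using False by simp
  qed
qed

text \<open>Each component contributes \<open>card c\<close> objects, all with \<open>card c * card (Aut c)\<close> outgoing arrows.\<close>

lemma (in is_groupoid) hcard_eq_sum_objects:
  assumes "finite (Obj G)"
  shows "hcard G = (\<Sum>x\<in>Obj G. 1 / of_nat (card (outs G x)))"
proof -
  have un: "Obj G = \<Union> (pi0 G)"
    using equiv_iso by (simp add: pi0_def Union_quotient)
  have "(\<Sum>x\<in>Obj G. 1 / of_nat (card (outs G x)) :: rat)
      = (\<Sum>c\<in>pi0 G. \<Sum>x\<in>c. 1 / of_nat (card (outs G x)))"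
  proof (subst un, rule sum.Union_disjoint[unfolded o_def])
    show "\<forall>c\<in>pi0 G. finite c"
      using assms un by (metis Union_upper finite_subset)
    show "\<forall>A\<in>pi0 G. \<forall>B\<in>pi0 G. A \<noteq> B \<longrightarrow> A \<inter> B = {}"
      using quotient_disj[OF equiv_iso] by (auto simp: pi0_def)
  qed
  also have "\<dots> = (\<Sum>c\<in>pi0 G. 1 / aut_card G (repr c))"
  proof (rule sum.cong[OF refl])
    fix c assume c: "c \<in> pi0 G"
    note r = repr_in[OF c]
    have fin: "finite c" using assms c un by (metis Union_upper finite_subset)
    have "card (outs G x) = card c * card (Hom G (repr c) (repr c))" if x: "x \<in> c" for x
    proof -
      have xG: "x \<in> Obj G" using x un c by auto
      have cx: "component G x = c"
        using component_eq[of "repr c" x] r x by simp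
      have "Hom G (repr c) x \<noteq> {}" using x r(3) by (auto simp: component_def)
      then have "card (Hom G x x) = card (Hom G (repr c) (repr c))"
      proof -
        show ?thesis
          using card_Hom_eq'[OF xG r(2) xG \<open>Hom G (repr c) x \<noteq> {}\<close>]
            card_Hom_eq[OF r(2) r(2) xG \<open>Hom G (repr c) x \<noteq> {}\<close>] by simp
      qed
      then show ?thesis using card_outs[OF xG] cx fin by simp
    qed
    then have "(\<Sum>x\<in>c. 1 / of_nat (card (outs G x)) :: rat)
        = (\<Sum>x\<in>c. 1 / (of_nat (card c) * aut_card G (repr c)))"
      by (simp add: aut_card_def)
    also have "\<dots> = 1 / aut_card G (repr c)"
      using fin r(1) by (auto simp: card_gt_0_iff)
    finally show "(\<Sum>x\<in>c. 1 / of_nat (card (outs G x)) :: rat) = 1 / aut_card G (repr c)" .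
  qed
  finally show ?thesis by (simp add: hcard_def)
qed

section \<open>Functors\<close>

definition is_functor :: "('o, 'm, 'p, 'n) gfunctor \<Rightarrow> ('o, 'm) groupoid \<Rightarrow> ('p, 'n) groupoid \<Rightarrow> bool" where
  "is_functor F G H \<longleftrightarrow>
     (\<forall>x\<in>Obj G. ob F x \<in> Obj H) \<and>
     (\<forall>x\<in>Obj G. \<forall>y\<in>Obj G. \<forall>f\<in>Hom G x y. ar F f \<in> Hom H (ob F x) (ob F y)) \<and>
     (\<forall>x\<in>Obj G. \<forall>y\<in>Obj G. \<forall>z\<in>Obj G. \<forall>f\<in>Hom G x y. \<forall>g\<in>Hom G y z.
        ar F (Comp G g f) = Comp H (ar F g) (ar F f))"

lemma is_functorI:
  assumes "\<And>x. x \<in> Obj G \<Longrightarrow> ob F x \<in> Obj H"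
    and "\<And>x y f. \<lbrakk>x \<in> Obj G; y \<in> Obj G; f \<in> Hom G x y\<rbrakk> \<Longrightarrow> ar F f \<in> Hom H (ob F x) (ob F y)"
    and "\<And>x y z f g. \<lbrakk>x \<in> Obj G; y \<in> Obj G; z \<in> Obj G; f \<in> Hom G x y; g \<in> Hom G y z\<rbrakk>
      \<Longrightarrow> ar F (Comp G g f) = Comp H (ar F g) (ar F f)"
  shows "is_functor F G H"
  using assms unfolding is_functor_def by blast

lemma is_functorD:
  assumes "is_functor F G H"
  shows functor_ob: "x \<in> Obj G \<Longrightarrow> ob F x \<in> Obj H"
    and functor_ar: "\<lbrakk>x \<in> Obj G; y \<in> Obj G; f \<in> Hom G x y\<rbrakk> \<Longrightarrow> ar F f \<in> Hom H (ob F x) (ob F y)"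
    and functor_Comp: "\<lbrakk>x \<in> Obj G; y \<in> Obj G; z \<in> Obj G; f \<in> Hom G x y; g \<in> Hom G y z\<rbrakk>
      \<Longrightarrow> ar F (Comp G g f) = Comp H (ar F g) (ar F f)"
  using assms unfolding is_functor_def by blast+

text \<open>The image of an identity is idempotent, and by cancellation an idempotent arrow of a
  groupoid is an identity; so preservation of composition suffices.\<close>

lemma functor_Id:
  assumes "is_functor F G H" "is_groupoid G" "is_groupoid H" "x \<in> Obj G"
  shows "ar F (Id G x) = Id H (ob F x)"
proof -
  interpret G: is_groupoid G by fact
  interpret H: is_groupoid H by fact
  note F = functor_ob[OF assms(1)] functor_ar[OF assms(1)] functor_Comp[OF assms(1)]
  have "Comp H (ar F (Id G x)) (ar F (Id G x)) = Comp H (Id H (ob F x)) (ar F (Id G x))"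
    using F(3)[OF assms(4,4,4) G.Id_in G.Id_in] G.Comp_Id_left H.Comp_Id_left F(1,2) G.Id_in assms(4)
    by metis
  then show ?thesis
    using H.Comp_cancel_right[of "ob F x" "ob F x" "ob F x" "ar F (Id G x)"] F(1,2) G.Id_in H.Id_in assms(4)
    by blast
qed

lemma is_functor_compF:
  "\<lbrakk>is_functor F G H; is_functor F' H K\<rbrakk> \<Longrightarrow> is_functor (F' \<odot> F) G K"
proof (rule is_functorI)
  fix x y z f g
  assume F: "is_functor F G H" "is_functor F' H K"
    and a: "x \<in> Obj G" "y \<in> Obj G" "z \<in> Obj G" "f \<in> Hom G x y" "g \<in> Hom G y z"
  show "ar (F' \<odot> F) (Comp G g f) = Comp K (ar (F' \<odot> F) g) (ar (F' \<odot> F) f)"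
    using functor_Comp[OF F(1) a]
      functor_Comp[OF F(2) functor_ob[OF F(1) a(1)] functor_ob[OF F(1) a(2)] functor_ob[OF F(1) a(3)]
        functor_ar[OF F(1) a(1,2,4)] functor_ar[OF F(1) a(2,3,5)]]
    by (simp add: compF_def)
qed (simp_all add: compF_def is_functor_def)

lemma compF_sel [simp]: "ob (G \<odot> F) x = ob G (ob F x)" "ar (G \<odot> F) f = ar G (ar F f)"
  by (simp_all add: compF_def)

section \<open>Products, relabellings and pullbacks of groupoids\<close>

lemma is_groupoid_prod:
  assumes "is_groupoid G" "is_groupoid H"
  shows "is_groupoid (prod_groupoid G H)"
proof -
  interpret G: is_groupoid G by fact
  interpret H: is_groupoid H by fact
  show ?thesis
  proof (unfold_locales, goal_cases)
    case (5 xx yy ff)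
    then obtain x x' y y' f f' where s: "xx = (x, x')" "yy = (y, y')" "ff = (f, f')"
      and a: "x \<in> Obj G" "x' \<in> Obj H" "y \<in> Obj G" "y' \<in> Obj H" "f \<in> Hom G x y" "f' \<in> Hom H x' y'"
      by (auto simp: prod_groupoid_def)
    obtain g where "g \<in> Hom G y x" "Comp G g f = Id G x" using G.left_inverse a by blast
    moreover obtain g' where "g' \<in> Hom H y' x'" "Comp H g' f' = Id H x'" using H.left_inverse a by blast
    ultimately show ?case
      by (auto simp: s prod_groupoid_def)
  qed (auto simp: prod_groupoid_def intro: G.Id_in H.Id_in G.Comp_in H.Comp_in G.Comp_assoc H.Comp_assoc G.Comp_Id_left H.Comp_Id_left)
qed

lemma is_groupoid_full_subgroupoid:
  assumes "is_groupoid G" shows "is_groupoid (full_subgroupoid A G)"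
proof -
  interpret G: is_groupoid G by fact
  show ?thesis
    by unfold_locales
      (auto simp: full_subgroupoid_def G.Id_in G.Comp_Id_left G.left_inverse
        elim!: G.Comp_in[rotated 3] G.Comp_assoc[rotated 4])
qed

lemma is_groupoid_relabel:
  assumes "is_groupoid G" "inj (ob F)" "inj (ar F)"
  shows "is_groupoid (relabel F G)"
proof -
  interpret G: is_groupoid G by fact
  note [simp] = assms(2,3)
  show ?thesis
  proof (unfold_locales, goal_cases)
    case (2 x y z f g)
    then show ?case by (auto simp: relabel_def intro!: imageI elim!: G.Comp_in[rotated 3])
  next
    case (3 w x y z f g h)
    then show ?case by (auto simp: relabel_def intro!: arg_cong[of _ _ "ar F"] elim!: G.Comp_assoc[rotated 4])
  next
    case (5 x y f)
    then obtain x' y' f' where s: "x = ob F x'" "y = ob F y'" "f = ar F f'"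
      "x' \<in> Obj G" "y' \<in> Obj G" "f' \<in> Hom G x' y'"
      by (auto simp: relabel_def)
    then show ?case using G.left_inverse[OF s(4-6)] by (simp add: relabel_def) (metis (no_types))
  qed (auto simp: relabel_def G.Id_in G.Comp_Id_left)
qed

lemma is_functor_relabel:
  assumes "inj (ob F)" "inj (ar F)"
  shows "is_functor F G (relabel F G)"
  using assms by (auto simp: is_functor_def relabel_def)

lemma is_functor_inv_functor:
  assumes "inj (ob F)" "inj (ar F)"
  shows "is_functor (inv_functor F) (relabel F G) G"
  using assms by (auto simp: is_functor_def relabel_def inv_functor_def)

lemma card_Hom_relabel:
  assumes "inj (ob F)" "inj (ar F)"
  shows "card (Hom (relabel F G) (ob F x) (ob F y)) = card (Hom G x y)"
  using assms by (simp add: relabel_def card_image inj_on_subset)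

lemma outs_relabel:
  assumes "inj (ob F)" "inj (ar F)"
  shows "outs (relabel F G) (ob F x) = map_prod (ob F) (ar F) ` outs G x"
proof
  show "outs (relabel F G) (ob F x) \<subseteq> map_prod (ob F) (ar F) ` outs G x"
  proof
    fix u assume "u \<in> outs (relabel F G) (ob F x)"
    then obtain y f where "u = (ob F y, ar F f)" "y \<in> Obj G" "f \<in> Hom G x y"
      using assms by (auto simp: outs_def relabel_def)
    then show "u \<in> map_prod (ob F) (ar F) ` outs G x"
      by (intro image_eqI[of _ _ "(y, f)"]) (auto simp: outs_def)
  qed
  show "map_prod (ob F) (ar F) ` outs G x \<subseteq> outs (relabel F G) (ob F x)"
    using assms by (auto simp: outs_def relabel_def)
qed

lemma is_groupoid_pullback:
  assumes "is_groupoid G" "is_groupoid H" "is_groupoid B" "is_functor F G B" "is_functor F' H B"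
  shows "is_groupoid (pullback F F' G H)"
proof -
  interpret G: is_groupoid G by fact
  interpret H: is_groupoid H by fact
  interpret B: is_groupoid B by fact
  note F = functor_ob[OF assms(4)] functor_ar[OF assms(4)] functor_Comp[OF assms(4)]
    functor_Id[OF assms(4,1,3)]
  note F' = functor_ob[OF assms(5)] functor_ar[OF assms(5)] functor_Comp[OF assms(5)]
    functor_Id[OF assms(5,2,3)]
  show ?thesis
  proof
    fix x y f
    assume a: "x \<in> Obj (pullback F F' G H)" "y \<in> Obj (pullback F F' G H)" "f \<in> Hom (pullback F F' G H) x y"
    obtain x1 x2 y1 y2 f1 f2 where s: "x = (x1, x2)" "y = (y1, y2)" "f = (f1, f2)"
      by (metis surj_pair)
    have b: "x1 \<in> Obj G" "x2 \<in> Obj H" "y1 \<in> Obj G" "y2 \<in> Obj H" "f1 \<in> Hom G x1 y1" "f2 \<in> Hom H x2 y2"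
      "ob F x1 = ob F' x2" "ob F y1 = ob F' y2" "ar F f1 = ar F' f2"
      using a by (auto simp: s pullback_def prod_groupoid_def)
    obtain g1 where g1: "g1 \<in> Hom G y1 x1" "Comp G g1 f1 = Id G x1" using G.left_inverse b by blast
    obtain g2 where g2: "g2 \<in> Hom H y2 x2" "Comp H g2 f2 = Id H x2" using H.left_inverse b by blast
    \<comment> \<open>The two inverses must agree in \<open>B\<close> to form an arrow of the
      pullback. Both of their images compose with the common image of \<open>f1\<close> and
      \<open>f2\<close> to an identity, so cancellation applies.\<close>
    have "Comp B (ar F g1) (ar F f1) = Comp B (ar F' g2) (ar F f1)"
      using F(3)[OF b(1,3,1,5) g1(1)] F'(3)[OF b(2,4,2,6) g2(1)] F(4) F'(4) b g1(2) g2(2) by simp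
    then have "ar F g1 = ar F' g2"
      using B.Comp_cancel_right[of "ob F x1" "ob F y1" "ob F x1" "ar F f1" "ar F g1" "ar F' g2"]
        F(1,2) F'(1,2) b g1(1) g2(1) by (metis (no_types))
    then show "\<exists>g\<in>Hom (pullback F F' G H) y x. Comp (pullback F F' G H) g f = Id (pullback F F' G H) x"
      using g1 g2 b by (intro bexI[of _ "(g1, g2)"]) (auto simp: s pullback_def prod_groupoid_def)
  qed (auto simp: pullback_def prod_groupoid_def F(3,4) F'(3,4) G.Id_in H.Id_in
      intro: G.Comp_in H.Comp_in G.Comp_assoc H.Comp_assoc G.Comp_Id_left H.Comp_Id_left)
qed

lemma is_functor_fstF_pullback: "is_functor fstF (pullback F F' G H) G"
  and is_functor_sndF_pullback: "is_functor sndF (pullback F F' G H) H"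
  by (auto simp: is_functor_def pullback_def prod_groupoid_def fstF_def sndF_def)

text \<open>If \<open>F'\<close> lifts arrows uniquely from \<open>y\<close> on, like a discrete
  opfibration, the second component of an arrow leaving \<open>(x, y)\<close> is forced by the
  first. With the source functor of the operad as \<open>F'\<close>, this reduces the count for
  trees to one for the tuples of their tops.\<close>

lemma card_outs_pullback:
  assumes F: "is_functor F G B" and xy: "(x, y) \<in> Obj (pullback F F' G H)"
    and unique_lift: "\<And>z b. \<lbrakk>z \<in> Obj B; b \<in> Hom B (ob F' y) z\<rbrakk>
      \<Longrightarrow> \<exists>!(y', g). y' \<in> Obj H \<and> g \<in> Hom H y y' \<and> ob F' y' = z \<and> ar F' g = b"
  shows "card (outs (pullback F F' G H) (x, y)) = card (outs G x)"
proof -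
  let ?p = "\<lambda>((x', y'), (f, g)). (x', f)"
  have lift: "\<exists>!(y', g). y' \<in> Obj H \<and> g \<in> Hom H y y' \<and> ob F' y' = ob F x' \<and> ar F' g = ar F f"
    if "x' \<in> Obj G" "f \<in> Hom G x x'" for x' f
    using unique_lift[of "ob F x'" "ar F f"] functor_ob[OF F] functor_ar[OF F, of x x' f] that xy
    by (simp add: pullback_def prod_groupoid_def)
  have "bij_betw ?p (outs (pullback F F' G H) (x, y)) (outs G x)"
  proof (rule bij_betw_imageI)
    show "inj_on ?p (outs (pullback F F' G H) (x, y))"
    proof (rule inj_onI)
      fix u v assume uv: "u \<in> outs (pullback F F' G H) (x, y)" "v \<in> outs (pullback F F' G H) (x, y)" "?p u = ?p v"
      obtain x' f y1 g1 y2 g2 where s: "u = ((x', y1), (f, g1))" "v = ((x', y2), (f, g2))"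
        using uv(3) by (auto split: prod.splits)
      show "u = v"
        using lift[of x' f] uv(1,2) by (auto simp: s outs_def pullback_def prod_groupoid_def)
    qed
    show "?p ` outs (pullback F F' G H) (x, y) = outs G x"
    proof
      show "?p ` outs (pullback F F' G H) (x, y) \<subseteq> outs G x"
        by (auto simp: outs_def pullback_def prod_groupoid_def)
      show "outs G x \<subseteq> ?p ` outs (pullback F F' G H) (x, y)"
      proof
        fix u assume "u \<in> outs G x"
        then obtain x' f where u: "u = (x', f)" "x' \<in> Obj G" "f \<in> Hom G x x'" by (auto simp: outs_def)
        obtain y' g where "y' \<in> Obj H" "g \<in> Hom H y y'" "ob F' y' = ob F x'" "ar F' g = ar F f"
          using lift[OF u(2,3)] by auto
        then show "u \<in> ?p ` outs (pullback F F' G H) (x, y)"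
          using u by (intro image_eqI[of _ _ "((x', y'), (f, g))"]) (auto simp: outs_def pullback_def prod_groupoid_def)
      qed
    qed
  qed
  then show ?thesis by (rule bij_betw_same_card)
qed

section \<open>Homotopy fibres\<close>

lemma is_groupoid_hofibre:
  assumes "is_groupoid G" "is_groupoid H" "is_functor F G H" "y \<in> Obj H"
  shows "is_groupoid (hofibre F G H y)"
proof -
  interpret G: is_groupoid G by fact
  interpret H: is_groupoid H by fact
  note F = functor_ob[OF assms(3)] functor_ar[OF assms(3)] functor_Comp[OF assms(3)]
    functor_Id[OF assms(3,1,2)]
  show ?thesis
  proof (unfold_locales; clarsimp simp: hofibre_def)
    fix x and \<phi> assume "x \<in> Obj G" "\<phi> \<in> Hom H (ob F x) y"
    then show "Id G x \<in> Hom G x x \<and> Comp H \<phi> (ar F (Id G x)) = \<phi>"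
      using F(1,4) H.Comp_Id_right assms(4) G.Id_in by simp
  next
    fix x x' x'' f g \<phi>
    assume a: "x \<in> Obj G" "x' \<in> Obj G" "x'' \<in> Obj G" "f \<in> Hom G x x'" "g \<in> Hom G x' x''"
      "\<phi> \<in> Hom H (ob F x'') y"
    show "Comp G g f \<in> Hom G x x'' \<and> Comp H \<phi> (ar F (Comp G g f)) = Comp H (Comp H \<phi> (ar F g)) (ar F f)"
      using a F(3)[OF a(1-5)] G.Comp_in[OF a(1-5)]
        H.Comp_assoc[of "ob F x" "ob F x'" "ob F x''" y "ar F f" "ar F g" \<phi>] F(1,2) assms(4) by simp
  next
    fix x x' f \<phi>
    assume a: "x \<in> Obj G" "x' \<in> Obj G" "f \<in> Hom G x x'" "\<phi> \<in> Hom H (ob F x') y"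
    obtain g where g: "g \<in> Hom G x' x" "Comp G g f = Id G x" "Comp G f g = Id G x'"
      using G.inverse[OF a(1-3)] by blast
    have "Comp H \<phi> (Comp H (ar F f) (ar F g)) = \<phi>"
      using F(3)[OF a(2,1,2) g(1) a(3)] g(3) F(1,4) a H.Comp_Id_right assms(4) by metis
    then have "Comp H (Comp H \<phi> (ar F f)) (ar F g) = \<phi>"
      using H.Comp_assoc[of "ob F x'" "ob F x" "ob F x'" y "ar F g" "ar F f" \<phi>] F(1,2) a g assms(4)
      by simp
    then show "\<exists>g. g \<in> Hom G x' x \<and> Comp H (Comp H \<phi> (ar F f)) (ar F g) = \<phi> \<and> Comp G g f = Id G x"
      using g by blast
  qed (auto intro: G.Comp_assoc G.Comp_Id_left)
qed

text \<open>Once an arrow \<open>f\<close> of \<open>G\<close> leaving \<open>x\<close> is chosen,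
  the label \<psi> of its target must solve \<psi> F(f) = \<phi>, and in a groupoid this equation
  has exactly one solution.\<close>

lemma card_outs_hofibre:
  assumes "is_groupoid G" "is_groupoid H" "is_functor F G H" "y \<in> Obj H"
    and x\<phi>: "(x, \<phi>) \<in> Obj (hofibre F G H y)"
  shows "card (outs (hofibre F G H y) (x, \<phi>)) = card (outs G x)"
proof -
  interpret G: is_groupoid G by fact
  interpret H: is_groupoid H by fact
  note F = functor_ob[OF assms(3)] functor_ar[OF assms(3)]
  have x: "x \<in> Obj G" "\<phi> \<in> Hom H (ob F x) y" using x\<phi> by (auto simp: hofibre_def)
  let ?p = "\<lambda>((x', \<phi>'), f). (x', f)"
  have "bij_betw ?p (outs (hofibre F G H y) (x, \<phi>)) (outs G x)"
  proof (rule bij_betw_imageI)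
    show "inj_on ?p (outs (hofibre F G H y) (x, \<phi>))"
    proof (rule inj_onI)
      fix u v assume uv: "u \<in> outs (hofibre F G H y) (x, \<phi>)" "v \<in> outs (hofibre F G H y) (x, \<phi>)" "?p u = ?p v"
      obtain x' f \<psi> \<chi> where s: "u = ((x', \<psi>), f)" "v = ((x', \<chi>), f)"
        using uv(3) by (auto split: prod.splits)
      show "u = v"
        using uv(1,2) H.Comp_cancel_right[of "ob F x" "ob F x'" y "ar F f" \<psi> \<chi>] F assms(4) x(1)
        by (auto simp: s outs_def hofibre_def)
    qed
    show "?p ` outs (hofibre F G H y) (x, \<phi>) = outs G x"
    proof
      show "?p ` outs (hofibre F G H y) (x, \<phi>) \<subseteq> outs G x"
        by (auto simp: outs_def hofibre_def)
      show "outs G x \<subseteq> ?p ` outs (hofibre F G H y) (x, \<phi>)"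
      proof
        fix u assume "u \<in> outs G x"
        then obtain x' f where u: "u = (x', f)" "x' \<in> Obj G" "f \<in> Hom G x x'" by (auto simp: outs_def)
        obtain \<psi> where "\<psi> \<in> Hom H (ob F x') y" "Comp H \<psi> (ar F f) = \<phi>"
          using H.divide_right[of "ob F x" "ob F x'" y "ar F f" \<phi>] F assms(4) x u by blast
        then show "u \<in> ?p ` outs (hofibre F G H y) (x, \<phi>)"
          using u by (intro image_eqI[of _ _ "((x', \<psi>), f)"]) (auto simp: outs_def hofibre_def)
      qed
    qed
  qed
  then show ?thesis by (rule bij_betw_same_card)
qed

section \<open>Tuples up to permutation\<close>

abbreviation perms :: "nat \<Rightarrow> nat list set" where
  "perms n \<equiv> permutations_of_set {..<n}"

lemma permsD:
  assumes "\<sigma> \<in> perms n"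
  shows perms_length: "length \<sigma> = n" and perms_set: "set \<sigma> = {..<n}" and perms_distinct: "distinct \<sigma>"
    and perms_nth: "i < n \<Longrightarrow> \<sigma> ! i < n"
proof -
  show 1: "set \<sigma> = {..<n}" "distinct \<sigma>" using assms by (auto simp: permutations_of_set_def)
  then show 2: "length \<sigma> = n" using distinct_card[of \<sigma>] by simp
  show "i < n \<Longrightarrow> \<sigma> ! i < n" using 1(1) 2 nth_mem[of i \<sigma>] by auto
qed

lemma permsI: "\<lbrakk>length \<sigma> = n; set \<sigma> = {..<n}\<rbrakk> \<Longrightarrow> \<sigma> \<in> perms n"
  by (simp add: permutations_of_set_def card_distinct)

lemma perms_nth_surj: "\<lbrakk>\<sigma> \<in> perms n; p < n\<rbrakk> \<Longrightarrow> \<exists>i<n. \<sigma> ! i = p"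
  by (metis in_set_conv_nth lessThan_iff perms_length perms_set)

lemma bij_betw_perms_nth: "\<sigma> \<in> perms n \<Longrightarrow> bij_betw ((!) \<sigma>) {..<n} {..<n}"
  by (metis bij_betw_nth perms_distinct perms_length perms_set)

lemma upt_in_perms: "[0..<n] \<in> perms n"
  by (rule permsI) auto

lemma map_nth_in_perms: "\<lbrakk>\<sigma> \<in> perms n; \<tau> \<in> perms n\<rbrakk> \<Longrightarrow> map ((!) \<sigma>) \<tau> \<in> perms n"
  by (rule permsI) (use bij_betw_perms_nth[of \<sigma> n] in \<open>auto simp: perms_length perms_set bij_betw_def\<close>)

lemma perms_inverse:
  assumes "\<sigma> \<in> perms n"
  shows "\<exists>\<tau>\<in>perms n. (\<forall>i<n. \<sigma> ! (\<tau> ! i) = i) \<and> (\<forall>i<n. \<tau> ! (\<sigma> ! i) = i)"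
proof -
  let ?g = "inv_into {..<n} ((!) \<sigma>)"
  let ?t = "map ?g [0..<n]"
  note b = bij_betw_perms_nth[OF assms]
  have "?t \<in> perms n"
    using bij_betw_inv_into[OF b] by (intro permsI) (auto simp: bij_betw_def atLeast0LessThan)
  moreover have "\<sigma> ! (?t ! i) = i" if "i < n" for i
    using that b by (simp add: bij_betw_inv_into_right[OF b])
  moreover have "?t ! (\<sigma> ! i) = i" if "i < n" for i
    using that b perms_nth[OF assms that] by (simp add: bij_betw_inv_into_left[OF b])
  ultimately show ?thesis by blast
qed

lemma map_nth_perms_inverse:
  assumes "\<sigma> \<in> perms n" "\<tau> \<in> perms n" "\<forall>i<n. \<sigma> ! (\<tau> ! i) = i" "length xs = n"
  shows "map ((!) (map ((!) xs) \<sigma>)) \<tau> = xs"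
  using assms by (intro nth_equalityI) (auto simp: perms_length perms_nth)

lemma mset_map_nth_perms:
  assumes "\<sigma> \<in> perms (length xs)"
  shows "mset (map ((!) xs) \<sigma>) = mset xs"
proof -
  have "mset \<sigma> = mset [0..<length xs]"
    using assms perms_set[OF assms] perms_distinct[OF assms]
    by (subst set_eq_iff_mset_eq_distinct[symmetric]) (auto simp: atLeast0LessThan)
  then have "image_mset ((!) xs) (mset \<sigma>) = image_mset ((!) xs) (mset [0..<length xs])"
    by simp
  then show ?thesis by (metis map_nth mset_map)
qed

lemma mset_eq_perms:
  assumes "mset xs = mset ys"
  shows "\<exists>\<sigma>\<in>perms (length ys). map ((!) ys) \<sigma> = xs"
proof -
  obtain p where p: "p permutes {..<length ys}" "permute_list p ys = xs"
    using mset_eq_permutation[OF assms] by blast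
  have "map p [0..<length ys] \<in> perms (length ys)"
    using p(1) by (intro permsI) (auto simp: permutes_image atLeast0LessThan)
  moreover have "map ((!) ys) (map p [0..<length ys]) = xs"
    using p by (simp add: permute_list_def o_def)
  ultimately show ?thesis by blast
qed

section \<open>The groupoid of tuples\<close>

lemma Obj_Sr: "Obj (Sr G) = {as. as \<noteq> [] \<and> set as \<subseteq> Obj G}"
  by (simp add: Sr_def tuples_def)

lemma Hom_Sr_iff:
  "(\<sigma>, fs) \<in> Hom (Sr G) as bs \<longleftrightarrow> length as = length bs \<and> length fs = length bs
     \<and> \<sigma> \<in> perms (length bs) \<and> (\<forall>i<length bs. fs ! i \<in> Hom G (as ! (\<sigma> ! i)) (bs ! i))"
  by (simp add: Sr_def tuples_def)

lemma Hom_SrE: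
  assumes "h \<in> Hom (Sr G) as bs"
  obtains \<sigma> fs where "h = (\<sigma>, fs)" "length as = length bs" "length fs = length bs" "\<sigma> \<in> perms (length bs)"
    "\<And>i. i < length bs \<Longrightarrow> fs ! i \<in> Hom G (as ! (\<sigma> ! i)) (bs ! i)"
  using assms by (cases h) (auto simp: Hom_Sr_iff)

lemma Id_Sr: "Id (Sr G) as = ([0..<length as], map (Id G) as)"
  by (simp add: Sr_def tuples_def)

lemma Comp_Sr: "Comp (Sr G) (\<tau>, gs) (\<sigma>, fs) = (map ((!) \<sigma>) \<tau>, map2 (\<lambda>g i. Comp G g (fs ! i)) gs \<tau>)"
  by (simp add: Sr_def tuples_def)

lemma Obj_Sr_nth: "\<lbrakk>as \<in> Obj (Sr G); i < length as\<rbrakk> \<Longrightarrow> as ! i \<in> Obj G"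
  by (auto simp: Obj_Sr)

lemma is_groupoid_Sr:
  assumes "is_groupoid G"
  shows "is_groupoid (Sr G)"
proof -
  interpret G: is_groupoid G by fact
  show ?thesis
  proof (unfold_locales, goal_cases)
    case (1 x)
    then show ?case
      by (auto simp: Id_Sr Hom_Sr_iff upt_in_perms Obj_Sr intro!: G.Id_in)
  next
    case (2 x y z f g)
    obtain \<sigma> fs where f: "f = (\<sigma>, fs)" "length x = length y" "length fs = length y" "\<sigma> \<in> perms (length y)"
      "\<And>i. i < length y \<Longrightarrow> fs ! i \<in> Hom G (x ! (\<sigma> ! i)) (y ! i)" using 2(4) by (blast elim: Hom_SrE)
    obtain \<tau> gs where g: "g = (\<tau>, gs)" "length y = length z" "length gs = length z" "\<tau> \<in> perms (length z)"
      "\<And>i. i < length z \<Longrightarrow> gs ! i \<in> Hom G (y ! (\<tau> ! i)) (z ! i)" using 2(5) by (blast elim: Hom_SrE)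
    have "Comp G (gs ! i) (fs ! (\<tau> ! i)) \<in> Hom G (x ! (\<sigma> ! (\<tau> ! i))) (z ! i)" if "i < length z" for i
    proof -
      have "\<tau> ! i < length z" using perms_nth[OF g(4)] that by simp
      then show ?thesis
        using f g that perms_nth[OF f(4)] 2(1-3) by (intro G.Comp_in[of _ "y ! (\<tau> ! i)"]) (auto intro!: Obj_Sr_nth)
    qed
    then show ?case
      using f g map_nth_in_perms[of \<sigma> "length z" \<tau>] by (simp add: Comp_Sr Hom_Sr_iff perms_length[OF g(4)])
  next
    case (3 w x y z f g h)
    obtain \<sigma> fs where f: "f = (\<sigma>, fs)" "length w = length x" "length fs = length x" "\<sigma> \<in> perms (length x)"
      "\<And>i. i < length x \<Longrightarrow> fs ! i \<in> Hom G (w ! (\<sigma> ! i)) (x ! i)" using 3(5) by (blast elim: Hom_SrE)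
    obtain \<tau> gs where g: "g = (\<tau>, gs)" "length x = length y" "length gs = length y" "\<tau> \<in> perms (length y)"
      "\<And>i. i < length y \<Longrightarrow> gs ! i \<in> Hom G (x ! (\<tau> ! i)) (y ! i)" using 3(6) by (blast elim: Hom_SrE)
    obtain \<rho> hs where h: "h = (\<rho>, hs)" "length y = length z" "length hs = length z" "\<rho> \<in> perms (length z)"
      "\<And>i. i < length z \<Longrightarrow> hs ! i \<in> Hom G (y ! (\<rho> ! i)) (z ! i)" using 3(7) by (blast elim: Hom_SrE)
    note l = perms_length[OF f(4)] perms_length[OF g(4)] perms_length[OF h(4)]
    have "Comp G (Comp G (hs ! i) (gs ! (\<rho> ! i))) (fs ! (\<tau> ! (\<rho> ! i)))
        = Comp G (hs ! i) (Comp G (gs ! (\<rho> ! i)) (fs ! (\<tau> ! (\<rho> ! i))))" if i: "i < length z" for i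
    proof -
      have *: "\<rho> ! i < length z" "\<tau> ! (\<rho> ! i) < length z" "\<sigma> ! (\<tau> ! (\<rho> ! i)) < length z"
        using perms_nth[OF h(4) i] perms_nth[OF g(4)] perms_nth[OF f(4)] f(2) g(2) h(2) by auto
      show ?thesis
        using * i f(2,5) g(2,5) h(2,5) 3(1-4)
        by (intro G.Comp_assoc[of "w ! (\<sigma> ! (\<tau> ! (\<rho> ! i)))" "x ! (\<tau> ! (\<rho> ! i))" "y ! (\<rho> ! i)" "z ! i"])
          (auto intro!: Obj_Sr_nth)
    qed
    then show ?case
      using f(1-4) g(1-4) h(1-4) l
      by (auto simp: Comp_Sr perms_nth perms_length perms_set intro!: nth_equalityI)
  next
    case (4 x y f)
    obtain \<sigma> fs where f: "f = (\<sigma>, fs)" "length x = length y" "length fs = length y" "\<sigma> \<in> perms (length y)"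
      "\<And>i. i < length y \<Longrightarrow> fs ! i \<in> Hom G (x ! (\<sigma> ! i)) (y ! i)" using 4(3) by (blast elim: Hom_SrE)
    have "Comp G (Id G (y ! i)) (fs ! i) = fs ! i" if "i < length y" for i
      using that f 4(1,2) perms_nth[OF f(4)] by (intro G.Comp_Id_left[of "x ! (\<sigma> ! i)"]) (auto intro!: Obj_Sr_nth)
    then show ?case
      using f perms_length[OF f(4)] by (auto simp: Comp_Sr Id_Sr intro!: nth_equalityI)
  next
    case (5 x y f)
    obtain \<sigma> fs where f: "f = (\<sigma>, fs)" "length x = length y" "length fs = length y" "\<sigma> \<in> perms (length y)"
      "\<And>i. i < length y \<Longrightarrow> fs ! i \<in> Hom G (x ! (\<sigma> ! i)) (y ! i)" using 5(3) by (blast elim: Hom_SrE)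
    obtain \<tau> where \<tau>: "\<tau> \<in> perms (length y)" "\<forall>i<length y. \<sigma> ! (\<tau> ! i) = i" "\<forall>i<length y. \<tau> ! (\<sigma> ! i) = i"
      using perms_inverse[OF f(4)] by blast
    \<comment> \<open>The entry of \<open>fs\<close> that starts at \<open>x ! i\<close> sits at
      position \<open>\<tau> ! i\<close>, so this is the arrow that component \<open>i\<close> of
      the inverse has to undo.\<close>
    have "\<forall>i<length y. \<exists>g. g \<in> Hom G (y ! (\<tau> ! i)) (x ! i) \<and> Comp G g (fs ! (\<tau> ! i)) = Id G (x ! i)"
    proof (intro allI impI)
      fix i assume i: "i < length y"
      have "\<tau> ! i < length y" using perms_nth[OF \<tau>(1) i] .
      then show "\<exists>g. g \<in> Hom G (y ! (\<tau> ! i)) (x ! i) \<and> Comp G g (fs ! (\<tau> ! i)) = Id G (x ! i)"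
        using G.left_inverse[of "x ! i" "y ! (\<tau> ! i)" "fs ! (\<tau> ! i)"] f(2) f(5)[of "\<tau> ! i"] \<tau>(2) i 5(1,2)
        by (auto simp: Obj_Sr_nth)
    qed
    then obtain g where g: "\<And>i. i < length y \<Longrightarrow>
        g i \<in> Hom G (y ! (\<tau> ! i)) (x ! i) \<and> Comp G (g i) (fs ! (\<tau> ! i)) = Id G (x ! i)"
      by metis
    show ?case
    proof (rule bexI[of _ "(\<tau>, map g [0..<length y])"])
      show "(\<tau>, map g [0..<length y]) \<in> Hom (Sr G) y x"
        using g f(2) \<tau>(1) by (simp add: Hom_Sr_iff)
      show "Comp (Sr G) (\<tau>, map g [0..<length y]) f = Id (Sr G) x"
        using g f \<tau> perms_length[OF \<tau>(1)] by (auto simp: Comp_Sr Id_Sr intro!: nth_equalityI)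
    qed
  qed
qed

lemma mapT_sel [simp]: "ob (mapT F) = map (ob F)" "ar (mapT F) (\<sigma>, fs) = (\<sigma>, map (ar F) fs)"
  by (simp_all add: mapT_def)

lemma is_functor_mapT:
  assumes "is_functor F G H"
  shows "is_functor (mapT F) (Sr G) (Sr H)"
proof (rule is_functorI)
  note F = functor_ob[OF assms] functor_ar[OF assms] functor_Comp[OF assms]
  fix x y f assume a: "x \<in> Obj (Sr G)" "y \<in> Obj (Sr G)" "f \<in> Hom (Sr G) x y"
  obtain \<sigma> fs where f: "f = (\<sigma>, fs)" "length x = length y" "length fs = length y" "\<sigma> \<in> perms (length y)"
    "\<And>i. i < length y \<Longrightarrow> fs ! i \<in> Hom G (x ! (\<sigma> ! i)) (y ! i)" using a(3) by (blast elim: Hom_SrE)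
  show "ar (mapT F) f \<in> Hom (Sr H) (ob (mapT F) x) (ob (mapT F) y)"
    using f perms_nth[OF f(4)] a(1,2) F(2) by (auto simp: Hom_Sr_iff Obj_Sr_nth)
  fix z g assume b: "z \<in> Obj (Sr G)" "g \<in> Hom (Sr G) y z"
  obtain \<tau> gs where g: "g = (\<tau>, gs)" "length y = length z" "length gs = length z" "\<tau> \<in> perms (length z)"
    "\<And>i. i < length z \<Longrightarrow> gs ! i \<in> Hom G (y ! (\<tau> ! i)) (z ! i)" using b(2) by (blast elim: Hom_SrE)
  have "ar F (Comp G (gs ! i) (fs ! (\<tau> ! i))) = Comp H (ar F (gs ! i)) (ar F (fs ! (\<tau> ! i)))"
    if i: "i < length z" for i
  proof -
    have *: "\<tau> ! i < length z" "\<sigma> ! (\<tau> ! i) < length z"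
      using perms_nth[OF g(4) i] perms_nth[OF f(4)] g(2) by auto
    show ?thesis
      using * i f(2,5) g(2,5) a(1,2) b(1)
      by (intro F(3)[of "x ! (\<sigma> ! (\<tau> ! i))" "y ! (\<tau> ! i)" "z ! i"]) (auto intro!: Obj_Sr_nth)
  qed
  then show "ar (mapT F) (Comp (Sr G) g f) = Comp (Sr H) (ar (mapT F) g) (ar (mapT F) f)"
    using f g perms_length[OF g(4)] by (auto simp: Comp_Sr perms_nth intro!: nth_equalityI)
qed (use functor_ob[OF assms] in \<open>auto simp: Obj_Sr\<close>)

section \<open>Flattening and block permutations\<close>

definition offset :: "nat list \<Rightarrow> nat \<Rightarrow> nat" where
  "offset ns i = sum_list (take i ns)"

text \<open>Addressing a position of a concatenation by a block and a place inside it, together with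
  \<open>nth_concat_offset\<close>, reduces the functor laws of \<open>multT\<close> to pointwise
  identities.\<close>

lemma concat_positions:
  "m < length (concat xss) \<Longrightarrow>
    \<exists>i<length xss. \<exists>j<length (xss ! i). m = offset (map length xss) i + j"
proof (induction xss arbitrary: m)
  case (Cons xs xss)
  show ?case
  proof (cases "m < length xs")
    case True
    then show ?thesis by (intro exI[of _ 0]) (auto simp: offset_def)
  next
    case False
    then have "m - length xs < length (concat xss)"
      using Cons.prems by (simp add: less_diff_conv2)
    then obtain i j where "i < length xss" "j < length (xss ! i)" "m - length xs = offset (map length xss) i + j"
      using Cons.IH by blast
    then show ?thesis
      using False by (intro exI[of _ "Suc i"]) (auto simp: offset_def)
  qed
qed simp

lemma nth_concat_offset:
  assumes "map length xss = ns" "i < length xss" "j < length (xss ! i)"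
  shows "concat xss ! (offset ns i + j) = xss ! i ! j" "offset ns i + j < length (concat xss)"
proof -
  have *: "concat xss = concat (take i xss) @ xss ! i @ concat (drop (Suc i) xss)"
    using assms(2) by (metis concat.simps(2) concat_append id_take_nth_drop)
  have l: "length (concat (take i xss)) = offset ns i"
    using assms(1) by (auto simp: offset_def length_concat take_map)
  show "concat xss ! (offset ns i + j) = xss ! i ! j" "offset ns i + j < length (concat xss)"
    using assms(3) l by (subst *, simp add: nth_append)+
qed

text \<open>The permutation part of \<open>multT\<close>, kept as one list for each block of the
  target. \<open>ns\<close> holds the lengths of the source blocks, and the permutation of a block
  is shifted to the place where its source block starts.\<close>

definition block_perm :: "nat list \<Rightarrow> nat list \<Rightarrow> nat list list \<Rightarrow> nat list list" where
  "block_perm ns \<pi> \<sigma>s = map2 (\<lambda>p \<sigma>. map ((+) (offset ns p)) \<sigma>) \<pi> \<sigma>s"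

lemma block_perm_simps:
  "length (block_perm ns \<pi> \<sigma>s) = min (length \<pi>) (length \<sigma>s)"
  "i < min (length \<pi>) (length \<sigma>s) \<Longrightarrow> block_perm ns \<pi> \<sigma>s ! i = map ((+) (offset ns (\<pi> ! i))) (\<sigma>s ! i)"
  "length \<pi> = length \<sigma>s \<Longrightarrow> map length (block_perm ns \<pi> \<sigma>s) = map length \<sigma>s"
  by (auto simp: block_perm_def intro!: nth_equalityI)

lemma sum_list_map_nth_perms:
  fixes f :: "'a \<Rightarrow> 'b :: comm_monoid_add"
  assumes "\<sigma> \<in> perms (length xs)"
  shows "(\<Sum>i<length xs. f (xs ! (\<sigma> ! i))) = (\<Sum>i<length xs. f (xs ! i))"
  using sum.reindex_bij_betw[OF bij_betw_perms_nth[OF assms], of "\<lambda>i. f (xs ! i)"] by simp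

lemma block_perm_in_perms:
  assumes \<pi>: "\<pi> \<in> perms (length ns)" and l: "length \<sigma>s = length ns"
    and \<sigma>: "\<And>i. i < length ns \<Longrightarrow> \<sigma>s ! i \<in> perms (ns ! (\<pi> ! i))"
  shows "concat (block_perm ns \<pi> \<sigma>s) \<in> perms (sum_list ns)"
proof (rule permsI)
  note pl = perms_length[OF \<pi>]
  have ls: "length (\<sigma>s ! i) = ns ! (\<pi> ! i)" if "i < length ns" for i
    using perms_length[OF \<sigma>[OF that]] .
  have "length (concat (block_perm ns \<pi> \<sigma>s)) = sum_list (map length \<sigma>s)"
    using block_perm_simps(3)[of \<pi> \<sigma>s ns] pl l by (simp add: length_concat)
  also have "\<dots> = (\<Sum>i<length ns. ns ! (\<pi> ! i))"
    using l ls by (simp add: sum_list_sum_nth atLeast0LessThan)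
  also have "\<dots> = sum_list ns"
    using sum_list_map_nth_perms[OF \<pi>, of "\<lambda>x. x"] by (simp add: sum_list_sum_nth atLeast0LessThan)
  finally show "length (concat (block_perm ns \<pi> \<sigma>s)) = sum_list ns" .
  \<comment> \<open>An auxiliary nested list with block lengths \<open>ns\<close>, through which the
    numbers below \<open>sum_list ns\<close> are addressed as positions.\<close>
  let ?L = "map (\<lambda>n. [0..<n]) ns"
  have L: "map length ?L = ns" by (auto intro: nth_equalityI)
  have tot: "length (concat ?L) = sum_list ns" by (simp add: length_concat o_def)
  show "set (concat (block_perm ns \<pi> \<sigma>s)) = {..<sum_list ns}"
  proof
    show "set (concat (block_perm ns \<pi> \<sigma>s)) \<subseteq> {..<sum_list ns}"
    proof
      fix m assume "m \<in> set (concat (block_perm ns \<pi> \<sigma>s))"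
      then obtain i j where i: "i < length ns" and j: "j \<in> set (\<sigma>s ! i)" and m: "m = offset ns (\<pi> ! i) + j"
        using pl l by (auto simp: block_perm_def set_zip)
      have "j < ns ! (\<pi> ! i)" using perms_set[OF \<sigma>[OF i]] j by auto
      then show "m \<in> {..<sum_list ns}"
        using nth_concat_offset(2)[OF L, of "\<pi> ! i" j] perms_nth[OF \<pi> i] m tot by simp
    qed
    show "{..<sum_list ns} \<subseteq> set (concat (block_perm ns \<pi> \<sigma>s))"
    proof
      fix m assume "m \<in> {..<sum_list ns}"
      then obtain p j where p: "p < length ns" "j < ns ! p" "m = offset ns p + j"
        using concat_positions[of m ?L] tot L by auto
      obtain i where i: "i < length ns" "\<pi> ! i = p" using perms_nth_surj[OF \<pi> p(1)] by blast
      have "j \<in> set (\<sigma>s ! i)" using perms_set[OF \<sigma>[OF i(1)]] i p by simp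
      then have "m \<in> set (block_perm ns \<pi> \<sigma>s ! i)"
        using i p pl l by (simp add: block_perm_simps)
      then show "m \<in> set (concat (block_perm ns \<pi> \<sigma>s))"
        using nth_mem[of i "block_perm ns \<pi> \<sigma>s"] i pl l by (auto simp: block_perm_simps(1))
    qed
  qed
qed

lemma nth_concat_block_perm:
  fixes ns :: "nat list"
  assumes "length \<pi> = length \<sigma>s" "i < length \<sigma>s" "j < length (\<sigma>s ! i)" "map length \<sigma>s = ms"
  shows "concat (block_perm ns \<pi> \<sigma>s) ! (offset ms i + j) = offset ns (\<pi> ! i) + \<sigma>s ! i ! j"
  using nth_concat_offset(1)[of "block_perm ns \<pi> \<sigma>s" ms i j] block_perm_simps[where ns = ns and \<pi> = \<pi> and \<sigma>s = \<sigma>s] assms by simp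

lemma ob_multT [simp]: "ob multT = concat"
  by (simp add: multT_def)

text \<open>On arrows \<open>multT\<close> does not see the source tuple and recovers the block
  lengths from the component arrows. For a genuine arrow these lengths are those of the source
  blocks, so \<open>block_offset\<close> becomes an ordinary partial sum.\<close>

lemma ar_multT:
  assumes "(\<pi>, ts) \<in> Hom (Sr (Sr G)) ass bss"
  shows "ar multT (\<pi>, ts) = (concat (block_perm (map length ass) \<pi> (map fst ts)), concat (map snd ts))"
proof -
  have h: "length ass = length bss" "length ts = length bss" "\<pi> \<in> perms (length bss)"
    "\<And>i. i < length bss \<Longrightarrow> ts ! i \<in> Hom (Sr G) (ass ! (\<pi> ! i)) (bss ! i)"
    using assms by (auto simp: Hom_Sr_iff)
  have len: "length (snd (ts ! i)) = length (ass ! (\<pi> ! i))" if "i < length bss" for i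
    using h(4)[OF that] by (auto elim!: Hom_SrE)
  have off: "block_offset \<pi> ts p = offset (map length ass) p" if p: "p < length bss" for p
  proof -
    have "block_offset \<pi> ts p = (\<Sum>i<length bss. if \<pi> ! i < p then length (snd (ts ! i)) else 0)"
      using h(1,2) perms_length[OF h(3)]
      by (simp add: block_offset_def sum_list_sum_nth atLeast0LessThan case_prod_beta)
    also have "\<dots> = (\<Sum>i<length bss. if \<pi> ! i < p then length (ass ! (\<pi> ! i)) else 0)"
      using len by (intro sum.cong) auto
    \<comment> \<open>Reindexing along \<pi>, which meets every source block exactly once.\<close>
    also have "\<dots> = (\<Sum>i<length bss. if i < p then length (ass ! i) else 0)"
      using sum.reindex_bij_betw[OF bij_betw_perms_nth[OF h(3)], of "\<lambda>i. if i < p then length (ass ! i) else 0"]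
      by simp
    also have "\<dots> = (\<Sum>i<p. length (ass ! i))"
      using p by (simp add: sum.If_cases) (rule sum.cong, auto)
    also have "\<dots> = offset (map length ass) p"
      using p h(1) by (simp add: offset_def sum_list_sum_nth atLeast0LessThan)
    finally show ?thesis .
  qed
  have "map2 (\<lambda>p (\<sigma>, fs). map (\<lambda>j. block_offset \<pi> ts p + j) \<sigma>) \<pi> ts
      = block_perm (map length ass) \<pi> (map fst ts)"
  proof (rule nth_equalityI)
    fix i assume i: "i < length (map2 (\<lambda>p (\<sigma>, fs). map (\<lambda>j. block_offset \<pi> ts p + j) \<sigma>) \<pi> ts)"
    then show "map2 (\<lambda>p (\<sigma>, fs). map (\<lambda>j. block_offset \<pi> ts p + j) \<sigma>) \<pi> ts ! i
        = block_perm (map length ass) \<pi> (map fst ts) ! i"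
      using h(2) perms_length[OF h(3)] off[OF perms_nth[OF h(3), of i]]
      by (simp add: block_perm_simps case_prod_beta)
  qed (simp add: block_perm_simps)
  then show ?thesis by (simp add: multT_def)
qed

lemma is_functor_multT:
  assumes "is_groupoid G"
  shows "is_functor multT (Sr (Sr G)) (Sr G)"
proof (rule is_functorI)
  fix ass assume "ass \<in> Obj (Sr (Sr G))"
  then show "ob multT ass \<in> Obj (Sr G)" by (cases ass) (auto simp: Obj_Sr)
next
  fix ass bss h assume a: "h \<in> Hom (Sr (Sr G)) ass bss"
  obtain \<pi> ts where h: "h = (\<pi>, ts)" "length ass = length bss" "length ts = length bss" "\<pi> \<in> perms (length bss)"
    "\<And>i. i < length bss \<Longrightarrow> ts ! i \<in> Hom (Sr G) (ass ! (\<pi> ! i)) (bss ! i)"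
    using a by (blast elim: Hom_SrE)
  have t: "length (ass ! (\<pi> ! i)) = length (bss ! i)" "length (snd (ts ! i)) = length (bss ! i)"
    "fst (ts ! i) \<in> perms (length (bss ! i))"
    "\<And>j. j < length (bss ! i) \<Longrightarrow>
      snd (ts ! i) ! j \<in> Hom G (ass ! (\<pi> ! i) ! (fst (ts ! i) ! j)) (bss ! i ! j)" if "i < length bss" for i
    using h(5)[OF that] by (auto elim!: Hom_SrE)
  let ?P = "concat (block_perm (map length ass) \<pi> (map fst ts))"
  have P: "?P \<in> perms (sum_list (map length ass))"
    using h(2-4) t(1,3) perms_nth[OF h(4)] by (intro block_perm_in_perms) auto
  have shapes: "map length (map fst ts) = map length bss" "map length (map snd ts) = map length bss"
    using h(3) t(2,3) by (auto intro!: nth_equalityI simp: perms_length)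
  have len: "length (concat ass) = length (concat bss)" "length (concat (map snd ts)) = length (concat bss)"
  proof -
    show "length (concat (map snd ts)) = length (concat bss)" using shapes(2) by (metis length_concat)
    have "length ?P = sum_list (map length (map fst ts))"
      using block_perm_simps(3)[of \<pi> "map fst ts" "map length ass"] perms_length[OF h(4)] h(3)
      by (simp add: length_concat)
    then show "length (concat ass) = length (concat bss)"
      using shapes(1) perms_length[OF P] by (simp add: length_concat)
  qed
  have "concat (map snd ts) ! m \<in> Hom G (concat ass ! (?P ! m)) (concat bss ! m)" if m: "m < length (concat bss)" for m
  proof -
    obtain i j where ij: "i < length bss" "j < length (bss ! i)" "m = offset (map length bss) i + j"
      using concat_positions[OF m] by blast
    have "?P ! m = offset (map length ass) (\<pi> ! i) + fst (ts ! i) ! j"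
      using nth_concat_block_perm[of \<pi> "map fst ts" i j "map length bss"] shapes(1) ij h(3) t(3)[OF ij(1)]
        perms_length[OF h(4)] by (simp add: perms_length)
    then have "concat ass ! (?P ! m) = ass ! (\<pi> ! i) ! (fst (ts ! i) ! j)"
      using nth_concat_offset(1)[of ass "map length ass" "\<pi> ! i" "fst (ts ! i) ! j"] perms_nth[OF h(4) ij(1)] h(2)
        perms_nth[OF t(3)[OF ij(1)] ij(2)] t(1)[OF ij(1)] by simp
    moreover have "concat bss ! m = bss ! i ! j"
      using nth_concat_offset(1)[of bss _ i j] ij by simp
    moreover have "concat (map snd ts) ! m = snd (ts ! i) ! j"
      using nth_concat_offset(1)[of "map snd ts" "map length bss" i j] ij shapes(2) h(3) t(2)[OF ij(1)] by simp
    ultimately show ?thesis using t(4)[OF ij(1,2)] by simp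
  qed
  then show "ar multT h \<in> Hom (Sr G) (ob multT ass) (ob multT bss)"
    using P len by (simp add: ar_multT[OF a[unfolded h(1)], folded h(1)] Hom_Sr_iff length_concat)
next
  fix ass bss css h k
  assume obj: "ass \<in> Obj (Sr (Sr G))" "bss \<in> Obj (Sr (Sr G))" "css \<in> Obj (Sr (Sr G))"
    and a: "h \<in> Hom (Sr (Sr G)) ass bss" "k \<in> Hom (Sr (Sr G)) bss css"
  obtain \<pi> ts where h: "h = (\<pi>, ts)" "length ass = length bss" "length ts = length bss" "\<pi> \<in> perms (length bss)"
    "\<And>i. i < length bss \<Longrightarrow> ts ! i \<in> Hom (Sr G) (ass ! (\<pi> ! i)) (bss ! i)"
    using a(1) by (blast elim: Hom_SrE)
  obtain \<rho> us where k: "k = (\<rho>, us)" "length bss = length css" "length us = length css" "\<rho> \<in> perms (length css)"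
    "\<And>i. i < length css \<Longrightarrow> us ! i \<in> Hom (Sr G) (bss ! (\<rho> ! i)) (css ! i)"
    using a(2) by (blast elim: Hom_SrE)
  have t: "length (ass ! (\<pi> ! i)) = length (bss ! i)" "length (snd (ts ! i)) = length (bss ! i)"
    "fst (ts ! i) \<in> perms (length (bss ! i))" if "i < length bss" for i
    using h(5)[OF that] by (auto elim!: Hom_SrE)
  have u: "length (bss ! (\<rho> ! i)) = length (css ! i)" "length (snd (us ! i)) = length (css ! i)"
    "fst (us ! i) \<in> perms (length (css ! i))" if "i < length css" for i
    using k(5)[OF that] by (auto elim!: Hom_SrE)
  have \<rho>: "length \<rho> = length css" "\<And>i. i < length css \<Longrightarrow> \<rho> ! i < length css"
    using perms_length[OF k(4)] perms_nth[OF k(4)] by auto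
  let ?v = "\<lambda>i. Comp (Sr G) (us ! i) (ts ! (\<rho> ! i))"
  let ?vs = "map2 (\<lambda>g i. Comp (Sr G) g (ts ! i)) us \<rho>"
  have kh: "Comp (Sr (Sr G)) k h = (map ((!) \<pi>) \<rho>, ?vs)"
    by (simp add: h(1) k(1) Comp_Sr)
  have vs: "?vs = map ?v [0..<length css]"
    using \<rho> k(3) by (auto intro!: nth_equalityI)
  have fst_v: "fst (?v i) = map ((!) (fst (ts ! (\<rho> ! i)))) (fst (us ! i))"
    and snd_v: "snd (?v i) = map2 (\<lambda>g j. Comp G g (snd (ts ! (\<rho> ! i)) ! j)) (snd (us ! i)) (fst (us ! i))" for i
    by (cases "us ! i"; cases "ts ! (\<rho> ! i)"; simp add: Comp_Sr)+
  have khHom: "Comp (Sr (Sr G)) k h \<in> Hom (Sr (Sr G)) ass css"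
    using is_groupoid.Comp_in[OF is_groupoid_Sr[OF is_groupoid_Sr[OF assms]] obj a] .
  let ?P = "concat (block_perm (map length ass) \<pi> (map fst ts))"
  let ?Q = "concat (block_perm (map length bss) \<rho> (map fst us))"
  let ?R = "concat (block_perm (map length ass) (map ((!) \<pi>) \<rho>) (map fst ?vs))"
  have len_v: "length (fst (?v i)) = length (css ! i)" "length (snd (?v i)) = length (css ! i)" if "i < length css" for i
    using u[OF that] by (simp_all add: fst_v snd_v perms_length)
  have st: "map length (map fst ts) = map length bss" "map length (map snd ts) = map length bss"
    using h(3) t(2,3) by (auto intro!: nth_equalityI simp: perms_length)
  have su: "map length (map fst us) = map length css" "map length (map snd us) = map length css"
    using k(3) u(2,3) by (auto intro!: nth_equalityI simp: perms_length)
  have sv: "map length (map fst ?vs) = map length css" "map length (map snd ?vs) = map length css"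
    unfolding vs using len_v by (auto intro!: nth_equalityI)
  have len: "length ?R = length (concat css)" "length ?Q = length (concat css)"
    "length (concat (map snd ?vs)) = length (concat css)" "length (concat (map snd us)) = length (concat css)"
    using block_perm_simps(3)[of "map ((!) \<pi>) \<rho>" "map fst ?vs" "map length ass"]
      block_perm_simps(3)[of \<rho> "map fst us" "map length bss"] \<rho>(1) k(3) su sv
    by (simp_all only: length_concat) simp_all
  \<comment> \<open>Position \<open>j\<close> of target block \<open>i\<close> comes from middle
    block \<open>\<rho> ! i\<close>, which in turn comes from source block
    \<open>\<pi> ! (\<rho> ! i)\<close>. Both sides are evaluated there.\<close>
  have "?R ! m = ?P ! (?Q ! m) \<and> concat (map snd ?vs) ! m
      = Comp G (concat (map snd us) ! m) (concat (map snd ts) ! (?Q ! m))" if m: "m < length (concat css)" for m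
  proof -
    obtain i j where ij: "i < length css" "j < length (css ! i)" "m = offset (map length css) i + j"
      using concat_positions[OF m] by blast
    let ?j = "fst (us ! i) ! j"
    have \<rho>i: "\<rho> ! i < length bss" using \<rho>(2) ij(1) k(2) by simp
    have j': "?j < length (bss ! (\<rho> ! i))" using perms_nth[OF u(3)[OF ij(1)] ij(2)] u(1)[OF ij(1)] by simp
    have Q: "?Q ! m = offset (map length bss) (\<rho> ! i) + ?j"
      using nth_concat_block_perm[of \<rho> "map fst us" i j "map length css"] su(1) ij k(3) u(3)[OF ij(1)] \<rho>(1)
      by (simp add: perms_length)
    have P: "?P ! (?Q ! m) = offset (map length ass) (\<pi> ! (\<rho> ! i)) + fst (ts ! (\<rho> ! i)) ! ?j"
      unfolding Q
      using nth_concat_block_perm[of \<pi> "map fst ts" "\<rho> ! i" ?j "map length bss"] st(1) \<rho>i h(3) t(3)[OF \<rho>i] j'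
        perms_length[OF h(4)] by (simp add: perms_length)
    have vi: "?vs ! i = ?v i" unfolding vs using ij(1) by simp
    have R: "?R ! m = offset (map length ass) (\<pi> ! (\<rho> ! i)) + fst (ts ! (\<rho> ! i)) ! ?j"
      using nth_concat_block_perm[of "map ((!) \<pi>) \<rho>" "map fst ?vs" i j "map length css" "map length ass"] sv(1) ij
        k(3) \<rho>(1) len_v[OF ij(1)] vi u(3)[OF ij(1)] by (simp add: fst_v perms_length)
    have T: "concat (map snd ts) ! (?Q ! m) = snd (ts ! (\<rho> ! i)) ! ?j"
      unfolding Q using nth_concat_offset(1)[of "map snd ts" "map length bss" "\<rho> ! i" ?j] st(2) \<rho>i h(3) j' t(2)[OF \<rho>i]
      by simp
    have U: "concat (map snd us) ! m = snd (us ! i) ! j"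
      using nth_concat_offset(1)[of "map snd us" "map length css" i j] su(2) ij k(3) u(2)[OF ij(1)] by simp
    have "concat (map snd ?vs) ! m = snd (?v i) ! j"
      using nth_concat_offset(1)[of "map snd ?vs" "map length css" i j] sv(2) ij k(3) len_v[OF ij(1)] vi \<rho>(1) by simp
    also have "\<dots> = Comp G (snd (us ! i) ! j) (snd (ts ! (\<rho> ! i)) ! ?j)"
      using u(2,3)[OF ij(1)] ij(2) by (simp add: snd_v perms_length)
    finally show ?thesis using R P T U by simp
  qed
  then show "ar multT (Comp (Sr (Sr G)) k h) = Comp (Sr G) (ar multT k) (ar multT h)"
    using len
    unfolding kh ar_multT[OF khHom[unfolded kh]] ar_multT[OF a(1)[unfolded h(1)], folded h(1)]
      ar_multT[OF a(2)[unfolded k(1)], folded k(1)] Comp_Sr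
    by (intro prod_eqI nth_equalityI) (simp_all del: length_concat)
qed

section \<open>Counting arrows between tuples\<close>

lemma lists_nth_Cons:
  "{xs. length xs = length (A # As) \<and> (\<forall>i<length (A # As). xs ! i \<in> (A # As) ! i)}
    = (\<lambda>(x, xs). x # xs) ` (A \<times> {xs. length xs = length As \<and> (\<forall>i<length As. xs ! i \<in> As ! i)})"
proof (intro subset_antisym subsetI)
  fix xs assume xs: "xs \<in> {xs. length xs = length (A # As) \<and> (\<forall>i<length (A # As). xs ! i \<in> (A # As) ! i)}"
  then obtain y ys where "xs = y # ys" by (cases xs) auto
  then show "xs \<in> (\<lambda>(x, xs). x # xs) ` (A \<times> {xs. length xs = length As \<and> (\<forall>i<length As. xs ! i \<in> As ! i)})"
    using xs by (auto simp: All_less_Suc2)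
qed (auto simp: All_less_Suc2)

lemma finite_lists_nth: "\<forall>A\<in>set As. finite A \<Longrightarrow> finite {xs. length xs = length As \<and> (\<forall>i<length As. xs ! i \<in> As ! i)}"
proof (induction As)
  case (Cons A As)
  show ?case unfolding lists_nth_Cons by (intro finite_imageI finite_cartesian_product) (use Cons in auto)
qed simp

lemma card_lists_nth: "card {xs. length xs = length As \<and> (\<forall>i<length As. xs ! i \<in> As ! i)} = prod_list (map card As)"
proof (induction As)
  case (Cons A As)
  show ?case
    unfolding lists_nth_Cons
    using Cons by (subst card_image) (auto simp: inj_on_def card_cartesian_product)
qed simp

lemma prod_list_prod_nth: "prod_list xs = (\<Prod>i<length xs. xs ! i)" for xs :: "'a :: comm_monoid_mult list"
  using prod.list_conv_set_nth[of xs] by (simp add: atLeast0LessThan)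

lemma prod_perms_nth:
  fixes f :: "'a \<Rightarrow> 'b :: comm_monoid_mult"
  assumes "\<sigma> \<in> perms (length xs)"
  shows "(\<Prod>i<length xs. f (xs ! (\<sigma> ! i))) = prod_list (map f xs)"
  using prod.reindex_bij_betw[OF bij_betw_perms_nth[OF assms], of "\<lambda>i. f (xs ! i)"]
  by (simp add: prod_list_prod_nth)

lemma card_Hom_Sr:
  assumes "length as = length bs" "\<And>a b. \<lbrakk>a \<in> set as; b \<in> set bs\<rbrakk> \<Longrightarrow> finite (Hom G a b)"
  shows "card (Hom (Sr G) as bs) = (\<Sum>\<sigma>\<in>perms (length bs). \<Prod>i<length bs. card (Hom G (as ! (\<sigma> ! i)) (bs ! i)))"
    and "finite (Hom (Sr G) as bs)"
proof -
  let ?As = "\<lambda>\<sigma>. map (\<lambda>i. Hom G (as ! (\<sigma> ! i)) (bs ! i)) [0..<length bs]"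
  let ?S = "\<lambda>\<sigma>. {fs. length fs = length (?As \<sigma>) \<and> (\<forall>i<length (?As \<sigma>). fs ! i \<in> ?As \<sigma> ! i)}"
  have eq: "Hom (Sr G) as bs = (SIGMA \<sigma>:perms (length bs). ?S \<sigma>)"
    using assms(1) by (auto simp: Hom_Sr_iff)
  have fin: "finite (?S \<sigma>)" if "\<sigma> \<in> perms (length bs)" for \<sigma>
    by (rule finite_lists_nth) (use assms perms_nth[OF that] in auto)
  show "card (Hom (Sr G) as bs) = (\<Sum>\<sigma>\<in>perms (length bs). \<Prod>i<length bs. card (Hom G (as ! (\<sigma> ! i)) (bs ! i)))"
    unfolding eq using fin
    by (subst card_SigmaI) (auto simp: card_lists_nth simp del: length_map intro!: sum.cong, simp add: prod_list_prod_nth)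
  show "finite (Hom (Sr G) as bs)" unfolding eq using fin by (intro finite_SigmaI) auto
qed

text \<open>Zipping the target entries with the component arrows makes an arrow leaving
  \<open>xs\<close> a permutation \<sigma> together with an arrow leaving
  \<open>xs ! (\<sigma> ! i)\<close> for each \<open>i\<close>. Every \<sigma> allows the same
  number of choices, and distinct \<sigma> give distinct arrows even when entries of
  \<open>xs\<close> coincide.\<close>

lemma card_outs_Sr:
  assumes "xs \<noteq> []" "\<And>x. x \<in> set xs \<Longrightarrow> finite (outs G x)"
  shows "card (outs (Sr G) xs) = fact (length xs) * prod_list (map (\<lambda>x. card (outs G x)) xs)"
    and "finite (outs (Sr G) xs)"
proof -
  let ?As = "\<lambda>\<sigma>. map (\<lambda>i. outs G (xs ! (\<sigma> ! i))) [0..<length xs]"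
  let ?S = "\<lambda>\<sigma>. {ps. length ps = length (?As \<sigma>) \<and> (\<forall>i<length (?As \<sigma>). ps ! i \<in> ?As \<sigma> ! i)}"
  let ?f = "\<lambda>(\<sigma>, ps). (map fst ps, (\<sigma>, map snd ps))"
  have eq: "outs (Sr G) xs = ?f ` (SIGMA \<sigma>:perms (length xs). ?S \<sigma>)"
  proof (intro subset_antisym subsetI)
    fix u assume "u \<in> outs (Sr G) xs"
    then obtain ys \<sigma> fs where u: "u = (ys, (\<sigma>, fs))" "ys \<in> Obj (Sr G)" "(\<sigma>, fs) \<in> Hom (Sr G) xs ys"
      by (auto simp: outs_def)
    then show "u \<in> ?f ` (SIGMA \<sigma>:perms (length xs). ?S \<sigma>)"
      by (intro image_eqI[of _ _ "(\<sigma>, zip ys fs)"]) (auto simp: Hom_Sr_iff outs_def Obj_Sr)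
  next
    fix u assume "u \<in> ?f ` (SIGMA \<sigma>:perms (length xs). ?S \<sigma>)"
    then obtain \<sigma> ps where u: "u = (map fst ps, (\<sigma>, map snd ps))" "\<sigma> \<in> perms (length xs)" "length ps = length xs"
      "\<forall>i<length xs. ps ! i \<in> outs G (xs ! (\<sigma> ! i))" by auto
    then show "u \<in> outs (Sr G) xs"
      using assms(1) by (fastforce simp: outs_def Obj_Sr Hom_Sr_iff in_set_conv_nth)
  qed
  have inj: "inj_on ?f (SIGMA \<sigma>:perms (length xs). ?S \<sigma>)"
    by (auto simp: inj_on_def intro: pair_list_eqI)
  have fin: "finite (?S \<sigma>)" if "\<sigma> \<in> perms (length xs)" for \<sigma>
    by (rule finite_lists_nth) (use assms perms_nth[OF that] in auto)
  have "card (?S \<sigma>) = prod_list (map (\<lambda>x. card (outs G x)) xs)" if "\<sigma> \<in> perms (length xs)" for \<sigma>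
    unfolding card_lists_nth prod_perms_nth[OF that, symmetric] by (simp add: prod_list_prod_nth)
  then show "card (outs (Sr G) xs) = fact (length xs) * prod_list (map (\<lambda>x. card (outs G x)) xs)"
    unfolding eq card_image[OF inj] using fin by (subst card_SigmaI) (auto simp del: length_map)
  show "finite (outs (Sr G) xs)" unfolding eq using fin by (intro finite_imageI finite_SigmaI) auto
qed

lemma of_nat_prod_list: "of_nat (prod_list xs) = prod_list (map of_nat xs)"
  by (induction xs) auto

lemma lists_length_Suc_image: "{xs. set xs \<subseteq> E \<and> length xs = Suc n} = (\<lambda>(x, xs). x # xs) ` (E \<times> {xs. set xs \<subseteq> E \<and> length xs = n})"
  by (auto simp: length_Suc_conv)

lemma sum_prod_lists:
  fixes h :: "'b \<Rightarrow> 'a \<Rightarrow> 'c :: comm_semiring_1"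
  shows "(\<Sum>xs\<in>{xs. set xs \<subseteq> E \<and> length xs = length fs}. prod_list (map2 h fs xs)) = prod_list (map (\<lambda>f. sum (h f) E) fs)"
proof (induction fs)
  case Nil
  have "{xs. set xs \<subseteq> E \<and> length xs = 0} = {[]}" by auto
  then show ?case by simp
next
  case (Cons f fs)
  let ?L = "{xs. set xs \<subseteq> E \<and> length xs = length fs}"
  have "(\<Sum>xs\<in>{xs. set xs \<subseteq> E \<and> length xs = length (f # fs)}. prod_list (map2 h (f # fs) xs))
      = (\<Sum>(x, xs)\<in>E \<times> ?L. h f x * prod_list (map2 h fs xs))"
    unfolding length_Cons lists_length_Suc_image
    by (subst sum.reindex) (auto simp: inj_on_def intro!: sum.cong)
  also have "\<dots> = (\<Sum>x\<in>E. \<Sum>xs\<in>?L. h f x * prod_list (map2 h fs xs))"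
    by (rule sum.cartesian_product[symmetric])
  also have "\<dots> = sum (h f) E * (\<Sum>xs\<in>?L. prod_list (map2 h fs xs))"
    by (rule sum_product[symmetric])
  finally show ?case using Cons.IH by simp
qed

lemma map_nth_perms_bij:
  assumes "\<sigma> \<in> perms n"
  shows "bij_betw (\<lambda>xs. map ((!) xs) \<sigma>) {xs. set xs \<subseteq> E \<and> length xs = n} {xs. set xs \<subseteq> E \<and> length xs = n}"
proof -
  obtain \<tau> where \<tau>: "\<tau> \<in> perms n" "\<forall>i<n. \<sigma> ! (\<tau> ! i) = i" "\<forall>i<n. \<tau> ! (\<sigma> ! i) = i"
    using perms_inverse[OF assms] by blast
  have E: "xs ! i \<in> E" if "set xs \<subseteq> E" "i < length xs" for xs :: "'a list" and i
    using that nth_mem by blast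
  show ?thesis
    by (rule bij_betw_byWitness[of _ "\<lambda>xs. map ((!) xs) \<tau>"])
      (use map_nth_perms_inverse[OF assms \<tau>(1,2)] map_nth_perms_inverse[OF \<tau>(1) assms \<tau>(3)]
        perms_length[OF assms] perms_length[OF \<tau>(1)] perms_set[OF assms] perms_set[OF \<tau>(1)] in \<open>auto simp: E\<close>)
qed

text \<open>Each of the \<open>n!\<close> permutations occurring in an arrow contributes the same sum over the lists \<open>xs\<close>.\<close>

lemma sum_Sr:
  fixes v :: "'o \<Rightarrow> rat"
  assumes E: "finite E" "E \<subseteq> Obj G"
    and out: "\<And>x. x \<in> E \<Longrightarrow> finite (outs G x)"
    and hom: "\<And>x f. \<lbrakk>x \<in> E; f \<in> set fs\<rbrakk> \<Longrightarrow> finite (Hom H (ob F x) f)"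
    and ne: "fs \<noteq> []"
  shows "(\<Sum>xs\<in>{xs. set xs \<subseteq> E \<and> length xs = length fs}.
      of_nat (card (Hom (Sr H) (map (ob F) xs) fs)) / of_nat (card (outs (Sr G) xs)) * prod_list (map v xs))
    = prod_list (map (\<lambda>f. \<Sum>x\<in>E. of_nat (card (Hom H (ob F x) f)) / of_nat (card (outs G x)) * v x) fs)"
    (is "?lhs = ?rhs")
proof -
  let ?n = "length fs"
  let ?L = "{xs. set xs \<subseteq> E \<and> length xs = ?n}"
  let ?h = "\<lambda>f x. of_nat (card (Hom H (ob F x) f)) / of_nat (card (outs G x)) * v x"
  \<comment> \<open>The hom-set is counted by a sum over permutations, and
    \<open>card_outs_Sr\<close> splits the denominator into \<open>n!\<close> and a product over the
    entries. Once \<open>n!\<close> is set aside, each permutation contributes a product of factors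
    of the form \<open>?h\<close>.\<close>
  have summand: "of_nat (card (Hom (Sr H) (map (ob F) xs) fs)) / of_nat (card (outs (Sr G) xs)) * prod_list (map v xs)
      = (\<Sum>\<sigma>\<in>perms ?n. prod_list (map2 ?h fs (map ((!) xs) \<sigma>))) / fact ?n" if xs: "xs \<in> ?L" for xs
  proof -
    have l: "length xs = ?n" and xE: "\<And>x. x \<in> set xs \<Longrightarrow> x \<in> E" using xs by auto
    have ne': "xs \<noteq> []" using l ne by auto
    have "prod_list (map2 ?h fs (map ((!) xs) \<sigma>))
        = (\<Prod>i<?n. of_nat (card (Hom H (map (ob F) xs ! (\<sigma> ! i)) (fs ! i))))
          / prod_list (map (\<lambda>x. of_nat (card (outs G x))) xs) * prod_list (map v xs)" if \<sigma>: "\<sigma> \<in> perms ?n" for \<sigma>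
    proof -
      have "prod_list (map2 ?h fs (map ((!) xs) \<sigma>)) = (\<Prod>i<?n. ?h (fs ! i) (xs ! (\<sigma> ! i)))"
        using perms_length[OF \<sigma>] l by (simp add: prod_list_prod_nth)
      also have "\<dots> = (\<Prod>i<?n. of_nat (card (Hom H (map (ob F) xs ! (\<sigma> ! i)) (fs ! i))))
          / (\<Prod>i<?n. of_nat (card (outs G (xs ! (\<sigma> ! i))))) * (\<Prod>i<?n. v (xs ! (\<sigma> ! i)))"
        using perms_nth[OF \<sigma>] l by (simp add: prod.distrib prod_dividef)
      finally show ?thesis
        using prod_perms_nth[of \<sigma> xs v] prod_perms_nth[of \<sigma> xs "\<lambda>x. rat_of_nat (card (outs G x))"] \<sigma>
        by (simp add: l)
    qed
    moreover have "card (Hom (Sr H) (map (ob F) xs) fs)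
        = (\<Sum>\<sigma>\<in>perms ?n. \<Prod>i<?n. card (Hom H (map (ob F) xs ! (\<sigma> ! i)) (fs ! i)))"
      using l xE hom by (intro card_Hom_Sr(1)) auto
    ultimately have "(\<Sum>\<sigma>\<in>perms ?n. prod_list (map2 ?h fs (map ((!) xs) \<sigma>)))
        = of_nat (card (Hom (Sr H) (map (ob F) xs) fs)) / prod_list (map (\<lambda>x. of_nat (card (outs G x))) xs) * prod_list (map v xs)"
      by (simp add: sum_distrib_right sum_divide_distrib)
    moreover have "rat_of_nat (card (outs (Sr G) xs)) = fact ?n * prod_list (map (\<lambda>x. of_nat (card (outs G x))) xs)"
      using card_outs_Sr(1)[OF ne', of G, OF out[OF xE]] l by (simp add: of_nat_prod_list o_def)
    ultimately show ?thesis by simp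
  qed
  have "?lhs = (\<Sum>xs\<in>?L. \<Sum>\<sigma>\<in>perms ?n. prod_list (map2 ?h fs (map ((!) xs) \<sigma>))) / fact ?n"
    using summand by (simp add: sum_divide_distrib)
  also have "\<dots> = (\<Sum>\<sigma>\<in>perms ?n. \<Sum>xs\<in>?L. prod_list (map2 ?h fs (map ((!) xs) \<sigma>))) / fact ?n"
    by (subst sum.swap) simp
  also have "\<dots> = (\<Sum>\<sigma>\<in>perms ?n. \<Sum>xs\<in>?L. prod_list (map2 ?h fs xs)) / fact ?n"
    using sum.reindex_bij_betw[OF map_nth_perms_bij, of _ ?n "\<lambda>xs. prod_list (map2 ?h fs xs)" E] by simp
  also have "\<dots> = ?rhs"
    using sum_prod_lists[of ?h fs E] by simp
  finally show ?thesis .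
qed

text \<open>A permutation has to match entries with equal \<kappa>, and any such matching can be
  filled with isomorphisms. So a complete invariant of the entries yields one of tuples, namely the
  multiset of its values.\<close>

lemma Hom_Sr_nonempty:
  assumes "\<And>a b. \<lbrakk>a \<in> set as; b \<in> set bs\<rbrakk> \<Longrightarrow> Hom G a b \<noteq> {} \<longleftrightarrow> \<kappa> a = \<kappa> b"
  shows "Hom (Sr G) as bs \<noteq> {} \<longleftrightarrow> mset (map \<kappa> as) = mset (map \<kappa> bs)"
proof
  assume "Hom (Sr G) as bs \<noteq> {}"
  then obtain \<sigma> fs where s: "length as = length bs" "length fs = length bs" "\<sigma> \<in> perms (length bs)"
    "\<And>i. i < length bs \<Longrightarrow> fs ! i \<in> Hom G (as ! (\<sigma> ! i)) (bs ! i)"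
    by (auto elim!: Hom_SrE)
  have "map ((!) (map \<kappa> as)) \<sigma> = map \<kappa> bs"
    using s perms_nth[OF s(3)] perms_length[OF s(3)] assms
    by (intro nth_equalityI) (auto, metis empty_iff nth_mem)
  then show "mset (map \<kappa> as) = mset (map \<kappa> bs)"
    using mset_map_nth_perms[of \<sigma> "map \<kappa> as"] s by simp
next
  assume m: "mset (map \<kappa> as) = mset (map \<kappa> bs)"
  obtain \<sigma> where \<sigma>: "\<sigma> \<in> perms (length as)" "map ((!) (map \<kappa> as)) \<sigma> = map \<kappa> bs"
    using mset_eq_perms[OF m[symmetric]] by auto
  have l: "length as = length bs" using m by (metis length_map size_mset)
  have "\<forall>i<length bs. \<exists>f. f \<in> Hom G (as ! (\<sigma> ! i)) (bs ! i)"
  proof (intro allI impI)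
    fix i assume i: "i < length bs"
    have "\<kappa> (as ! (\<sigma> ! i)) = \<kappa> (bs ! i)"
      using arg_cong[OF \<sigma>(2), of "\<lambda>l. l ! i"] i l perms_length[OF \<sigma>(1)] perms_nth[OF \<sigma>(1), of i] by simp
    then show "\<exists>f. f \<in> Hom G (as ! (\<sigma> ! i)) (bs ! i)"
      using assms[of "as ! (\<sigma> ! i)" "bs ! i"] i l perms_nth[OF \<sigma>(1), of i] by auto
  qed
  then obtain f where "\<And>i. i < length bs \<Longrightarrow> f i \<in> Hom G (as ! (\<sigma> ! i)) (bs ! i)" by metis
  then have "(\<sigma>, map f [0..<length bs]) \<in> Hom (Sr G) as bs"
    using l \<sigma>(1) by (simp add: Hom_Sr_iff)
  then show "Hom (Sr G) as bs \<noteq> {}" by blast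
qed

section \<open>The operad of two-coloured operations\<close>

lemma ob_distribute: "ob distribute (gss, fs) = map2 (\<lambda>gs f. map (\<lambda>g. (g, f)) gs) gss fs"
  and ar_distribute: "ar distribute ((\<pi>, ts), (\<rho>, \<beta>s))
    = (\<pi>, map2 (\<lambda>(\<sigma>, \<alpha>s) \<beta>. (\<sigma>, map (\<lambda>\<alpha>. (\<alpha>, \<beta>)) \<alpha>s)) ts \<beta>s)"
  by (simp_all add: distribute_def)

text \<open>Arrows of tops and arrows of the root can be paired entrywise because both lie over the
  same arrow of colour tuples and hence carry the same permutation. The assumption
  \<open>fst h = fst k\<close> records this.\<close>

lemma is_functor_distribute:
  assumes objs: "\<And>gss fs. (gss, fs) \<in> Obj P \<Longrightarrow>
      length gss = length fs \<and> gss \<in> Obj (Sr (Sr A)) \<and> fs \<in> Obj (Sr B)"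
    and homs: "\<And>gss fs gss' fs' h k. (h, k) \<in> Hom P (gss, fs) (gss', fs') \<Longrightarrow>
      h \<in> Hom (Sr (Sr A)) gss gss' \<and> k \<in> Hom (Sr B) fs fs' \<and> fst h = fst k"
    and comp: "\<And>h k h' k'. Comp P (h', k') (h, k) = (Comp (Sr (Sr A)) h' h, Comp (Sr B) k' k)"
  shows "is_functor distribute P (Sr (Sr (prod_groupoid A B)))"
proof (rule is_functorI)
  fix x assume "x \<in> Obj P"
  moreover obtain gss fs where x: "x = (gss, fs)" by (cases x)
  ultimately have o: "length gss = length fs" "gss \<in> Obj (Sr (Sr A))" "fs \<in> Obj (Sr B)"
    using objs by auto
  have "map2 (\<lambda>gs f. map (\<lambda>g. (g, f)) gs) gss fs ! i \<in> Obj (Sr (prod_groupoid A B))" if "i < length fs" for i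
    using that o(1) Obj_Sr_nth[OF o(2), of i] Obj_Sr_nth[OF o(3), of i]
    by (auto simp: Obj_Sr prod_groupoid_def)
  then show "ob distribute x \<in> Obj (Sr (Sr (prod_groupoid A B)))"
    using o by (auto simp: x ob_distribute Obj_Sr[of "Sr (prod_groupoid A B)"] in_set_conv_nth)
      (auto simp: Obj_Sr)
next
  fix x y h assume xy: "x \<in> Obj P" "y \<in> Obj P" and a: "h \<in> Hom P x y"
  obtain gss fs where x: "x = (gss, fs)" by (cases x)
  obtain gss' fs' where y: "y = (gss', fs')" by (cases y)
  obtain h1 h2 where "h = (h1, h2)" by (cases h)
  moreover obtain \<pi> ts where "h1 = (\<pi>, ts)" by (cases h1)
  moreover obtain \<rho> \<beta>s where "h2 = (\<rho>, \<beta>s)" by (cases h2)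
  ultimately have h: "h = ((\<pi>, ts), (\<pi>, \<beta>s))"
    and 1: "(\<pi>, ts) \<in> Hom (Sr (Sr A)) gss gss'" and 2: "(\<pi>, \<beta>s) \<in> Hom (Sr B) fs fs'"
    using homs[of "(\<pi>, ts)" "(\<rho>, \<beta>s)" gss fs gss' fs'] a x y by auto
  note l = objs[OF xy(1)[unfolded x]] objs[OF xy(2)[unfolded y]]
  note 1 = 1[unfolded Hom_Sr_iff] and 2 = 2[unfolded Hom_Sr_iff]
  let ?ts = "map2 (\<lambda>(\<sigma>, \<alpha>s) \<beta>. (\<sigma>, map (\<lambda>\<alpha>. (\<alpha>, \<beta>)) \<alpha>s)) ts \<beta>s"
  have "?ts ! i \<in> Hom (Sr (prod_groupoid A B)) (ob distribute x ! (\<pi> ! i)) (ob distribute y ! i)"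
    if i: "i < length fs'" for i
  proof -
    obtain \<sigma> \<alpha>s where t: "ts ! i = (\<sigma>, \<alpha>s)" by (cases "ts ! i")
    have p: "\<pi> ! i < length fs'" using perms_nth 2 i by blast
    have "(\<sigma>, \<alpha>s) \<in> Hom (Sr A) (gss ! (\<pi> ! i)) (gss' ! i)" using 1 2 i l t by auto
    note 3 = this[unfolded Hom_Sr_iff]
    have "\<beta>s ! i \<in> Hom B (fs ! (\<pi> ! i)) (fs' ! i)" using 2 i by blast
    then show ?thesis
      using 1 2 3 i t p l perms_nth[of \<sigma> "length (gss' ! i)"]
      by (auto simp: x y ob_distribute Hom_Sr_iff prod_groupoid_def)
  qed
  then show "ar distribute h \<in> Hom (Sr (Sr (prod_groupoid A B))) (ob distribute x) (ob distribute y)"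
    using 1 2 l by (auto simp: h ar_distribute Hom_Sr_iff x y ob_distribute)
  fix z k assume z0: "z \<in> Obj P" and b: "k \<in> Hom P y z"
  obtain gss'' fs'' where z: "z = (gss'', fs'')" by (cases z)
  obtain k1 k2 where "k = (k1, k2)" by (cases k)
  moreover obtain \<tau> us where "k1 = (\<tau>, us)" by (cases k1)
  moreover obtain \<rho>' \<gamma>s where "k2 = (\<rho>', \<gamma>s)" by (cases k2)
  ultimately have k: "k = ((\<tau>, us), (\<tau>, \<gamma>s))"
    and 4: "(\<tau>, us) \<in> Hom (Sr (Sr A)) gss' gss''" and 5: "(\<tau>, \<gamma>s) \<in> Hom (Sr B) fs' fs''"
    using homs[of "(\<tau>, us)" "(\<rho>', \<gamma>s)" gss' fs' gss'' fs''] b y z by auto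
  note 4 = 4[unfolded Hom_Sr_iff] and 5 = 5[unfolded Hom_Sr_iff]
  note m = objs[OF z0[unfolded z]]
  have tl: "length \<tau> = length fs''" using 5 perms_length by blast
  show "ar distribute (Comp P k h) = Comp (Sr (Sr (prod_groupoid A B))) (ar distribute k) (ar distribute h)"
    unfolding h k comp Comp_Sr ar_distribute prod.inject
  proof (intro conjI refl nth_equalityI)
    fix i assume "i < length (map2 (\<lambda>(\<sigma>, \<alpha>s) \<beta>. (\<sigma>, map (\<lambda>\<alpha>. (\<alpha>, \<beta>)) \<alpha>s))
        (map2 (\<lambda>g i. Comp (Sr A) g (ts ! i)) us \<tau>) (map2 (\<lambda>g i. Comp B g (\<beta>s ! i)) \<gamma>s \<tau>))"
    then have i: "i < length fs''" using tl 5 4 by simp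
    have ti: "\<tau> ! i < length fs''" using perms_nth 5 i by blast
    obtain \<sigma> \<alpha>s where t: "ts ! (\<tau> ! i) = (\<sigma>, \<alpha>s)" by (cases "ts ! (\<tau> ! i)")
    obtain \<sigma>' \<alpha>s' where u: "us ! i = (\<sigma>', \<alpha>s')" by (cases "us ! i")
    have "(\<sigma>', \<alpha>s') \<in> Hom (Sr A) (gss' ! (\<tau> ! i)) (gss'' ! i)" using 4 5 i m u by auto
    then have s': "length \<alpha>s' = length \<sigma>'" "\<sigma>' \<in> perms (length (gss'' ! i))"
      "length (gss' ! (\<tau> ! i)) = length (gss'' ! i)"
      by (auto simp: Hom_Sr_iff perms_length)
    have "(\<sigma>, \<alpha>s) \<in> Hom (Sr A) (gss ! (\<pi> ! (\<tau> ! i))) (gss' ! (\<tau> ! i))" using 1 2 4 5 ti m l t by auto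
    then have s: "length \<alpha>s = length (gss'' ! i)" using s' by (auto simp: Hom_Sr_iff)
    show "map2 (\<lambda>(\<sigma>, \<alpha>s) \<beta>. (\<sigma>, map (\<lambda>\<alpha>. (\<alpha>, \<beta>)) \<alpha>s))
          (map2 (\<lambda>g i. Comp (Sr A) g (ts ! i)) us \<tau>) (map2 (\<lambda>g i. Comp B g (\<beta>s ! i)) \<gamma>s \<tau>) ! i
      = map2 (\<lambda>g i. Comp (Sr (prod_groupoid A B)) g
            (map2 (\<lambda>(\<sigma>, \<alpha>s) \<beta>. (\<sigma>, map (\<lambda>\<alpha>. (\<alpha>, \<beta>)) \<alpha>s)) ts \<beta>s ! i))
          (map2 (\<lambda>(\<sigma>, \<alpha>s) \<beta>. (\<sigma>, map (\<lambda>\<alpha>. (\<alpha>, \<beta>)) \<alpha>s)) us \<gamma>s) \<tau> ! i"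
      using i ti t u tl 1 2 4 5 m l s s'
      by (auto simp: Comp_Sr prod_groupoid_def perms_length perms_nth intro!: nth_equalityI)
  qed (use tl 4 5 m in simp)
qed

section \<open>Full subgroupoids, and groupoids with identities only\<close>

lemma full_subgroupoid_sel [simp]:
  "Obj (full_subgroupoid S G) = Obj G \<inter> S" "Hom (full_subgroupoid S G) = Hom G"
  "Id (full_subgroupoid S G) = Id G" "Comp (full_subgroupoid S G) = Comp G"
  by (simp_all add: full_subgroupoid_def)

lemma Sr_full_subgroupoid [simp]:
  "Hom (Sr (full_subgroupoid S G)) = Hom (Sr G)" "Comp (Sr (full_subgroupoid S G)) = Comp (Sr G)"
  by (simp_all add: Sr_def tuples_def)

lemma is_functor_into_full:
  "\<lbrakk>is_functor F G H; \<And>x. x \<in> Obj G \<Longrightarrow> ob F x \<in> S\<rbrakk> \<Longrightarrow> is_functor F G (full_subgroupoid S H)"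
  by (simp add: is_functor_def)

lemma is_functor_from_full: "is_functor F G H \<Longrightarrow> is_functor F (full_subgroupoid S G) H"
  unfolding is_functor_def by (simp del: Int_iff) (metis Int_iff)

lemma pullback_sel:
  "Obj (pullback F F' G H) = {(x, y) \<in> Obj G \<times> Obj H. ob F x = ob F' y}"
  "Hom (pullback F F' G H) (x, y) (x', y') = {(f, g) \<in> Hom G x x' \<times> Hom H y y'. ar F f = ar F' g}"
  "Comp (pullback F F' G H) (g, g') (f, f') = (Comp G g f, Comp H g' f')"
  by (simp_all add: pullback_def prod_groupoid_def)

lemma is_functor_pairF_pullback:
  assumes K: "is_functor K G G'"
    and o: "\<And>x. x \<in> Obj G \<Longrightarrow> ob F2 (ob K x) = ob F x"
    and a: "\<And>x y f. \<lbrakk>x \<in> Obj G; y \<in> Obj G; f \<in> Hom G x y\<rbrakk> \<Longrightarrow> ar F2 (ar K f) = ar F f"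
  shows "is_functor (pairF (K \<odot> fstF) sndF) (pullback F F' G H) (pullback F2 F' G' H)"
proof -
  note K = functor_ob[OF K] functor_ar[OF K] functor_Comp[OF K]
  show ?thesis
    using K o a
    by (intro is_functorI) (auto simp: pullback_sel pairF_def fstF_def sndF_def)
qed

text \<open>Discreteness without fixing the labels: the identity at \<open>x\<close> need not be
  \<open>x\<close> itself, as it is in \<open>discrete\<close>. The quantifiers range over the whole
  type, so that restricting \<open>Obj\<close> leaves the property untouched.\<close>

definition only_identities :: "('o, 'm) groupoid \<Rightarrow> bool" where
  "only_identities G \<longleftrightarrow> (\<forall>x y. Hom G x y = (if x = y then {Id G x} else {})) \<and>
     (\<forall>x. Comp G (Id G x) (Id G x) = Id G x)"

lemma is_groupoid_only_identities: "only_identities G \<Longrightarrow> is_groupoid G"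
  by (unfold_locales) (auto simp: only_identities_def split: if_splits)

lemma is_functor_only_identities:
  assumes "only_identities G" "is_groupoid H"
    "\<And>x. x \<in> Obj G \<Longrightarrow> ob F x \<in> Obj H" "\<And>x. x \<in> Obj G \<Longrightarrow> ar F (Id G x) = Id H (ob F x)"
  shows "is_functor F G H"
proof -
  interpret H: is_groupoid H by fact
  show ?thesis
    using assms(1,3,4) H.Id_in H.Comp_Id_left[OF _ _ H.Id_in]
    by (intro is_functorI) (auto simp: only_identities_def split: if_splits)
qed

lemma only_identities_prod: "\<lbrakk>only_identities G; only_identities H\<rbrakk> \<Longrightarrow> only_identities (prod_groupoid G H)"
  by (auto simp: only_identities_def prod_groupoid_def)

lemma only_identities_full: "only_identities G \<Longrightarrow> only_identities (full_subgroupoid S G)"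
  by (simp add: only_identities_def)

lemma only_identities_discrete: "only_identities (discrete S)"
  by (auto simp: only_identities_def discrete_def)

text \<open>\<open>Mr\<close> admits the identity permutation alone, so no symmetry arises at this
  stage; all symmetry of the final operad comes from \<open>Sr\<close>.\<close>

lemma only_identities_Mr_discrete: "only_identities (Mr (discrete S))"
  by (auto simp: only_identities_def Mr_def tuples_def discrete_def intro!: nth_equalityI)

section \<open>Colours, arrows and operations of the operad\<close>

lemma UNIV_two: "(UNIV :: two set) = {One, Two}"
  by (auto intro: two.exhaust)

abbreviation colour_groupoid :: "(two, two) groupoid" where
  "colour_groupoid \<equiv> discrete {One, Two}"

abbreviation arrow_groupoid :: "(two list \<times> two, two tuple_arrow \<times> two) groupoid" where
  "arrow_groupoid \<equiv> arrows (T_M Ass2)"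

abbreviation sym_operad where
  "sym_operad \<equiv> T_S (T_M Ass2)"

abbreviation op_groupoid where
  "op_groupoid \<equiv> operations sym_operad"

lemma only_identities_arrow_groupoid: "only_identities arrow_groupoid"
  by (simp add: T_M_def Ass2_def only_identities_full only_identities_prod
      only_identities_Mr_discrete only_identities_discrete)

lemma Obj_arrow_groupoid: "Obj arrow_groupoid = {(cs, d). \<exists>c. set cs = {c}}"
  by (auto simp: T_M_def Ass2_def prod_groupoid_def Mr_def tuples_def discrete_def fstF_def UNIV_two[symmetric])

lemma Id_arrow_groupoid: "Id arrow_groupoid (cs, d) = (([0..<length cs], cs), d)"
  by (simp add: T_M_def Ass2_def prod_groupoid_def Mr_def tuples_def discrete_def)

lemma Hom_arrow_groupoid: "Hom arrow_groupoid x y = (if x = y then {Id arrow_groupoid x} else {})"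
  using only_identities_arrow_groupoid unfolding only_identities_def by blast

lemma op_groupoid_eq: "op_groupoid = full_subgroupoid {fs. \<exists>d. set (map snd fs) = {d}} (Sr arrow_groupoid)"
  by (simp add: T_S_def T_M_def Ass2_def sndF_def)

lemma is_groupoid_colour: "is_groupoid colour_groupoid"
  and is_groupoid_arrow: "is_groupoid arrow_groupoid"
  by (simp_all add: is_groupoid_only_identities only_identities_discrete only_identities_arrow_groupoid)

lemma is_groupoid_op: "is_groupoid op_groupoid"
  unfolding op_groupoid_eq by (intro is_groupoid_full_subgroupoid is_groupoid_Sr is_groupoid_arrow)

lemma colours_sym_operad: "colours sym_operad = colour_groupoid"
  by (simp add: T_S_def T_M_def Ass2_def)

lemma is_functor_sourceC: "is_functor (sourceC (T_M Ass2)) arrow_groupoid colour_groupoid"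
proof (rule is_functor_only_identities[OF only_identities_arrow_groupoid is_groupoid_colour])
  fix x assume "x \<in> Obj arrow_groupoid"
  show "ar (sourceC (T_M Ass2)) (Id arrow_groupoid x) = Id colour_groupoid (ob (sourceC (T_M Ass2)) x)"
    unfolding T_M_def
    by (cases x) (use Id_arrow_groupoid[unfolded T_M_def] in \<open>simp add: Ass2_def fstF_def discrete_def\<close>)
qed (simp add: discrete_def UNIV_two[symmetric])

lemma is_functor_sourceO: "is_functor (sourceO sym_operad) op_groupoid (Sr colour_groupoid)"
  unfolding op_groupoid_eq
  by (rule is_functor_from_full) (simp add: T_S_def is_functor_mapT[OF is_functor_sourceC])

lemma targetO_sel: "ob (targetO sym_operad) q = snd (hd q)" "ar (targetO sym_operad) (\<sigma>, fs) = snd (hd fs)"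
  by (simp_all add: T_S_def T_M_def Ass2_def sndF_def)

text \<open>The component arrows can only be identities, so an arrow of operations carries no data
  beyond its permutation, which together with the source determines the target.\<close>

lemma Hom_op_iff: "(\<sigma>, fs) \<in> Hom op_groupoid q q' \<longleftrightarrow>
    length q = length q' \<and> \<sigma> \<in> perms (length q) \<and> map ((!) q) \<sigma> = q' \<and> fs = map (Id arrow_groupoid) q'"
  by (auto simp: op_groupoid_eq Hom_Sr_iff Hom_arrow_groupoid perms_length split: if_splits intro!: nth_equalityI)

lemma op_targets_eq:
  assumes "q \<in> Obj op_groupoid" "q' \<in> Obj op_groupoid" "h \<in> Hom op_groupoid q q'"
  shows "snd (hd q') = snd (hd q)"
proof -
  have "mset q' = mset q"
    using assms(3) mset_map_nth_perms[of _ q] by (cases h) (auto simp: Hom_op_iff simp del: mset_map)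
  then have s: "set q' = set q" by (metis set_mset_mset)
  obtain d where d: "set (map snd q) = {d}" using assms(1) by (auto simp: op_groupoid_eq)
  have "q \<noteq> []" "q' \<noteq> []" using assms by (auto simp: op_groupoid_eq Obj_Sr)
  then have "hd q \<in> set q" "hd q' \<in> set q" using s hd_in_set by blast+
  then have "snd (hd q) \<in> set (map snd q)" "snd (hd q') \<in> set (map snd q)" by simp_all
  then show ?thesis using d by simp
qed

lemma is_functor_targetO: "is_functor (targetO sym_operad) op_groupoid colour_groupoid"
proof (rule is_functorI)
  fix q q' h assume q: "q \<in> Obj op_groupoid" "q' \<in> Obj op_groupoid" "h \<in> Hom op_groupoid q q'"
  have ar: "ar (targetO sym_operad) h = snd (hd q')" if q': "q' \<in> Obj op_groupoid" "h \<in> Hom op_groupoid q q'" for q q' h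
  proof -
    obtain \<sigma> fs where "h = (\<sigma>, fs)" by (cases h)
    moreover have "q' \<noteq> []" using q' by (auto simp: op_groupoid_eq Obj_Sr)
    moreover obtain cs d where "hd q' = (cs, d)" by (cases "hd q'")
    ultimately show ?thesis using q' by (auto simp: Hom_op_iff targetO_sel hd_map Id_arrow_groupoid)
  qed
  obtain \<sigma> fs where h: "h = (\<sigma>, fs)" by (cases h)
  have t: "snd (hd q') = snd (hd q)" using op_targets_eq[OF q] .
  then show "ar (targetO sym_operad) h \<in> Hom colour_groupoid (ob (targetO sym_operad) q) (ob (targetO sym_operad) q')"
    using ar[OF q(2,3)] t by (simp add: targetO_sel discrete_def)
  fix q'' k assume r: "q'' \<in> Obj op_groupoid" "k \<in> Hom op_groupoid q' q''"
  have "Comp op_groupoid k h \<in> Hom op_groupoid q q''"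
    using is_groupoid.Comp_in[OF is_groupoid_op q(1,2) r(1) q(3) r(2)] .
  have t': "snd (hd q'') = snd (hd q')" using op_targets_eq[OF q(2) r] .
  show "ar (targetO sym_operad) (Comp op_groupoid k h)
      = Comp colour_groupoid (ar (targetO sym_operad) k) (ar (targetO sym_operad) h)"
    using ar[OF r(1) \<open>Comp op_groupoid k h \<in> Hom op_groupoid q q''\<close>] ar[OF q(2,3)] t'
    by (simp add: discrete_def)
qed (simp add: discrete_def UNIV_two[symmetric])

text \<open>A copy of \<open>x\<close> is grafted onto every input of \<open>y\<close>, so arities
  multiply. This is the origin of the indices \<open>k * j\<close> in the plethysm.\<close>

lemma composeC_ob: "ob (composeC (T_M Ass2)) (x, y) = (concat (replicate (length (fst y)) (fst x)), snd y)"
  by (simp add: T_M_def Ass2_def pairF_def fstF_def sndF_def)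

lemma composeC_ar: "ar (composeC (T_M Ass2)) (f, g)
    = (ar (multT :: (two list list, two tuple_arrow tuple_arrow, two list, two tuple_arrow) gfunctor) ([0..<length (snd (fst g))], replicate (length (snd (fst g))) (fst f)), snd g)"
  by (simp add: T_M_def Ass2_def pairF_def fstF_def sndF_def Let_def)

lemma is_functor_composeC:
  "is_functor (composeC (T_M Ass2)) (prod_groupoid arrow_groupoid arrow_groupoid) arrow_groupoid"
proof (rule is_functor_only_identities[OF _ is_groupoid_arrow])
  show "only_identities (prod_groupoid arrow_groupoid arrow_groupoid)"
    by (simp add: only_identities_prod only_identities_arrow_groupoid)
next
  fix p assume "p \<in> Obj (prod_groupoid arrow_groupoid arrow_groupoid)"
  then obtain cs d es e where p: "p = ((cs, d), (es, e))" "\<exists>c. set cs = {c}" "\<exists>c. set es = {c}"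
    by (auto simp: prod_groupoid_def Obj_arrow_groupoid)
  show "ob (composeC (T_M Ass2)) p \<in> Obj arrow_groupoid"
    using p by (auto simp: composeC_ob Obj_arrow_groupoid)
  let ?D = "colour_groupoid"
  have "replicate (length es) cs \<in> Obj (Sr (Sr ?D))"
    using p by (auto simp: Obj_Sr discrete_def UNIV_two[symmetric])
  \<comment> \<open>Functoriality of \<open>multT\<close> replaces the computation of the block
    permutation of an identity.\<close>
  from functor_Id[OF is_functor_multT is_groupoid_Sr[OF is_groupoid_Sr] is_groupoid_Sr this, OF is_groupoid_colour is_groupoid_colour is_groupoid_colour]
  have "ar (multT :: (two list list, two tuple_arrow tuple_arrow, two list, two tuple_arrow) gfunctor)
      ([0..<length es], replicate (length es) ([0..<length cs], cs))
      = ([0..<length (concat (replicate (length es) cs))], concat (replicate (length es) cs))"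
    by (simp add: Id_Sr discrete_def)
  then show "ar (composeC (T_M Ass2)) (Id (prod_groupoid arrow_groupoid arrow_groupoid) p)
      = Id arrow_groupoid (ob (composeC (T_M Ass2)) p)"
    by (simp add: p prod_groupoid_def Id_arrow_groupoid composeC_ar composeC_ob)
qed

abbreviation composables where
  "composables \<equiv> pullback (mapT (targetO sym_operad)) (sourceO sym_operad) (Sr op_groupoid) op_groupoid"

lemma composeO_eq: "composeO sym_operad = mapT (composeC (T_M Ass2)) \<odot> multT \<odot> distribute"
  and sourceO_eq: "sourceO sym_operad = mapT (sourceC (T_M Ass2))"
  by (simp_all add: T_S_def)

lemma is_functor_composeO: "is_functor (composeO sym_operad) composables op_groupoid"
proof -
  let ?A = arrow_groupoid
  have objs: "length gss = length fs \<and> gss \<in> Obj (Sr (Sr ?A)) \<and> fs \<in> Obj (Sr ?A)"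
    if "(gss, fs) \<in> Obj composables" for gss fs
  proof -
    have "length (map (ob (targetO sym_operad)) gss) = length (map (ob (sourceC (T_M Ass2))) fs)"
      using that by (auto simp: pullback_sel sourceO_eq dest: map_eq_imp_length_eq)
    then show ?thesis using that by (auto simp: pullback_sel op_groupoid_eq Obj_Sr)
  qed
  have dist: "is_functor distribute composables (Sr (Sr (prod_groupoid ?A ?A)))"
  proof (rule is_functor_distribute[OF objs])
    fix gss fs gss' fs' h k assume a: "(h, k) \<in> Hom composables (gss, fs) (gss', fs')"
    obtain \<pi> ts \<rho> \<beta>s where "h = (\<pi>, ts)" "k = (\<rho>, \<beta>s)" by (cases h, cases k)
    then show "h \<in> Hom (Sr (Sr ?A)) gss gss' \<and> k \<in> Hom (Sr ?A) fs fs' \<and> fst h = fst k"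
      using a by (auto simp: pullback_sel sourceO_eq op_groupoid_eq)
  qed (simp_all add: pullback_sel op_groupoid_eq)
  have F: "is_functor (composeO sym_operad) composables (Sr ?A)"
    unfolding composeO_eq
    by (intro is_functor_compF[OF dist] is_functor_compF[OF is_functor_multT] is_functor_mapT
        is_functor_composeC is_groupoid_prod is_groupoid_arrow)
  \<comment> \<open>A composite ends where its root arrow ends, and the root arrows share their
    target; so the resulting tuple is again an operation.\<close>
  have "\<exists>d. set (map snd (ob (composeO sym_operad) x)) = {d}" if x: "x \<in> Obj composables" for x
  proof -
    obtain gss fs where x': "x = (gss, fs)" by (cases x)
    have o: "length gss = length fs" "gss \<in> Obj (Sr (Sr ?A))" using objs x x' by auto
    obtain d where d: "set (map snd fs) = {d}" using x by (auto simp: x' pullback_sel op_groupoid_eq)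
    have "\<And>p. p \<in> set fs \<Longrightarrow> snd p = d" using d by auto
    then have "set (map snd (ob (composeO sym_operad) x)) \<subseteq> {d}"
      by (auto simp: composeO_eq x' ob_distribute composeC_ob dest!: set_zip_rightD)
    moreover have "ob (composeO sym_operad) x \<noteq> []"
      using functor_ob[OF F x] by (simp add: Obj_Sr)
    ultimately show ?thesis by (cases "ob (composeO sym_operad) x") auto
  qed
  then show ?thesis
    unfolding op_groupoid_eq[of] using F by (intro is_functor_into_full) (auto simp: op_groupoid_eq)
qed

lemma card_outs_relabel:
  assumes "inj (ob F)" "inj (ar F)"
  shows "card (outs (relabel F G) (ob F x)) = card (outs G x)"
  unfolding outs_relabel[OF assms]
  by (rule card_image) (use prod.inj_map[OF assms] in \<open>auto intro: inj_on_subset\<close>)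

lemma is_functor_cong:
  assumes F: "is_functor F G H" and G: "is_groupoid G"
    and o: "\<And>x. x \<in> Obj G \<Longrightarrow> ob F' x = ob F x"
    and a: "\<And>x y f. f \<in> Hom G x y \<Longrightarrow> ar F' f = ar F f"
  shows "is_functor F' G H"
proof (rule is_functorI)
  note F = functor_ob[OF F] functor_ar[OF F] functor_Comp[OF F]
  show "ob F' x \<in> Obj H" if "x \<in> Obj G" for x using F o that by simp
  show "ar F' f \<in> Hom H (ob F' x) (ob F' y)" if "x \<in> Obj G" "y \<in> Obj G" "f \<in> Hom G x y" for x y f
    using F o a that by simp
  show "ar F' (Comp G g f) = Comp H (ar F' g) (ar F' f)"
    if "x \<in> Obj G" "y \<in> Obj G" "z \<in> Obj G" "f \<in> Hom G x y" "g \<in> Hom G y z" for x y z f g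
    using F(3)[OF that] a[OF is_groupoid.Comp_in[OF G that]] a[OF that(4)] a[OF that(5)] by simp
qed

section \<open>Words and trees\<close>

text \<open>The multiset of the entries, written as an exponent vector: the monomial spelt by a
  word. It serves for words in the variables as well as for lists of generators.\<close>

definition msum :: "'a list \<Rightarrow> ('a \<Rightarrow>\<^sub>0 nat)" where
  "msum xs = (\<Sum>x\<leftarrow>xs. Poly_Mapping.single x 1)"

lemma msum_simps [simp]: "msum [] = 0" "msum (x # xs) = Poly_Mapping.single x 1 + msum xs"
  "msum (xs @ ys) = msum xs + msum ys"
  by (simp_all add: msum_def)

lemma lookup_msum: "Poly_Mapping.lookup (msum xs) x = count (mset xs) x"
  by (induction xs) (auto simp: lookup_add lookup_single when_def)

lemma keys_msum [simp]: "Poly_Mapping.keys (msum xs) = set xs"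
  by (auto simp: in_keys_iff lookup_msum)

lemma msum_eq_iff: "msum xs = msum ys \<longleftrightarrow> mset xs = mset ys"
  by (auto simp: poly_mapping_eq_iff fun_eq_iff lookup_msum multiset_eq_iff)

lemma msum_eq_0_iff [simp]: "msum xs = 0 \<longleftrightarrow> xs = []"
  using msum_eq_iff[of xs "[]"] by simp

lemma msum_surj: "\<exists>xs. msum xs = m"
proof -
  have "finite {x. 0 < Poly_Mapping.lookup m x}"
    using finite_lookup[of m] by simp
  then obtain xs where "mset xs = Abs_multiset (Poly_Mapping.lookup m)"
    using ex_mset by blast
  then have "msum xs = m"
    using \<open>finite {x. 0 < Poly_Mapping.lookup m x}\<close>
    by (intro poly_mapping_eqI) (simp add: lookup_msum Abs_multiset_inverse)
  then show ?thesis by blast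
qed

lemma prod_keys_msum:
  fixes h :: "'a \<Rightarrow> 'b :: comm_monoid_mult"
  shows "(\<Prod>v\<in>Poly_Mapping.keys (msum xs). h v ^ Poly_Mapping.lookup (msum xs) v) = prod_list (map h xs)"
  using image_prod_mset_multiplicity[of h "mset xs"]
  by (simp add: lookup_msum prod_mset_prod_list flip: mset_map)

text \<open>The multinomial coefficient, with the denominator multiplied out.\<close>

lemma card_msum_class:
  "of_nat (card {ys. msum ys = msum xs}) * (\<Prod>v\<in>set xs. fact (Poly_Mapping.lookup (msum xs) v)) = (fact (length xs) :: rat)"
  "finite {ys. msum ys = msum xs}"
proof -
  have eq: "{ys. msum ys = msum xs} = permutations_of_multiset (mset xs)"
    by (auto simp: msum_eq_iff permutations_of_multiset_def)
  show "finite {ys. msum ys = msum xs}" by (simp add: eq)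
  have "card (permutations_of_multiset (mset xs)) * (\<Prod>v\<in>set xs. fact (count (mset xs) v)) = fact (length xs)"
    using card_permutations_of_multiset[of "mset xs"] by (metis dvd_div_mult_self set_mset_mset size_mset)
  from arg_cong[OF this, of "of_nat :: nat \<Rightarrow> rat"]
  show "of_nat (card {ys. msum ys = msum xs}) * (\<Prod>v\<in>set xs. fact (Poly_Mapping.lookup (msum xs) v)) = (fact (length xs) :: rat)"
    by (simp add: eq lookup_msum)
qed

definition words :: "pvar list set" where
  "words = {w. w \<noteq> [] \<and> (\<forall>v\<in>set w. 1 \<le> snd v)}"

text \<open>The letter \<open>(c, k)\<close> stands for the arrow with \<open>k\<close> inputs, all of colour \<open>c\<close>, and output \<open>d\<close>.\<close>

definition op_of_word :: "two \<Rightarrow> pvar list \<Rightarrow> (two list \<times> two) list" where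
  "op_of_word d w = map (\<lambda>(c, k). (replicate k c, d)) w"

lemma length_op_of_word [simp]: "length (op_of_word d w) = length w"
  by (simp add: op_of_word_def)

text \<open>The colour of a letter \<open>(c, k)\<close> is visible in \<open>replicate k c\<close>
  only for positive \<open>k\<close>, and the output colour is visible only in a nonempty word. Both
  conditions in \<open>words\<close> serve this purpose.\<close>

lemma op_of_word_inj:
  assumes "w \<in> words" "w' \<in> words" "op_of_word d w = op_of_word d' w'"
  shows "d = d'" "w = w'"
proof -
  have l: "length w = length w'" using assms(3) by (metis length_op_of_word)
  have nth: "replicate (snd (w ! i)) (fst (w ! i)) = replicate (snd (w' ! i)) (fst (w' ! i)) \<and> d = d'" if "i < length w" for i
    using arg_cong[OF assms(3), of "\<lambda>l. l ! i"] that l by (simp add: op_of_word_def case_prod_beta)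
  show "d = d'" using nth[of 0] assms(1) by (simp add: words_def)
  show "w = w'"
  proof (rule nth_equalityI[OF l])
    fix i assume i: "i < length w"
    then have "1 \<le> snd (w ! i)" using assms(1) by (simp add: words_def)
    then show "w ! i = w' ! i" using nth[OF i] by (auto simp: replicate_eq_replicate prod_eq_iff)
  qed
qed

lemma Obj_op: "Obj op_groupoid = {op_of_word d w |d w. w \<in> words}"
proof (intro subset_antisym subsetI)
  fix q assume "q \<in> Obj op_groupoid"
  then have q: "q \<noteq> []" "\<And>x. x \<in> set q \<Longrightarrow> \<exists>c. set (fst x) = {c}" "\<exists>d. set (map snd q) = {d}"
    by (auto simp: op_groupoid_eq Obj_Sr Obj_arrow_groupoid)
  then obtain d where "set (map snd q) = {d}" by blast
  then have d: "\<And>x. x \<in> set q \<Longrightarrow> snd x = d" by auto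
  define w where "w = map (\<lambda>(cs, d). (hd cs, length cs)) q"
  have rep: "replicate (length cs) (hd cs) = cs" if "set cs = {c}" for cs and c :: two
    using that by (cases cs) (auto intro!: replicate_length_same)
  have "op_of_word d w = map (\<lambda>(cs, d'). (replicate (length cs) (hd cs), d)) q"
    by (simp add: op_of_word_def w_def o_def case_prod_beta)
  also have "\<dots> = q"
  proof (rule map_idI)
    fix x assume x: "x \<in> set q"
    obtain c where "set (fst x) = {c}" using q(2)[OF x] by blast
    then show "(case x of (cs, d') \<Rightarrow> (replicate (length cs) (hd cs), d)) = x"
      using d[OF x] rep by (cases x) auto
  qed
  finally have "q = op_of_word d w" by simp
  moreover have "w \<in> words"
  proof -
    have "1 \<le> length (fst x)" if "x \<in> set q" for x
      using q(2)[OF that] by (cases "fst x") auto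
    then show ?thesis using q(1) by (auto simp: words_def w_def)
  qed
  ultimately show "q \<in> {op_of_word d w |d w. w \<in> words}" by auto
next
  fix q assume "q \<in> {op_of_word d w |d w. w \<in> words}"
  then obtain d w where q: "q = op_of_word d w" "w \<noteq> []" "\<And>v. v \<in> set w \<Longrightarrow> 1 \<le> snd v"
    by (auto simp: words_def)
  show "q \<in> Obj op_groupoid"
  proof -
    have "set (map snd q) = {d}"
      using q(2) by (cases w) (auto simp: q(1) op_of_word_def)
    moreover have "x \<in> Obj arrow_groupoid" if x: "x \<in> set q" for x
    proof -
      obtain v where v: "v \<in> set w" "x = (replicate (snd v) (fst v), d)"
        using x by (auto simp: q(1) op_of_word_def)
      then have "set (fst x) = {fst v}" using q(3)[OF v(1)] by (simp add: set_replicate_conv_if)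
      then show ?thesis using v(2) by (auto simp: Obj_arrow_groupoid)
    qed
    moreover have "q \<noteq> []" using q(1,2) by (simp add: op_of_word_def)
    ultimately show ?thesis by (auto simp: op_groupoid_eq Obj_Sr simp del: set_map)
  qed
qed

lemma map_nth_op_of_word:
  "\<sigma> \<in> perms (length w) \<Longrightarrow> map ((!) (op_of_word d w)) \<sigma> = op_of_word d (map ((!) w) \<sigma>)"
  by (auto simp: op_of_word_def perms_set)

lemma map_nth_words: "\<lbrakk>w \<in> words; \<sigma> \<in> perms (length w)\<rbrakk> \<Longrightarrow> map ((!) w) \<sigma> \<in> words"
  by (auto simp: words_def perms_set perms_length dest: perms_length)

text \<open>Each permutation of the letters is one arrow, whether or not it changes the word;
  repetitions affect the automorphisms but not this count.\<close>

lemma outs_op: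
  assumes "w \<in> words"
  shows "card (outs op_groupoid (op_of_word d w)) = fact (length w)" "finite (outs op_groupoid (op_of_word d w))"
proof -
  let ?q = "op_of_word d w"
  let ?f = "\<lambda>\<sigma>. (map ((!) ?q) \<sigma>, (\<sigma>, map (Id arrow_groupoid) (map ((!) ?q) \<sigma>)))"
  have eq: "outs op_groupoid ?q = ?f ` perms (length w)"
  proof (intro subset_antisym subsetI)
    fix u assume "u \<in> outs op_groupoid ?q"
    then show "u \<in> ?f ` perms (length w)"
      by (cases u) (auto simp: outs_def Hom_op_iff)
  next
    fix u assume "u \<in> ?f ` perms (length w)"
    then obtain \<sigma> where \<sigma>: "\<sigma> \<in> perms (length w)" "u = ?f \<sigma>" by blast
    have "map ((!) ?q) \<sigma> \<in> Obj op_groupoid"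
      using map_nth_op_of_word[OF \<sigma>(1)] map_nth_words[OF assms \<sigma>(1)] by (auto simp: Obj_op)
    then show "u \<in> outs op_groupoid ?q"
      using \<sigma> by (auto simp: outs_def Hom_op_iff perms_length)
  qed
  have "inj_on ?f (perms (length w))" by (auto simp: inj_on_def)
  then show "card (outs op_groupoid ?q) = fact (length w)" "finite (outs op_groupoid ?q)"
    unfolding eq by (simp_all add: card_image)
qed

lemma finite_Hom_op: "finite (Hom op_groupoid q q')"
proof (rule finite_subset)
  show "Hom op_groupoid q q' \<subseteq> perms (length q) \<times> {map (Id arrow_groupoid) q'}"
    by (auto simp: Hom_op_iff)
qed simp

lemma Hom_op_nonempty:
  assumes "w \<in> words" "w' \<in> words"
  shows "Hom op_groupoid (op_of_word d w) (op_of_word d' w') \<noteq> {} \<longleftrightarrow> (d, msum w) = (d', msum w')"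
proof
  assume "Hom op_groupoid (op_of_word d w) (op_of_word d' w') \<noteq> {}"
  then obtain \<sigma> where \<sigma>: "\<sigma> \<in> perms (length w)" "map ((!) (op_of_word d w)) \<sigma> = op_of_word d' w'"
    by (auto simp: Hom_op_iff)
  have "d = d'" "map ((!) w) \<sigma> = w'"
    using op_of_word_inj[OF map_nth_words[OF assms(1) \<sigma>(1)] assms(2)] \<sigma> map_nth_op_of_word by metis+
  then show "(d, msum w) = (d', msum w')"
    using mset_map_nth_perms[OF \<sigma>(1)] by (simp add: msum_eq_iff)
next
  assume "(d, msum w) = (d', msum w')"
  then obtain \<sigma> where \<sigma>: "\<sigma> \<in> perms (length w)" "map ((!) w) \<sigma> = w'" "d = d'"
    using mset_eq_perms[of w' w] by (auto simp: msum_eq_iff)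
  then have "map ((!) (op_of_word d w)) \<sigma> = op_of_word d' w'"
    using map_nth_op_of_word by simp
  moreover have "length w = length w'" using \<sigma> perms_length by fastforce
  ultimately have "(\<sigma>, map (Id arrow_groupoid) (op_of_word d' w')) \<in> Hom op_groupoid (op_of_word d w) (op_of_word d' w')"
    using \<sigma>(1) by (simp add: Hom_op_iff)
  then show "Hom op_groupoid (op_of_word d w) (op_of_word d' w') \<noteq> {}" by blast
qed

text \<open>Orbit-stabiliser: the \<open>n!\<close> arrows leaving a word with exponents \<mu> are
  spread evenly over the n!/\<mu>! words of its component, which leaves \<mu>! for each hom-set.
  This is the source of the exponential normalisation.\<close>

lemma card_Hom_op:
  assumes "w \<in> words" "w' \<in> words"
  shows "of_nat (card (Hom op_groupoid (op_of_word d w) (op_of_word d' w')))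
    = (if (d, msum w) = (d', msum w') then exp_factorial (msum w') else 0)"
proof (cases "(d, msum w) = (d', msum w')")
  case True
  interpret is_groupoid op_groupoid by (rule is_groupoid_op)
  have o: "op_of_word d w \<in> Obj op_groupoid" "op_of_word d w' \<in> Obj op_groupoid" using assms by (auto simp: Obj_op)
  have words: "v \<in> words" if "msum v = msum w'" for v
  proof -
    have "mset v = mset w'" using that by (simp add: msum_eq_iff)
    then have "set v = set w'" "v \<noteq> []" using assms(2) mset_eq_setD[of v w'] by (auto simp: words_def)
    then show ?thesis using assms(2) by (simp add: words_def)
  qed
  have comp: "component op_groupoid (op_of_word d w') = op_of_word d ` {v. msum v = msum w'}"
  proof (intro subset_antisym subsetI)
    fix q assume "q \<in> component op_groupoid (op_of_word d w')"
    then obtain d' v where "q = op_of_word d' v" "v \<in> words" "Hom op_groupoid (op_of_word d w') (op_of_word d' v) \<noteq> {}"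
      by (auto simp: component_def Obj_op)
    then show "q \<in> op_of_word d ` {v. msum v = msum w'}" using Hom_op_nonempty[OF assms(2)] by auto
  next
    fix q assume "q \<in> op_of_word d ` {v. msum v = msum w'}"
    then obtain v where v: "q = op_of_word d v" "msum v = msum w'" by blast
    then have "v \<in> words" using words by blast
    then show "q \<in> component op_groupoid (op_of_word d w')"
      using Hom_op_nonempty[OF assms(2), of v d d] v by (auto simp: component_def Obj_op)
  qed
  have fin: "finite {v. msum v = msum w'}" by (rule card_msum_class)
  have inj: "inj_on (op_of_word d) {v. msum v = msum w'}"
    using op_of_word_inj words by (auto simp: inj_on_def)
  have "card (outs op_groupoid (op_of_word d w'))
      = card {v. msum v = msum w'} * card (Hom op_groupoid (op_of_word d w') (op_of_word d w'))"
    using card_outs[OF o(2)] fin comp card_image[OF inj] by simp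
  then have 1: "fact (length w') = of_nat (card {v. msum v = msum w'}) * rat_of_nat (card (Hom op_groupoid (op_of_word d w') (op_of_word d w')))"
    using outs_op(1)[OF assms(2), of d] by (metis of_nat_fact of_nat_mult)
  have "card {v. msum v = msum w'} \<noteq> 0" using fin by auto
  then have "rat_of_nat (card (Hom op_groupoid (op_of_word d w') (op_of_word d w'))) = exp_factorial (msum w')"
    using 1 card_msum_class(1)[of w'] by (simp add: exp_factorial_def)
  moreover have "card (Hom op_groupoid (op_of_word d w) (op_of_word d w')) = card (Hom op_groupoid (op_of_word d w') (op_of_word d w'))"
    using card_Hom_eq'[OF o(2) o] True Hom_op_nonempty[OF assms, of d d] by simp
  ultimately show ?thesis using True by auto
next
  case False
  then show ?thesis using Hom_op_nonempty[OF assms, of d d'] by auto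
qed

section \<open>Cells of one level\<close>

lemma inj_embeddings: "inj (ob operF)" "inj (ar operF)" "inj (ob graftF)" "inj (ar graftF)"
    "inj (ob colourF)" "inj (ar colourF)"
  by (simp_all add: operF_def graftF_def colourF_def inj_def)

lemma inv_embeddings: "ob (inv_functor operF) (Oper q) = q" "ar (inv_functor operF) (OperA r) = r"
    "ob (inv_functor graftF) (Graft x) = x" "ar (inv_functor graftF) (GraftA h) = h"
    "ob (inv_functor colourF) (Colour c) = c"
  by (simp_all add: inv_functor_def operF_def graftF_def colourF_def inv_f_f inj_def)

lemma embedding_sel: "ob operF = Oper" "ar operF = OperA" "ob graftF = Graft" "ar graftF = GraftA"
    "ob colourF = Colour" "ar colourF = ColourA"
  by (simp_all add: operF_def graftF_def colourF_def)

declare cells.simps [simp del]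

abbreviation cells1 where "cells1 \<equiv> cells sym_operad (Suc 0)"
abbreviation cells2 where "cells2 \<equiv> cells sym_operad (Suc (Suc 0))"

lemma cells1_eq: "cells1 = relabel operF op_groupoid"
  by (simp add: cells.simps)

lemma is_groupoid_cells1: "is_groupoid cells1"
  by (simp add: cells1_eq is_groupoid_relabel is_groupoid_op inj_embeddings)

lemma Obj_cells1: "Obj cells1 = {Oper (op_of_word d w) |d w. w \<in> words}"
  by (auto simp: cells1_eq relabel_def Obj_op operF_def)

lemma card_Hom_cells1: "card (Hom cells1 (Oper q) (Oper q')) = card (Hom op_groupoid q q')"
  using card_Hom_relabel[OF inj_embeddings(1,2)] by (simp add: cells1_eq operF_def)

lemma finite_Hom_cells1: "finite (Hom cells1 x y)"
  by (simp add: cells1_eq relabel_def finite_Hom_op)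

lemma outs_cells1:
  assumes "w \<in> words"
  shows "card (outs cells1 (Oper (op_of_word d w))) = fact (length w)" "finite (outs cells1 (Oper (op_of_word d w)))"
proof -
  note r = card_outs_relabel[OF inj_embeddings(1,2), of op_groupoid "op_of_word d w", unfolded embedding_sel]
    outs_relabel[OF inj_embeddings(1,2), of op_groupoid "op_of_word d w", unfolded embedding_sel]
  show "card (outs cells1 (Oper (op_of_word d w))) = fact (length w)"
    using r(1) outs_op[OF assms, of d] by (simp add: cells1_eq)
  show "finite (outs cells1 (Oper (op_of_word d w)))"
    using outs_op(2)[OF assms, of d] by (simp add: cells1_eq r(2))
qed

lemma is_functor_outputF: "is_functor (outputF sym_operad) cells1 colour_groupoid"
proof -
  have t: "is_functor (targetO sym_operad \<odot> inv_functor operF) cells1 colour_groupoid"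
    unfolding cells1_eq
    by (rule is_functor_compF[OF is_functor_inv_functor is_functor_targetO]) (simp_all add: inj_embeddings)
  show ?thesis
  proof (rule is_functor_cong[OF t])
    fix x assume "x \<in> Obj cells1"
    then show "ob (outputF sym_operad) x = ob (targetO sym_operad \<odot> inv_functor operF) x"
      by (auto simp: Obj_cells1 outputF_def inv_embeddings)
  next
    fix x y f assume "f \<in> Hom cells1 x y"
    then show "ar (outputF sym_operad) f = ar (targetO sym_operad \<odot> inv_functor operF) f"
      by (auto simp: cells1_eq relabel_def outputF_def embedding_sel inv_embeddings)
  qed (rule is_groupoid_cells1)
qed

text \<open>An entry \<open>(v, us)\<close> is a letter \<open>v\<close> of the root operation together with the operation grafted onto it.\<close>

definition trees :: "(pvar \<times> pvar list) list set" where
  "trees = {z. z \<noteq> [] \<and> (\<forall>(v, us)\<in>set z. 1 \<le> snd v \<and> us \<in> words)}"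

definition tree_tops :: "(pvar \<times> pvar list) list \<Rightarrow> (two, (two list \<times> two) list) cell list" where
  "tree_tops z = map (\<lambda>(v, us). Oper (op_of_word (fst v) us)) z"

definition tree_cell :: "two \<Rightarrow> (pvar \<times> pvar list) list \<Rightarrow> (two, (two list \<times> two) list) cell" where
  "tree_cell d z = Graft (tree_tops z, op_of_word d (map fst z))"

text \<open>The effect on a word of being grafted onto an input letter of arity \<open>k\<close>; on
  monomials it is dilation by \<open>k\<close>.\<close>

definition scale_word :: "nat \<Rightarrow> pvar list \<Rightarrow> pvar list" where
  "scale_word k us = map (\<lambda>(c, j). (c, k * j)) us"

text \<open>The word of the composite operation, by \<open>compose_tree_cell\<close>.\<close>

definition tree_word :: "(pvar \<times> pvar list) list \<Rightarrow> pvar list" where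
  "tree_word z = concat (map (\<lambda>(v, us). scale_word (snd v) us) z)"

lemma trees_root: "z \<in> trees \<Longrightarrow> map fst z \<in> words"
  by (auto simp: trees_def words_def)

lemma trees_tops: "\<lbrakk>z \<in> trees; (v, us) \<in> set z\<rbrakk> \<Longrightarrow> us \<in> words \<and> 1 \<le> snd v"
  by (auto simp: trees_def)

lemma scale_word_words: "\<lbrakk>us \<in> words; 1 \<le> k\<rbrakk> \<Longrightarrow> scale_word k us \<in> words"
  by (fastforce simp: words_def scale_word_def)

lemma tree_word_words: "z \<in> trees \<Longrightarrow> tree_word z \<in> words"
proof -
  assume z: "z \<in> trees"
  have *: "scale_word (snd v) us \<in> words" if "(v, us) \<in> set z" for v us
    using trees_tops[OF z that] scale_word_words by simp
  obtain v us z' where "z = (v, us) # z'" using z by (cases z) (auto simp: trees_def)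
  then have "tree_word z \<noteq> []" using *[of v us] by (auto simp: tree_word_def words_def)
  moreover have "1 \<le> snd x" if x: "x \<in> set (tree_word z)" for x
  proof -
    obtain v us where "(v, us) \<in> set z" "x \<in> set (scale_word (snd v) us)"
      using x by (auto simp: tree_word_def)
    then show ?thesis using * by (auto simp: words_def)
  qed
  ultimately show ?thesis by (simp add: words_def)
qed

section \<open>Cells of two levels\<close>

abbreviation trees_groupoid where
  "trees_groupoid \<equiv> pullback (mapT (outputF sym_operad)) (sourceO sym_operad) (Sr cells1) op_groupoid"

lemma cells2_eq: "cells2 = relabel graftF trees_groupoid"
  by (simp add: cells.simps)

lemma output_word: "us \<in> words \<Longrightarrow> ob (outputF sym_operad) (Oper (op_of_word c us)) = c"
  by (cases us) (auto simp: outputF_def targetO_sel op_of_word_def words_def)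

lemma sourceC_sel: "ob (sourceC (T_M Ass2)) (cs, d) = hd cs" "ar (sourceC (T_M Ass2)) ((\<sigma>, fs), e) = hd fs"
  by (simp_all add: T_M_def Ass2_def fstF_def)

lemma source_word: "w \<in> words \<Longrightarrow> ob (sourceO sym_operad) (op_of_word d w) = map fst w"
  by (auto simp: sourceO_eq op_of_word_def words_def sourceC_sel hd_replicate Suc_le_eq)

text \<open>The matching condition of the pullback forces the output colour of a top to be the
  colour of the root letter below it. That is why a tree stores only the word of a top, and
  \<open>tree_tops\<close> can restore the rest.\<close>

lemma Obj_trees_groupoid: "Obj trees_groupoid = {(tree_tops z, op_of_word d (map fst z)) |d z. z \<in> trees}"
proof (intro subset_antisym subsetI)
  fix x assume "x \<in> Obj trees_groupoid"
  then obtain xs q where x: "x = (xs, q)" "xs \<in> Obj (Sr cells1)" "q \<in> Obj op_groupoid"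
    "map (ob (outputF sym_operad)) xs = ob (sourceO sym_operad) q"
    by (auto simp: pullback_sel)
  obtain d w where w: "q = op_of_word d w" "w \<in> words" using x(3) by (auto simp: Obj_op)
  have out: "map (ob (outputF sym_operad)) xs = map fst w"
    using x(4) source_word w by simp
  then have l: "length xs = length w" by (metis length_map)
  have "\<forall>i<length w. \<exists>us. us \<in> words \<and> xs ! i = Oper (op_of_word (fst (w ! i)) us)"
  proof (intro allI impI)
    fix i assume i: "i < length w"
    then have "xs ! i \<in> Obj cells1" using x(2) l by (simp add: Obj_Sr_nth)
    then obtain c us where "us \<in> words" "xs ! i = Oper (op_of_word c us)" by (auto simp: Obj_cells1)
    then show "\<exists>us. us \<in> words \<and> xs ! i = Oper (op_of_word (fst (w ! i)) us)"
      using arg_cong[OF out, of "\<lambda>l. l ! i"] i l output_word by auto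
  qed
  then obtain us where us: "\<And>i. i < length w \<Longrightarrow> us i \<in> words \<and> xs ! i = Oper (op_of_word (fst (w ! i)) (us i))"
    by metis
  define z where "z = map (\<lambda>i. (w ! i, us i)) [0..<length w]"
  have "map fst z = w" by (simp add: z_def o_def map_nth)
  moreover have "tree_tops z = xs" using us l by (auto simp: z_def tree_tops_def intro!: nth_equalityI)
  moreover have "z \<in> trees" using us w(2) by (auto simp: z_def trees_def words_def)
  ultimately show "x \<in> {(tree_tops z, op_of_word d (map fst z)) |d z. z \<in> trees}"
    using x(1) w(1) by blast
next
  fix x assume "x \<in> {(tree_tops z, op_of_word d (map fst z)) |d z. z \<in> trees}"
  then obtain d z where x: "x = (tree_tops z, op_of_word d (map fst z))" and z: "z \<in> trees" by blast
  have "map (ob (outputF sym_operad)) (tree_tops z) = map fst (map fst z)"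
    using trees_tops[OF z] output_word by (auto simp: tree_tops_def)
  moreover have "tree_tops z \<in> Obj (Sr cells1)"
  proof -
    have "tree_tops z \<noteq> []" using z by (simp add: trees_def tree_tops_def)
    moreover have "x \<in> Obj cells1" if x: "x \<in> set (tree_tops z)" for x
    proof -
      obtain v us where "(v, us) \<in> set z" "x = Oper (op_of_word (fst v) us)"
        using x by (auto simp: tree_tops_def)
      then show ?thesis unfolding Obj_cells1 using trees_tops[OF z] by blast
    qed
    ultimately show ?thesis by (auto simp: Obj_Sr)
  qed
  ultimately show "x \<in> Obj trees_groupoid"
    using trees_root[OF z] source_word by (auto simp: x pullback_sel Obj_op)
qed

lemma Obj_cells2: "Obj cells2 = {tree_cell d z |d z. z \<in> trees}"
  unfolding cells2_eq relabel_def groupoid.simps Obj_trees_groupoid by (auto simp: graftF_def tree_cell_def)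

lemma tree_cell_inj:
  assumes "z \<in> trees" "z' \<in> trees" "tree_cell d z = tree_cell d' z'"
  shows "d = d' \<and> z = z'"
proof -
  have 1: "d = d'" "map fst z = map fst z'"
    using assms op_of_word_inj[OF trees_root trees_root] by (auto simp: tree_cell_def)
  have l: "length z = length z'" using 1(2) by (metis length_map)
  have "z ! i = z' ! i" if i: "i < length z" for i
  proof -
    have "Oper (op_of_word (fst (fst (z ! i))) (snd (z ! i))) = (Oper (op_of_word (fst (fst (z' ! i))) (snd (z' ! i))) :: (two, _) cell)"
      using assms(3) i l by (auto simp: tree_cell_def tree_tops_def case_prod_beta dest!: arg_cong[where f = "\<lambda>l. l ! i"])
    moreover have "snd (z ! i) \<in> words" "snd (z' ! i) \<in> words"
      using trees_tops[OF assms(1), of "fst (z ! i)" "snd (z ! i)"] trees_tops[OF assms(2), of "fst (z' ! i)" "snd (z' ! i)"] i l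
      by simp_all
    ultimately have "snd (z ! i) = snd (z' ! i)" using op_of_word_inj(2) by blast
    moreover have "fst (z ! i) = fst (z' ! i)" using arg_cong[OF 1(2), of "\<lambda>l. l ! i"] i l by simp
    ultimately show ?thesis by (simp add: prod_eq_iff)
  qed
  then show ?thesis using 1(1) l by (auto intro: nth_equalityI)
qed

lemma is_groupoid_trees: "is_groupoid trees_groupoid"
  by (rule is_groupoid_pullback[OF is_groupoid_Sr[OF is_groupoid_cells1] is_groupoid_op is_groupoid_Sr[OF is_groupoid_colour]
      is_functor_mapT[OF is_functor_outputF] is_functor_sourceO])

lemma is_groupoid_cells2: "is_groupoid cells2"
  by (simp add: cells2_eq is_groupoid_relabel is_groupoid_trees inj_embeddings)

lemma Hom_discrete_iff: "f \<in> Hom (discrete S) x y \<longleftrightarrow> f = x \<and> f = y"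
  by (simp add: discrete_def)

text \<open>Over discrete colours an arrow of tuples is determined by its permutation, and there is
  exactly one arrow of operations leaving \<open>q\<close> with that permutation. So the source
  functor is a discrete opfibration.\<close>

lemma sourceO_unique_lift:
  assumes q: "q \<in> Obj op_groupoid" and b: "b \<in> Hom (Sr colour_groupoid) (ob (sourceO sym_operad) q) cs"
  shows "\<exists>!(q', g). q' \<in> Obj op_groupoid \<and> g \<in> Hom op_groupoid q q'
    \<and> ob (sourceO sym_operad) q' = cs \<and> ar (sourceO sym_operad) g = b"
proof -
  obtain d w where w: "q = op_of_word d w" "w \<in> words" using q by (auto simp: Obj_op)
  have "b \<in> Hom (Sr colour_groupoid) (map fst w) cs" using b by (simp add: w source_word)
  then obtain \<sigma> fs where \<sigma>': "b = (\<sigma>, fs)" "length (map fst w) = length cs" "length fs = length cs" "\<sigma> \<in> perms (length cs)"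
    "\<And>i. i < length cs \<Longrightarrow> fs ! i \<in> Hom colour_groupoid (map fst w ! (\<sigma> ! i)) (cs ! i)"
    by (blast elim: Hom_SrE)
  then have \<sigma>: "b = (\<sigma>, fs)" "length cs = length w" "length fs = length w" "\<sigma> \<in> perms (length w)" by simp_all
  have "fs ! i = fst (w ! (\<sigma> ! i)) \<and> fs ! i = cs ! i" if "i < length w" for i
  proof -
    have "fs ! i = map fst w ! (\<sigma> ! i)" "fs ! i = cs ! i"
      using \<sigma>'(5)[of i] that \<sigma>(2) unfolding Hom_discrete_iff by auto
    then show ?thesis using perms_nth[OF \<sigma>(4) that] by (metis nth_map)
  qed
  then have "\<And>i. i < length w \<Longrightarrow> fs ! i = cs ! i" "\<And>i. i < length w \<Longrightarrow> fs ! i = fst (w ! (\<sigma> ! i))"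
    by blast+
  then have fs: "fs = cs" "fs = map fst (map ((!) w) \<sigma>)"
    using \<sigma>(2,3) perms_length[OF \<sigma>(4)] by (intro nth_equalityI; simp)+
  let ?q' = "op_of_word d (map ((!) w) \<sigma>)"
  let ?g = "(\<sigma>, map (Id arrow_groupoid) ?q')"
  have w': "map ((!) w) \<sigma> \<in> words" using map_nth_words w(2) \<sigma>(4) by blast
  have g: "?g \<in> Hom op_groupoid q ?q'"
    using \<sigma>(4) map_nth_op_of_word[OF \<sigma>(4)] by (simp add: Hom_op_iff w perms_length)
  have ar: "ar (sourceO sym_operad) ?g = (\<sigma>, map fst (map ((!) w) \<sigma>))"
    using w'
    by (auto simp: sourceO_eq op_of_word_def words_def Id_arrow_groupoid sourceC_sel hd_replicate Suc_le_eq case_prod_beta)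
  show ?thesis
  proof (rule ex1I[of _ "(?q', ?g)"])
    show "case (?q', ?g) of (q', g) \<Rightarrow> q' \<in> Obj op_groupoid \<and> g \<in> Hom op_groupoid q q'
      \<and> ob (sourceO sym_operad) q' = cs \<and> ar (sourceO sym_operad) g = b"
      using w' g ar fs \<sigma>(1) by (auto simp: Obj_op source_word)
  next
    fix p assume p: "case p of (q', g) \<Rightarrow> q' \<in> Obj op_groupoid \<and> g \<in> Hom op_groupoid q q'
      \<and> ob (sourceO sym_operad) q' = cs \<and> ar (sourceO sym_operad) g = b"
    obtain q' \<tau> gs where "p = (q', (\<tau>, gs))" by (metis surj_pair)
    then show "p = (?q', ?g)"
      using p \<sigma>(1) map_nth_op_of_word[OF \<sigma>(4), of d] by (auto simp: Hom_op_iff sourceO_eq w)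
  qed
qed

text \<open>By unique lifting the root adds no choices: the arrows leaving a tree are those leaving
  its tuple of tops. The first factorial permutes the tops, the others permute the letters inside
  each top.\<close>

lemma outs_cells2:
  assumes z: "z \<in> trees"
  shows "card (outs cells2 (tree_cell d z)) = fact (length z) * prod_list (map (\<lambda>(v, us). fact (length us)) z)"
    and "finite (outs cells2 (tree_cell d z))"
proof -
  let ?x = "(tree_tops z, op_of_word d (map fst z))"
  have x: "?x \<in> Obj trees_groupoid" using z by (auto simp: Obj_trees_groupoid)
  have "card (outs cells2 (tree_cell d z)) = card (outs trees_groupoid ?x)"
    using card_outs_relabel[OF inj_embeddings(3,4), of trees_groupoid ?x]
    by (simp add: cells2_eq embedding_sel tree_cell_def)
  also have "\<dots> = card (outs (Sr cells1) (tree_tops z))"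
    by (rule card_outs_pullback[OF is_functor_mapT[OF is_functor_outputF] x sourceO_unique_lift])
      (use x in \<open>auto simp: pullback_sel\<close>)
  also have "\<dots> = fact (length (tree_tops z)) * prod_list (map (\<lambda>x. card (outs cells1 x)) (tree_tops z))"
    using z outs_cells1(2) by (intro card_outs_Sr) (auto simp: tree_tops_def trees_def)
  also have "map (\<lambda>x. card (outs cells1 x)) (tree_tops z) = map (\<lambda>(v, us). fact (length us)) z"
    using z outs_cells1(1) by (auto simp: tree_tops_def trees_def)
  finally show *: "card (outs cells2 (tree_cell d z)) = fact (length z) * prod_list (map (\<lambda>(v, us). fact (length us)) z)"
    by (simp add: tree_tops_def)
  \<comment> \<open>Finiteness is read off from the count, since a set of nonzero cardinality is
    finite.\<close>
  have "prod_list (map (\<lambda>(v, us). fact (length us)) z) \<noteq> (0 :: nat)"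
    by (auto simp: prod_list_zero_iff)
  then show "finite (outs cells2 (tree_cell d z))" using * by (intro card_ge_0_finite) simp
qed

section \<open>Faces of two-level trees\<close>

lemma is_functor_compose_cells: "is_functor (cell_face sym_operad (Suc (Suc 0)) (Suc 0)) cells2 cells1"
proof -
  have "is_functor (pairF (mapT (inv_functor operF) \<odot> fstF) sndF) trees_groupoid composables"
  proof (rule is_functor_pairF_pullback)
    show "is_functor (mapT (inv_functor operF)) (Sr cells1) (Sr op_groupoid)"
      unfolding cells1_eq by (intro is_functor_mapT is_functor_inv_functor inj_embeddings)
  next
    fix xs assume "xs \<in> Obj (Sr cells1)"
    then show "ob (mapT (targetO sym_operad)) (ob (mapT (inv_functor operF)) xs) = ob (mapT (outputF sym_operad)) xs"
      by (auto simp: Obj_Sr Obj_cells1 inv_embeddings outputF_def)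
  next
    fix xs ys h assume "h \<in> Hom (Sr cells1) xs ys"
    then obtain \<sigma> fs where h': "h = (\<sigma>, fs)" "length fs = length ys"
      "\<And>i. i < length ys \<Longrightarrow> fs ! i \<in> Hom cells1 (xs ! (\<sigma> ! i)) (ys ! i)"
      by (blast elim: Hom_SrE)
    have h: "h = (\<sigma>, fs)" "\<And>f. f \<in> set fs \<Longrightarrow> \<exists>r. f = OperA r"
    proof -
      fix f assume "f \<in> set fs"
      then obtain i where "f = fs ! i" "i < length ys" using h'(2) by (auto simp: in_set_conv_nth)
      then have "f \<in> Hom cells1 (xs ! (\<sigma> ! i)) (ys ! i)" using h'(3) by blast
      then show "\<exists>r. f = OperA r" unfolding cells1_eq relabel_def groupoid.simps embedding_sel by blast
    qed (rule h'(1))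
    show "ar (mapT (targetO sym_operad)) (ar (mapT (inv_functor operF)) h) = ar (mapT (outputF sym_operad)) h"
      unfolding h mapT_sel map_map prod.inject
      by (intro conjI refl map_cong) (auto dest!: h(2) simp: inv_embeddings outputF_def)
  qed
  then show ?thesis
    unfolding cell_face.simps cells2_eq cells1_eq
    by (auto intro!: is_functor_compF[OF is_functor_compF] is_functor_compF is_functor_inv_functor inj_embeddings
        is_functor_relabel is_functor_composeO)
qed

lemma is_functor_root_cell: "is_functor (cell_face sym_operad (Suc (Suc 0)) 0) cells2 cells1"
  unfolding cell_face.simps cells2_eq cells1_eq
  by (auto intro!: is_functor_compF is_functor_inv_functor inj_embeddings
        is_functor_relabel is_functor_sndF_pullback)

lemma is_functor_last_face: "is_functor (multT \<odot> mapT (cell_last_face sym_operad 2)) (Sr cells2) (Sr cells1)"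
  unfolding cell_last_face_def cells2_eq
  by (auto intro!: is_functor_compF is_functor_mapT is_functor_inv_functor inj_embeddings
        is_functor_multT is_functor_fstF_pullback is_groupoid_cells1)

lemma inv_tree_tops: "map (ob (inv_functor operF)) (tree_tops z) = map (\<lambda>(v, us). op_of_word (fst v) us) z"
  by (auto simp: tree_tops_def inv_embeddings)

lemma compose_tree_cell:
  assumes z: "z \<in> trees"
  shows "ob (cell_face sym_operad (Suc (Suc 0)) (Suc 0)) (tree_cell d z) = Oper (op_of_word d (tree_word z))"
proof -
  have "map (ob (composeC (T_M Ass2))) (concat (map2 (\<lambda>gs f. map (\<lambda>g. (g, f)) gs)
      (map (\<lambda>(v, us). op_of_word (fst v) us) z) (op_of_word d (map fst z)))) = op_of_word d (tree_word z)"
  proof (induction z)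
    case (Cons a z)
    obtain c k us where a: "a = ((c, k), us)" by (metis surj_pair)
    \<comment> \<open>Arities multiply here, which matches \<open>scale_word\<close>.\<close>
    have "concat (replicate k (replicate j c')) = replicate (k * j) c'" for j and c' :: two
      by (induction k) (auto simp: replicate_add)
    then have "map (ob (composeC (T_M Ass2))) (map (\<lambda>g. (g, (replicate k c, d))) (op_of_word c us))
        = op_of_word d (scale_word k us)"
      by (auto simp: op_of_word_def scale_word_def composeC_ob)
    then show ?case using Cons by (simp add: a op_of_word_def tree_word_def)
  qed (simp add: op_of_word_def tree_word_def)
  then show ?thesis
    by (simp add: inv_tree_tops tree_cell_def inv_embeddings pairF_def fstF_def sndF_def composeO_eq ob_distribute embedding_sel)
qed

lemma root_tree_cell: "ob (cell_face sym_operad (Suc (Suc 0)) 0) (tree_cell d z) = Oper (op_of_word d (map fst z))"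
  by (simp add: tree_cell_def inv_embeddings sndF_def embedding_sel)

lemma last_tree_cell: "ob (cell_last_face sym_operad 2) (tree_cell d z) = tree_tops z"
  by (simp add: cell_last_face_def tree_cell_def inv_embeddings fstF_def)

section \<open>Plethysm as a sum over trees\<close>

text \<open>The weights of the $n!/\mu!$ words with exponents $\mu$ add up to the coefficient at $\mu$.\<close>

definition word_weight :: "pvar mseries \<Rightarrow> pvar list \<Rightarrow> rat" where
  "word_weight F w = exp_factorial (msum w) * mcoeff F (msum w) / fact (length w)"

lemma msum_words:
  assumes "\<mu> \<in> exponents"
  obtains w where "w \<in> words" "msum w = \<mu>"
proof -
  obtain w where w: "msum w = \<mu>" using msum_surj by blast
  have "w \<noteq> []" "set w \<subseteq> UNIV \<times> {1..}" using assms w by (auto simp: exponents_def)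
  then have "w \<in> words" by (auto simp: words_def)
  then show ?thesis using w that by blast
qed

lemma words_exponents: "w \<in> words \<Longrightarrow> msum w \<in> exponents"
  by (auto simp: words_def exponents_def)

text \<open>\<open>Sum_any\<close> is a genuine sum only over a finite support, so a finite set
  \<open>W\<close> of words carrying all nonzero terms has to be exhibited. Closure of
  \<open>W\<close> under rearrangement makes every class of words complete, so that its weights add
  up to one coefficient of \<open>F\<close>.\<close>

lemma msubst_words:
  fixes H :: "pvar \<Rightarrow> 'w mseries"
  assumes F: "F \<in> series" and W: "finite W" "W \<subseteq> words"
    and closed: "\<And>w w'. \<lbrakk>w \<in> W; mset w' = mset w\<rbrakk> \<Longrightarrow> w' \<in> W"
    and supp: "\<And>w. \<lbrakk>w \<in> words; mcoeff (prod_list (map H w)) \<nu> \<noteq> 0\<rbrakk> \<Longrightarrow> w \<in> W"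
  shows "mcoeff (msubst F H) \<nu> = (\<Sum>w\<in>W. word_weight F w * mcoeff (prod_list (map H w)) \<nu>)"
proof -
  let ?f = "\<lambda>\<mu>. mcoeff F \<mu> * mcoeff (\<Prod>v\<in>Poly_Mapping.keys \<mu>. H v ^ Poly_Mapping.lookup \<mu> v) \<nu>"
  have f: "?f (msum w) = mcoeff F (msum w) * mcoeff (prod_list (map H w)) \<nu>" for w
    by (simp only: prod_keys_msum)
  have "{\<mu>. ?f \<mu> \<noteq> 0} \<subseteq> msum ` W"
  proof
    fix \<mu> assume "\<mu> \<in> {\<mu>. ?f \<mu> \<noteq> 0}"
    then have nz: "?f \<mu> \<noteq> 0" by simp
    then have "\<mu> \<in> exponents" using F by (auto simp: series_def)
    then obtain w where w: "w \<in> words" "msum w = \<mu>" using msum_words by blast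
    then have "w \<in> W" using supp nz f[of w] by auto
    then show "\<mu> \<in> msum ` W" using w by blast
  qed
  then have "mcoeff (msubst F H) \<nu> = (\<Sum>\<mu>\<in>msum ` W. ?f \<mu>)"
    unfolding msubst.rep_eq using W by (intro Sum_any.expand_superset) auto
  also have "\<dots> = (\<Sum>\<mu>\<in>msum ` W. \<Sum>w\<in>{w \<in> W. msum w = \<mu>}. word_weight F w * mcoeff (prod_list (map H w)) \<nu>)"
  proof (rule sum.cong[OF refl])
    fix \<mu> assume "\<mu> \<in> msum ` W"
    then obtain w0 where w0: "w0 \<in> W" "\<mu> = msum w0" by blast
    let ?C = "{w. msum w = msum w0}"
    have C: "{w \<in> W. msum w = \<mu>} = ?C"
      using closed[OF w0(1)] w0(2) by (auto simp: msum_eq_iff)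
    have "word_weight F w * mcoeff (prod_list (map H w)) \<nu> = word_weight F w0 * mcoeff (prod_list (map H w0)) \<nu>"
      if "w \<in> ?C" for w
    proof -
      have "mset w = mset w0" using that by (simp add: msum_eq_iff)
      then have "length w = length w0" "prod_list (map H w) = prod_list (map H w0)"
        by (metis size_mset, metis mset_map prod_mset_prod_list)
      then show ?thesis using that by (simp add: word_weight_def)
    qed
    then have "(\<Sum>w\<in>{w \<in> W. msum w = \<mu>}. word_weight F w * mcoeff (prod_list (map H w)) \<nu>)
        = (\<Sum>w\<in>?C. word_weight F w0 * mcoeff (prod_list (map H w0)) \<nu>)"
      unfolding C by (rule sum.cong[OF refl])
    also have "\<dots> = of_nat (card ?C) * (word_weight F w0 * mcoeff (prod_list (map H w0)) \<nu>)"
      by (rule sum_constant)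
    also have "\<dots> = (of_nat (card ?C) * exp_factorial (msum w0)) / fact (length w0) * ?f (msum w0)"
      unfolding f by (simp add: word_weight_def)
    also have "of_nat (card ?C) * exp_factorial (msum w0) = fact (length w0)"
      using card_msum_class(1)[of w0] by (simp add: exp_factorial_def)
    finally show "?f \<mu> = (\<Sum>w\<in>{w \<in> W. msum w = \<mu>}. word_weight F w * mcoeff (prod_list (map H w)) \<nu>)"
      using w0(2) by simp
  qed
  also have "\<dots> = (\<Sum>w\<in>W. word_weight F w * mcoeff (prod_list (map H w)) \<nu>)"
    using sum.image_gen[OF W(1), symmetric] .
  finally show ?thesis .
qed

lemma mcoeff_mvars: "mcoeff (prod_list (map mvar us)) \<alpha> = (if \<alpha> = msum us then 1 else 0)"
proof (induction us arbitrary: \<alpha>)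
  case Nil
  show ?case by (simp add: one_mseries.rep_eq)
next
  case (Cons v us)
  have "mcoeff (prod_list (map mvar (v # us))) \<alpha>
      = (\<Sum>p\<in>{(\<beta>, \<gamma>). \<beta> + \<gamma> = \<alpha>}. if p = (Poly_Mapping.single v 1, msum us) then 1 else 0)"
    unfolding list.map prod_list.Cons times_mseries.rep_eq
    by (rule sum.cong) (auto simp: Cons.IH mvar.rep_eq split: if_splits)
  also have "\<dots> = (if Poly_Mapping.single v 1 + msum us = \<alpha> then 1 else 0)"
    by (subst sum.delta) (auto simp: finite_splittings)
  finally show ?case by auto
qed

definition dilation_words :: "nat \<Rightarrow> pexp \<Rightarrow> pvar list set" where
  "dilation_words k \<alpha> = {us \<in> words. msum (scale_word k us) = \<alpha>}"

lemma finite_msum_class: "finite {w. msum w = \<mu>}"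
proof -
  obtain w where "msum w = \<mu>" using msum_surj by blast
  then show ?thesis using card_msum_class(2)[of w] by simp
qed

lemma mset_scale_word: "mset us = mset us' \<Longrightarrow> mset (scale_word k us) = mset (scale_word k us')"
  by (simp add: scale_word_def)

text \<open>For positive \<open>k\<close> scaling is injective on words, so the set embeds into the
  finitely many rearrangements of one word.\<close>

lemma finite_dilation_words:
  assumes "1 \<le> k" shows "finite (dilation_words k \<alpha>)"
proof -
  have "inj (map (\<lambda>(c, j). (c, k * j)) :: pvar list \<Rightarrow> pvar list)"
    using assms by (intro inj_mapI) (auto simp: inj_def)
  then have "inj (scale_word k)" by (simp add: inj_def scale_word_def)
  then have "inj_on (scale_word k) (dilation_words k \<alpha>)" by (rule inj_on_subset) simp
  moreover have "finite (scale_word k ` dilation_words k \<alpha>)"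
    by (rule finite_subset[OF _ finite_msum_class[of \<alpha>]]) (auto simp: dilation_words_def)
  ultimately show ?thesis using finite_imageD by blast
qed

text \<open>Substituting variables for variables turns a word into the single monomial of the scaled
  word, so each word contributes to one coefficient only.\<close>

lemma mcoeff_dilate:
  assumes "F \<in> series" "1 \<le> k"
  shows "mcoeff (dilate k F) \<alpha> = (\<Sum>us\<in>dilation_words k \<alpha>. word_weight F us)"
proof -
  let ?H = "\<lambda>(c, j). mvar (c, k * j) :: pvar mseries"
  have H: "prod_list (map ?H us) = prod_list (map mvar (scale_word k us))" for us
    by (rule arg_cong[of _ _ prod_list]) (auto simp: scale_word_def)
  have "mcoeff (dilate k F) \<alpha> = (\<Sum>us\<in>dilation_words k \<alpha>. word_weight F us * mcoeff (prod_list (map ?H us)) \<alpha>)"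
    unfolding dilate_def
  proof (rule msubst_words[OF assms(1)])
    show "finite (dilation_words k \<alpha>)" using assms(2) by (rule finite_dilation_words)
    show "us' \<in> dilation_words k \<alpha>" if "us \<in> dilation_words k \<alpha>" "mset us' = mset us" for us us'
    proof -
      have "set us' = set us" using that(2) by (rule mset_eq_setD)
      then have "us' \<in> words" using that(1) by (auto simp: dilation_words_def words_def)
      moreover have "msum (scale_word k us') = msum (scale_word k us)"
        using mset_scale_word[OF that(2)] by (simp only: msum_eq_iff)
      ultimately show ?thesis using that(1) by (simp add: dilation_words_def)
    qed
    show "us \<in> dilation_words k \<alpha>" if "us \<in> words" "mcoeff (prod_list (map ?H us)) \<alpha> \<noteq> 0" for us
      using that unfolding H mcoeff_mvars by (auto simp: dilation_words_def split: if_splits)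
  qed (auto simp: dilation_words_def)
  also have "\<dots> = (\<Sum>us\<in>dilation_words k \<alpha>. word_weight F us)"
    unfolding H mcoeff_mvars by (rule sum.cong) (auto simp: dilation_words_def)
  finally show ?thesis .
qed

definition rooted_trees :: "pvar list \<Rightarrow> pexp \<Rightarrow> (pvar \<times> pvar list) list set" where
  "rooted_trees w \<nu> = {z. map fst z = w \<and> (\<forall>(v, us)\<in>set z. us \<in> words) \<and> msum (tree_word z) = \<nu>}"

definition tops_weight :: "series_pair \<Rightarrow> (pvar \<times> pvar list) list \<Rightarrow> rat" where
  "tops_weight F z = prod_list (map (\<lambda>(v, us). word_weight (F (fst v)) us) z)"

lemma mcoeff_dilations:
  assumes F: "F \<in> series_pairs" and w: "\<forall>v\<in>set w. 1 \<le> snd v"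
  shows "finite (rooted_trees w \<nu>) \<and>
    mcoeff (prod_list (map (\<lambda>(c, k). dilate k (F c)) w)) \<nu> = (\<Sum>z\<in>rooted_trees w \<nu>. tops_weight F z)"
  using w
proof (induction w arbitrary: \<nu>)
  case Nil
  have "rooted_trees [] \<nu> = (if \<nu> = 0 then {[]} else {})"
    by (auto simp: rooted_trees_def tree_word_def)
  then show ?case by (simp add: one_mseries.rep_eq tops_weight_def)
next
  case (Cons v w)
  obtain c k where v: "v = (c, k)" by (cases v)
  have k: "1 \<le> k" using Cons.prems v by simp
  have Fc: "F c \<in> series" using F by (simp add: series_pairs_def)
  note IH = Cons.IH[THEN conjunct1] Cons.IH[THEN conjunct2]
  \<comment> \<open>A coefficient of a product splits \<nu> as \<alpha> + \<beta>. \<open>?S\<close>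
    lists a splitting together with a top for \<open>v\<close> spelling \<alpha> and a tree over
    \<open>w\<close> spelling \<beta>; \<open>?i\<close> takes a tree apart in this way and
    \<open>?j\<close> reassembles it.\<close>
  let ?S = "SIGMA p:{(\<alpha>, \<beta>). \<alpha> + \<beta> = \<nu>}. dilation_words k (fst p) \<times> rooted_trees w (snd p)"
  let ?i = "\<lambda>z. ((msum (scale_word k (snd (hd z))), msum (tree_word (tl z))), (snd (hd z), tl z))"
  let ?j = "\<lambda>(p, us, z). (v, us) # z"
  have fin: "finite ?S"
    using finite_splittings finite_dilation_words[OF k] IH(1) Cons.prems by (intro finite_SigmaI) auto
  have ij: "?i (?j x) = x \<and> ?j x \<in> rooted_trees (v # w) \<nu>" if "x \<in> ?S" for x
    using that by (auto simp: dilation_words_def rooted_trees_def tree_word_def v)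
  have ji: "?j (?i z) = z \<and> ?i z \<in> ?S" if "z \<in> rooted_trees (v # w) \<nu>" for z
    using that by (cases z) (auto simp: dilation_words_def rooted_trees_def tree_word_def v)
  have "rooted_trees (v # w) \<nu> \<subseteq> ?j ` ?S" using ji by (metis (no_types, lifting) image_eqI subsetI)
  then have "finite (rooted_trees (v # w) \<nu>)" using fin finite_surj by blast
  have "mcoeff (prod_list (map (\<lambda>(c, k). dilate k (F c)) (v # w))) \<nu>
      = (\<Sum>(\<alpha>, \<beta>)\<in>{(\<alpha>, \<beta>). \<alpha> + \<beta> = \<nu>}.
          (\<Sum>us\<in>dilation_words k \<alpha>. word_weight (F c) us) * (\<Sum>z\<in>rooted_trees w \<beta>. tops_weight F z))"
    using IH(2) Cons.prems by (simp add: v times_mseries.rep_eq mcoeff_dilate[OF Fc k])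
  also have "\<dots> = (\<Sum>p\<in>{(\<alpha>, \<beta>). \<alpha> + \<beta> = \<nu>}. \<Sum>(us, z)\<in>dilation_words k (fst p) \<times> rooted_trees w (snd p).
      word_weight (F c) us * tops_weight F z)"
    by (simp add: sum_product sum.cartesian_product case_prod_beta)
  also have "\<dots> = (\<Sum>(p, us, z)\<in>?S. word_weight (F c) us * tops_weight F z)"
    using finite_splittings finite_dilation_words[OF k] IH(1) Cons.prems by (subst sum.Sigma) auto
  also have "\<dots> = (\<Sum>z\<in>rooted_trees (v # w) \<nu>. tops_weight F z)"
    by (rule sum.reindex_bij_witness[where i = ?i and j = ?j])
      (use ij ji in \<open>auto simp: tops_weight_def v\<close>)
  finally show ?case using \<open>finite (rooted_trees (v # w) \<nu>)\<close> by blast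
qed

definition trees_over :: "pexp \<Rightarrow> (pvar \<times> pvar list) list set" where
  "trees_over \<nu> = {z \<in> trees. msum (tree_word z) = \<nu>}"

lemma length_le_sum_list: "(\<And>x. x \<in> set xs \<Longrightarrow> 1 \<le> f x) \<Longrightarrow> length xs \<le> (\<Sum>x\<leftarrow>xs. f x :: nat)"
proof (induction xs)
  case (Cons x xs)
  then have "length xs \<le> (\<Sum>x\<leftarrow>xs. f x)" "1 \<le> f x" by simp_all
  then show ?case by simp
qed simp

lemma le_sum_list: "x \<in> set xs \<Longrightarrow> f x \<le> (\<Sum>x\<leftarrow>xs. f x :: nat)"
  by (simp add: member_le_sum_list)

text \<open>The arities in the composite word add up to a number \<open>N\<close> fixed by \<nu>,
  and an entry \<open>(v, us)\<close> contributes the arity of \<open>v\<close> times the total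
  arity of \<open>us\<close>. As all arities are positive, \<open>N\<close> bounds the number of
  entries, every arity and the length of every top.\<close>

lemma finite_trees_over: "finite (trees_over \<nu>)"
proof -
  obtain w where w: "msum w = \<nu>" using msum_surj by blast
  define N where "N = sum_list (map snd w)"
  let ?V = "(UNIV :: two set) \<times> {..N}"
  let ?B = "{us. set us \<subseteq> ?V \<and> length us \<le> N}"
  have "trees_over \<nu> \<subseteq> {z. set z \<subseteq> ?V \<times> ?B \<and> length z \<le> N}"
  proof
    fix z assume "z \<in> trees_over \<nu>"
    then have z: "z \<in> trees" "mset (tree_word z) = mset w" by (auto simp: trees_over_def w[symmetric] msum_eq_iff)
    have "sum_list (map snd (tree_word z)) = N"
      unfolding N_def using z(2) by (metis mset_map sum_mset_sum_list)
    moreover have "sum_list (map snd (tree_word z)) = (\<Sum>(v, us)\<leftarrow>z. snd v * sum_list (map snd us))"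
    proof (induction z)
      case (Cons a z)
      obtain v us where a: "a = (v, us)" by (cases a)
      have "sum_list (map snd (scale_word k us)) = k * sum_list (map snd us)" for k
        by (simp add: scale_word_def o_def case_prod_beta sum_list_const_mult)
      then show ?case using Cons by (simp add: tree_word_def a)
    qed (simp add: tree_word_def)
    ultimately have N: "(\<Sum>(v, us)\<leftarrow>z. snd v * sum_list (map snd us)) = N" by simp
    have us: "length us \<le> sum_list (map snd us)" "1 \<le> sum_list (map snd us)" "set us \<subseteq> UNIV \<times> {..sum_list (map snd us)}"
      if "us \<in> words" for us
    proof -
      show 1: "length us \<le> sum_list (map snd us)"
        using that by (intro length_le_sum_list) (auto simp: words_def)
      moreover have "1 \<le> length us" using that by (cases us) (auto simp: words_def)
      ultimately show "1 \<le> sum_list (map snd us)" by simp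
      show "set us \<subseteq> UNIV \<times> {..sum_list (map snd us)}"
        using le_sum_list[of _ us snd] by fastforce
    qed
    have ge: "1 \<le> snd v * sum_list (map snd us)" if "(v, us) \<in> set z" for v us
      using trees_tops[OF z(1) that] us(2)[of us] by simp
    then have "length z \<le> N"
      unfolding N[symmetric] by (intro length_le_sum_list) auto
    moreover have "p \<in> ?V \<times> ?B" if p: "p \<in> set z" for p
    proof -
      obtain v us where vu: "p = (v, us)" by (cases p)
      have t: "us \<in> words" "1 \<le> snd v" using trees_tops[OF z(1)] p vu by auto
      have "snd v * sum_list (map snd us) \<le> N"
        using le_sum_list[OF p, of "\<lambda>(v, us). snd v * sum_list (map snd us)"] N vu by simp
      moreover have "snd v \<le> snd v * sum_list (map snd us)" "sum_list (map snd us) \<le> snd v * sum_list (map snd us)"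
        using us(2)[OF t(1)] t(2) by simp_all
      ultimately have "snd v \<le> N" "sum_list (map snd us) \<le> N" by linarith+
      then show ?thesis using us[OF t(1)] by (cases v) (fastforce simp: vu)
    qed
    ultimately show "z \<in> {z. set z \<subseteq> ?V \<times> ?B \<and> length z \<le> N}" by blast
  qed
  moreover have "finite (?V \<times> ?B)"
    by (intro finite_cartesian_product finite_lists_length_le) (auto simp: UNIV_two)
  then have "finite {z. set z \<subseteq> ?V \<times> ?B \<and> length z \<le> N}" by (rule finite_lists_length_le)
  ultimately show ?thesis by (rule finite_subset)
qed

text \<open>Permuting the entries of a tree permutes the blocks of its composite word. This makes
  the set of root words in \<open>mcoeff_plethysm\<close> closed under rearrangement.\<close>

lemma mset_tree_word: "mset (tree_word z) = \<Sum>\<^sub># (image_mset (\<lambda>(v, us). mset (scale_word (snd v) us)) (mset z))"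
  unfolding tree_word_def by (induction z) auto

lemma mcoeff_plethysm:
  assumes F: "F \<in> series_pairs" and G: "G \<in> series_pairs"
  shows "mcoeff ((G \<circledast> F) d) \<nu> = (\<Sum>z\<in>trees_over \<nu>. word_weight (G d) (map fst z) * tops_weight F z)"
proof -
  let ?H = "\<lambda>(c, k). dilate k (F c)"
  \<comment> \<open>Root words of the trees over \<nu>. Their number is finite, and for any other
    word the sum in \<open>mcoeff_dilations\<close> is empty, so its coefficient vanishes.\<close>
  let ?W = "map fst ` trees_over \<nu>"
  have slice: "{z \<in> trees_over \<nu>. map fst z = w} = rooted_trees w \<nu>" if "w \<in> words" for w
    using that by (fastforce simp: trees_over_def rooted_trees_def trees_def words_def)
  have pr: "mcoeff (prod_list (map ?H w)) \<nu> = (\<Sum>z\<in>rooted_trees w \<nu>. tops_weight F z)" if "w \<in> words" for w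
    using mcoeff_dilations[OF F, of w \<nu>] that by (simp add: words_def)
  have W: "?W \<subseteq> words" using trees_root by (auto simp: trees_over_def)
  have "mcoeff ((G \<circledast> F) d) \<nu> = (\<Sum>w\<in>?W. word_weight (G d) w * mcoeff (prod_list (map ?H w)) \<nu>)"
    unfolding plethysm_def
  proof (rule msubst_words)
    show "G d \<in> series" using G by (simp add: series_pairs_def)
    show "finite ?W" using finite_trees_over by simp
    show "?W \<subseteq> words" by (rule W)
    show "w' \<in> ?W" if w: "w \<in> ?W" "mset w' = mset w" for w w'
    proof -
      obtain z where z: "z \<in> trees_over \<nu>" "w = map fst z" using w(1) by blast
      obtain \<sigma> where \<sigma>: "\<sigma> \<in> perms (length z)" "map ((!) w) \<sigma> = w'"
        using mset_eq_perms[OF w(2)] z(2) by auto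
      \<comment> \<open>The tops travel with the letters of the root that they are grafted
        onto.\<close>
      let ?z = "map ((!) z) \<sigma>"
      have m: "mset ?z = mset z" using mset_map_nth_perms[OF \<sigma>(1)] .
      then have s: "set ?z = set z" by (rule mset_eq_setD)
      have "msum (tree_word ?z) = msum (tree_word z)"
        unfolding msum_eq_iff mset_tree_word m ..
      moreover have "?z \<in> trees"
        using z(1) s by (cases \<sigma>) (auto simp: trees_over_def trees_def simp del: set_map)
      ultimately have "?z \<in> trees_over \<nu>" using z(1) by (simp add: trees_over_def)
      moreover have "map fst ?z = w'" using \<sigma> z(2) by (auto simp: perms_set)
      ultimately show ?thesis by (metis image_eqI)
    qed
    show "w \<in> ?W" if "w \<in> words" "mcoeff (prod_list (map ?H w)) \<nu> \<noteq> 0" for w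
    proof -
      have "rooted_trees w \<nu> \<noteq> {}" using that pr by force
      then have "{z \<in> trees_over \<nu>. map fst z = w} \<noteq> {}" using slice[OF that(1)] by simp
      then show ?thesis by auto
    qed
  qed
  also have "\<dots> = (\<Sum>w\<in>?W. \<Sum>z\<in>{z \<in> trees_over \<nu>. map fst z = w}. word_weight (G d) (map fst z) * tops_weight F z)"
  proof (rule sum.cong[OF refl])
    fix w assume "w \<in> ?W"
    then have w: "w \<in> words" using W by blast
    have "(\<Sum>z\<in>{z \<in> trees_over \<nu>. map fst z = w}. word_weight (G d) (map fst z) * tops_weight F z)
        = (\<Sum>z\<in>{z \<in> trees_over \<nu>. map fst z = w}. word_weight (G d) w * tops_weight F z)"
      by (rule sum.cong) auto
    then show "word_weight (G d) w * mcoeff (prod_list (map ?H w)) \<nu>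
        = (\<Sum>z\<in>{z \<in> trees_over \<nu>. map fst z = w}. word_weight (G d) (map fst z) * tops_weight F z)"
      by (simp add: slice[OF w] pr[OF w] sum_distrib_left)
  qed
  also have "\<dots> = (\<Sum>z\<in>trees_over \<nu>. word_weight (G d) (map fst z) * tops_weight F z)"
    using sum.image_gen[OF finite_trees_over, symmetric] .
  finally show ?thesis .
qed

section \<open>Polynomials and tensors determined by their values\<close>

lemma lookup_scale: "Poly_Mapping.lookup (scale r v) b = r * Poly_Mapping.lookup v b"
  by (simp add: scale_def Poly_Mapping.map.rep_eq when_def)

lemma scale_simps [simp]: "scale 0 v = 0" "scale r 0 = 0" "scale 1 v = v"
  by (auto intro: poly_mapping_eqI simp: lookup_scale)

lemma scale_add_left: "scale (r + s) v = scale r v + scale s v"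
  and scale_scale: "scale r (scale s v) = scale (r * s) v"
  and scale_single: "scale r (Poly_Mapping.single b s) = Poly_Mapping.single b (r * s)"
  by (auto intro!: poly_mapping_eqI simp: lookup_scale lookup_add lookup_single when_def algebra_simps)

lemma lookup_sum_poly: "Poly_Mapping.lookup (sum f A) b = (\<Sum>a\<in>A. Poly_Mapping.lookup (f a) b)"
  by (induction A rule: infinite_finite_induct) (auto simp: lookup_add)

lemma scale_sum: "scale r (sum f A) = (\<Sum>a\<in>A. scale r (f a))"
  by (rule poly_mapping_eqI) (simp add: lookup_scale lookup_sum_poly sum_distrib_left)

lemma lin_ext_superset:
  assumes "finite S" "Poly_Mapping.keys v \<subseteq> S"
  shows "lin_ext f v = (\<Sum>b\<in>S. scale (Poly_Mapping.lookup v b) (f b))"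
  unfolding lin_ext_def
  by (rule sum.mono_neutral_left) (use assms in \<open>auto simp: in_keys_iff\<close>)

lemma lin_ext_add: "lin_ext f (u + v) = lin_ext f u + lin_ext f v"
proof -
  let ?S = "Poly_Mapping.keys u \<union> Poly_Mapping.keys v"
  have "Poly_Mapping.keys (u + v) \<subseteq> ?S" by (rule keys_add)
  then show ?thesis
    by (simp add: lin_ext_superset[of ?S] lookup_add scale_add_left sum.distrib)
qed

lemma lin_ext_zero [simp]: "lin_ext f 0 = 0"
  by (simp add: lin_ext_def)

lemma lin_ext_sum: "lin_ext f (sum v A) = (\<Sum>a\<in>A. lin_ext f (v a))"
  by (induction A rule: infinite_finite_induct) (auto simp: lin_ext_add)

lemma lin_ext_scale: "lin_ext f (scale r v) = scale r (lin_ext f v)"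
proof -
  have "Poly_Mapping.keys (scale r v) \<subseteq> Poly_Mapping.keys v"
    by (auto simp: in_keys_iff lookup_scale)
  then show ?thesis
    by (simp add: lin_ext_superset[of "Poly_Mapping.keys v"] lookup_scale scale_sum scale_scale)
qed

lemma lin_ext_single: "lin_ext f (Poly_Mapping.single b r) = scale r (f b)"
  by (simp add: lin_ext_superset[of "{b}"])

lemma lin_ext_cong: "(\<And>b. b \<in> Poly_Mapping.keys v \<Longrightarrow> f b = g b) \<Longrightarrow> lin_ext f v = lin_ext g v"
  by (simp add: lin_ext_def)

lemma lin_ext_lin_ext: "lin_ext f (lin_ext g v) = lin_ext (\<lambda>b. lin_ext f (g b)) v"
  by (simp add: lin_ext_def[of g] lin_ext_def[of "\<lambda>b. lin_ext f (g b)"] lin_ext_sum lin_ext_scale)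

lemma sum_keys_single: "(\<Sum>b\<in>Poly_Mapping.keys v. Poly_Mapping.single b (Poly_Mapping.lookup v b)) = v"
  by (rule poly_mapping_eqI) (simp add: lookup_sum_poly lookup_single when_def in_keys_iff sum.delta)

lemma lin_ext_id: "lin_ext (\<lambda>b. Poly_Mapping.single b 1) v = v"
  using sum_keys_single[of v] by (simp add: lin_ext_def scale_single)

lemma tensor_single: "tensor (Poly_Mapping.single b r) (Poly_Mapping.single c s) = Poly_Mapping.single (b, c) (r * s)"
  by (simp add: tensor_def lin_ext_single scale_single)

section \<open>Linear functionals and their multiplicativity\<close>

definition lin_val :: "('b \<Rightarrow> rat) \<Rightarrow> ('b \<Rightarrow>\<^sub>0 rat) \<Rightarrow> rat" where
  "lin_val \<chi> v = (\<Sum>b\<in>Poly_Mapping.keys v. Poly_Mapping.lookup v b * \<chi> b)"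

lemma lin_val_superset:
  assumes "finite S" "Poly_Mapping.keys v \<subseteq> S"
  shows "lin_val \<chi> v = (\<Sum>b\<in>S. Poly_Mapping.lookup v b * \<chi> b)"
  unfolding lin_val_def
  by (rule sum.mono_neutral_left) (use assms in \<open>auto simp: in_keys_iff\<close>)

lemma lin_val_add: "lin_val \<chi> (u + v) = lin_val \<chi> u + lin_val \<chi> v"
proof -
  let ?S = "Poly_Mapping.keys u \<union> Poly_Mapping.keys v"
  have "Poly_Mapping.keys (u + v) \<subseteq> ?S" by (rule keys_add)
  then show ?thesis
    by (simp add: lin_val_superset[of ?S] lookup_add distrib_right sum.distrib)
qed

lemma lin_val_zero [simp]: "lin_val \<chi> 0 = 0"
  by (simp add: lin_val_def)

lemma lin_val_sum: "lin_val \<chi> (sum v A) = (\<Sum>a\<in>A. lin_val \<chi> (v a))"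
  by (induction A rule: infinite_finite_induct) (auto simp: lin_val_add)

lemma lin_val_single: "lin_val \<chi> (Poly_Mapping.single b r) = r * \<chi> b"
  by (simp add: lin_val_superset[of "{b}"])

lemma lin_val_lin_ext: "lin_val \<chi> (lin_ext f v) = lin_val (\<lambda>b. lin_val \<chi> (f b)) v"
proof -
  have "lin_val \<chi> (scale r w) = r * lin_val \<chi> w" for r w
  proof -
    have "Poly_Mapping.keys (scale r w) \<subseteq> Poly_Mapping.keys w"
      by (auto simp: in_keys_iff lookup_scale)
    then show ?thesis
      by (simp add: lin_val_superset[of "Poly_Mapping.keys w"] lookup_scale sum_distrib_left mult.assoc)
  qed
  then show ?thesis by (simp add: lin_ext_def lin_val_sum) (simp add: lin_val_def)
qed

lemma times_eq_sum:
  fixes u v :: "'b :: monoid_add \<Rightarrow>\<^sub>0 rat"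
  shows "u * v = (\<Sum>b\<in>Poly_Mapping.keys u. \<Sum>c\<in>Poly_Mapping.keys v.
    Poly_Mapping.single (b + c) (Poly_Mapping.lookup u b * Poly_Mapping.lookup v c))"
proof -
  have "u * v = (\<Sum>b\<in>Poly_Mapping.keys u. Poly_Mapping.single b (Poly_Mapping.lookup u b))
      * (\<Sum>c\<in>Poly_Mapping.keys v. Poly_Mapping.single c (Poly_Mapping.lookup v c))"
    by (simp only: sum_keys_single)
  then show ?thesis by (simp add: sum_product mult_single)
qed

lemma lin_val_mult:
  fixes u v :: "'b :: monoid_add \<Rightarrow>\<^sub>0 rat"
  assumes "\<And>b c. \<chi> (b + c) = \<chi> b * \<chi> c"
  shows "lin_val \<chi> (u * v) = lin_val \<chi> u * lin_val \<chi> v"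
  unfolding times_eq_sum lin_val_sum lin_val_single
  by (simp add: lin_val_def sum_product assms mult_ac)

lemma lin_val_one:
  fixes \<chi> :: "'b :: monoid_add \<Rightarrow> rat"
  shows "\<chi> 0 = 1 \<Longrightarrow> lin_val \<chi> 1 = 1"
  using lin_val_single[of \<chi> 0 1] by simp

text \<open>Artin's argument. From the relation at \<open>m y x\<close> subtract
  \<open>\<chi> j y\<close> times the relation at \<open>x\<close>: the term of \<open>j\<close>
  disappears, and the induction hypothesis kills the coefficients
  \<open>c i * (\<chi> i y - \<chi> j y)\<close>. A point \<open>y\<close> separating
  \<open>i\<close> from \<open>j\<close> then gives \<open>c i = 0\<close>.\<close>

lemma characters_independent:
  fixes \<chi> :: "'i \<Rightarrow> 'x \<Rightarrow> 'a :: idom"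
  assumes "finite S"
    and "\<And>i x y. i \<in> S \<Longrightarrow> \<chi> i (m x y) = \<chi> i x * \<chi> i y"
    and "\<And>i. i \<in> S \<Longrightarrow> \<chi> i e = 1"
    and "\<And>i j. \<lbrakk>i \<in> S; j \<in> S; i \<noteq> j\<rbrakk> \<Longrightarrow> \<exists>x. \<chi> i x \<noteq> \<chi> j x"
    and "\<And>x. (\<Sum>i\<in>S. c i * \<chi> i x) = 0"
  shows "\<forall>i\<in>S. c i = 0"
  using assms
proof (induction S arbitrary: c rule: finite_induct)
  case (insert j S)
  have rel: "(\<Sum>i\<in>S. (c i * (\<chi> i y - \<chi> j y)) * \<chi> i x) = 0" for x y
  proof -
    have "(\<Sum>i\<in>insert j S. c i * \<chi> i (m y x)) - \<chi> j y * (\<Sum>i\<in>insert j S. c i * \<chi> i x)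
        = (\<Sum>i\<in>insert j S. (c i * (\<chi> i y - \<chi> j y)) * \<chi> i x)"
      unfolding sum_distrib_left sum_subtractf[symmetric]
      by (rule sum.cong) (simp_all add: insert.prems(1) algebra_simps)
    also have "\<dots> = (\<Sum>i\<in>S. (c i * (\<chi> i y - \<chi> j y)) * \<chi> i x)"
      using insert.hyps by simp
    finally show ?thesis by (simp only: insert.prems(4)) simp
  qed
  have "\<forall>i\<in>S. c i * (\<chi> i y - \<chi> j y) = 0" for y
    using insert.IH[of "\<lambda>i. c i * (\<chi> i y - \<chi> j y)"] insert.prems(1-3) rel by blast
  moreover have "\<exists>y. \<chi> i y \<noteq> \<chi> j y" if "i \<in> S" for i
    using insert.prems(3)[of i j] that insert.hyps by auto
  ultimately have S: "c i = 0" if "i \<in> S" for i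
    using that by (metis (no_types) eq_iff_diff_eq_0 mult_eq_0_iff)
  \<comment> \<open>Only the term of \<open>j\<close> is left, and at \<open>e\<close> it equals
    \<open>c j\<close>.\<close>
  then have "c j = 0"
    using insert.prems(4)[of e] insert.prems(2)[of j] insert.hyps by simp
  then show ?case using S by simp
qed simp

text \<open>\<open>monomial_value\<close> at an arbitrary assignment of values to the generators.
  Assignments can be multiplied entrywise, unlike series pairs with their values, and each monomial
  is a character for this product.\<close>

definition mono_eval :: "('g \<Rightarrow>\<^sub>0 nat) \<Rightarrow> ('g \<Rightarrow> rat) \<Rightarrow> rat" where
  "mono_eval M x = (\<Prod>g\<in>Poly_Mapping.keys M. x g ^ Poly_Mapping.lookup M g)"

lemma mono_eval_superset:
  assumes "finite S" "Poly_Mapping.keys M \<subseteq> S"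
  shows "mono_eval M x = (\<Prod>g\<in>S. x g ^ Poly_Mapping.lookup M g)"
  unfolding mono_eval_def
  by (rule prod.mono_neutral_left) (use assms in \<open>auto simp: in_keys_iff\<close>)

lemma mono_eval_add: "mono_eval (M + N) x = mono_eval M x * mono_eval N x"
proof -
  let ?S = "Poly_Mapping.keys M \<union> Poly_Mapping.keys N"
  have "Poly_Mapping.keys (M + N) \<subseteq> ?S" by (rule keys_add)
  then show ?thesis
    by (simp add: mono_eval_superset[of ?S] lookup_add power_add prod.distrib)
qed

lemma mono_eval_zero [simp]: "mono_eval 0 x = 1"
  by (simp add: mono_eval_def)

lemma mono_eval_msum: "mono_eval (msum gs) x = prod_list (map x gs)"
  unfolding mono_eval_def by (rule prod_keys_msum)

lemma mono_eval_distinct: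
  assumes "M \<noteq> N" shows "\<exists>x. mono_eval M x \<noteq> mono_eval N x"
proof -
  obtain g where g: "Poly_Mapping.lookup M g \<noteq> Poly_Mapping.lookup N g"
    using assms by (auto simp: poly_mapping_eq_iff fun_eq_iff)
  \<comment> \<open>The separating point is 2 at \<open>g\<close> and 1 elsewhere, since the powers
    of 2 are distinct.\<close>
  have "mono_eval L (\<lambda>h. if h = g then 2 else 1) = 2 ^ Poly_Mapping.lookup L g" for L
  proof -
    have "mono_eval L (\<lambda>h. if h = g then 2 else 1)
        = (\<Prod>h\<in>insert g (Poly_Mapping.keys L). (if h = g then 2 else 1) ^ Poly_Mapping.lookup L h)"
      by (rule mono_eval_superset) auto
    also have "\<dots> = (\<Prod>h\<in>insert g (Poly_Mapping.keys L). if h = g then 2 ^ Poly_Mapping.lookup L g else 1)"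
      by (rule prod.cong) auto
    finally show ?thesis by simp
  qed
  then show ?thesis using g by (intro exI[of _ "\<lambda>h. if h = g then 2 else 1"]) simp
qed

lemma monomial_value_eq: "monomial_value M F = mono_eval M (\<lambda>g. gen_value g F)"
  by (simp add: monomial_value_def mono_eval_def)

lemma tensor_value_eq: "tensor_value T F G = lin_val (\<lambda>(M, N). monomial_value M F * monomial_value N G) T"
  unfolding tensor_value_def lin_val_def by (rule sum.cong) auto

text \<open>The generators are free coordinates on series pairs: dividing the prescribed values by
  \<mu>! gives admissible coefficients. Hence agreement of two tensors on series is agreement at all
  points.\<close>

lemma gen_values_surj: "\<exists>F\<in>series_pairs. \<forall>g\<in>UNIV \<times> exponents. gen_value g F = x g"
proof -
  let ?F = "\<lambda>i. Abs_mseries (\<lambda>\<mu>. if \<mu> \<in> exponents then x (i, \<mu>) / exp_factorial \<mu> else 0)"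
  have "exp_factorial \<mu> \<noteq> 0" for \<mu> by (simp add: exp_factorial_def)
  then have "gen_value g ?F = x g" if "g \<in> UNIV \<times> exponents" for g
    using that by (auto simp: gen_value_def Abs_mseries_inverse)
  moreover have "?F \<in> series_pairs"
    by (simp add: series_pairs_def series_def Abs_mseries_inverse)
  ultimately show ?thesis by blast
qed

lemma mono_eval_cong: "(\<And>g. g \<in> Poly_Mapping.keys M \<Longrightarrow> x g = y g) \<Longrightarrow> mono_eval M x = mono_eval M y"
  by (simp add: mono_eval_def)

text \<open>The monomials are distinct characters of the multiplicative monoid of pairs of points.\<close>

lemma tensor_value_inject:
  assumes T: "Poly_Mapping.keys T \<subseteq> gen_monomials \<times> gen_monomials"
    and T': "Poly_Mapping.keys T' \<subseteq> gen_monomials \<times> gen_monomials"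
    and eq: "\<And>F G. \<lbrakk>F \<in> series_pairs; G \<in> series_pairs\<rbrakk> \<Longrightarrow> tensor_value T F G = tensor_value T' F G"
  shows "T = T'"
proof -
  let ?S = "Poly_Mapping.keys T \<union> Poly_Mapping.keys T'"
  let ?c = "\<lambda>p. Poly_Mapping.lookup T p - Poly_Mapping.lookup T' p"
  let ?\<chi> = "\<lambda>p xy. mono_eval (fst p) (fst xy) * mono_eval (snd p) (snd xy)"
  have vanish: "(\<Sum>p\<in>?S. ?c p * ?\<chi> p (x, y)) = 0" for x y
  proof -
    obtain F where F: "F \<in> series_pairs" "\<And>g. g \<in> UNIV \<times> exponents \<Longrightarrow> gen_value g F = x g"
      using gen_values_surj[of x] by blast
    obtain G where G: "G \<in> series_pairs" "\<And>g. g \<in> UNIV \<times> exponents \<Longrightarrow> gen_value g G = y g"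
      using gen_values_surj[of y] by blast
    have \<chi>: "?\<chi> p (x, y) = (case p of (M, N) \<Rightarrow> monomial_value M F * monomial_value N G)" if "p \<in> ?S" for p
    proof -
      have "fst p \<in> gen_monomials" "snd p \<in> gen_monomials" using T T' that by auto
      then have "mono_eval (fst p) x = monomial_value (fst p) F" "mono_eval (snd p) y = monomial_value (snd p) G"
        unfolding monomial_value_eq using F(2) G(2) by (auto simp: gen_monomials_def intro!: mono_eval_cong)
      then show ?thesis by (simp add: case_prod_beta)
    qed
    have "(\<Sum>p\<in>?S. ?c p * ?\<chi> p (x, y))
        = (\<Sum>p\<in>?S. ?c p * (case p of (M, N) \<Rightarrow> monomial_value M F * monomial_value N G))"
      using \<chi> by (intro sum.cong) simp_all
    also have "\<dots> = tensor_value T F G - tensor_value T' F G"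
      unfolding tensor_value_eq by (simp add: lin_val_superset[of ?S] left_diff_distrib sum_subtractf)
    finally show ?thesis using eq F G by simp
  qed
  have "\<forall>p\<in>?S. ?c p = 0"
  proof (rule characters_independent[where \<chi> = ?\<chi> and e = "(\<lambda>_. 1, \<lambda>_. 1)"
        and m = "\<lambda>xy xy'. (\<lambda>g. fst xy g * fst xy' g, \<lambda>g. snd xy g * snd xy' g)"])
    show "\<exists>xy. ?\<chi> p xy \<noteq> ?\<chi> q xy" if "p \<noteq> q" for p q
    proof (cases "fst p = fst q")
      case True
      then have "snd p \<noteq> snd q" using that by (simp add: prod_eq_iff)
      then obtain y where "mono_eval (snd p) y \<noteq> mono_eval (snd q) y" using mono_eval_distinct by blast
      then show ?thesis by (intro exI[of _ "(\<lambda>_. 1, y)"]) (simp add: mono_eval_def)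
    next
      case False
      then obtain x where "mono_eval (fst p) x \<noteq> mono_eval (fst q) x" using mono_eval_distinct by blast
      then show ?thesis by (intro exI[of _ "(x, \<lambda>_. 1)"]) (simp add: mono_eval_def)
    qed
    show "(\<Sum>p\<in>?S. ?c p * ?\<chi> p xy) = 0" for xy
      using vanish[of "fst xy" "snd xy"] by simp
  qed (simp_all add: mono_eval_def power_mult_distrib prod.distrib)
  have "Poly_Mapping.lookup T p = Poly_Mapping.lookup T' p" for p
  proof (cases "p \<in> ?S")
    case True
    then have "?c p = 0" using \<open>\<forall>p\<in>?S. ?c p = 0\<close> by blast
    then show ?thesis by simp
  next
    case False
    then show ?thesis by (simp add: in_keys_iff)
  qed
  then show ?thesis by (rule poly_mapping_eqI)
qed

text \<open>Uniqueness of the described tensor is \<open>tensor_value_inject\<close>; existence has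
  to come from a concrete \<open>T\<close>.\<close>

lemma gen_comult_eqI:
  assumes "Poly_Mapping.keys T \<subseteq> gen_monomials \<times> gen_monomials"
    and "\<And>F G. \<lbrakk>F \<in> series_pairs; G \<in> series_pairs\<rbrakk> \<Longrightarrow> tensor_value T F G = gen_value g (G \<circledast> F)"
  shows "gen_comult g = T"
  unfolding gen_comult_def
  by (rule the_equality) (use assms tensor_value_inject in auto)

lemma tensor_value_mult: "tensor_value (S * T) F G = tensor_value S F G * tensor_value T F G"
  unfolding tensor_value_eq
  by (rule lin_val_mult) (auto simp: monomial_value_eq mono_eval_add)

lemma tensor_value_one: "tensor_value 1 F G = 1"
  unfolding tensor_value_eq
  by (rule lin_val_one) (simp add: monomial_value_eq zero_prod_def)

lemma gen_monomials_add: "\<lbrakk>M \<in> gen_monomials; N \<in> gen_monomials\<rbrakk> \<Longrightarrow> M + N \<in> gen_monomials"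
  using keys_add[of M N] by (auto simp: gen_monomials_def)

lemma zero_gen_monomials: "0 \<in> gen_monomials"
  by (simp add: gen_monomials_def)

lemma keys_tensor_mult:
  assumes "Poly_Mapping.keys S \<subseteq> gen_monomials \<times> gen_monomials" "Poly_Mapping.keys T \<subseteq> gen_monomials \<times> gen_monomials"
  shows "Poly_Mapping.keys (S * T) \<subseteq> gen_monomials \<times> gen_monomials"
  using keys_mult[of S T] assms gen_monomials_add by (fastforce simp: plus_prod_def)

lemma keys_tensor_one: "Poly_Mapping.keys (1 :: gen_monomial \<times> gen_monomial \<Rightarrow>\<^sub>0 rat) \<subseteq> gen_monomials \<times> gen_monomials"
  using zero_gen_monomials by (simp add: zero_prod_def)

text \<open>Evaluation is an algebra map, so the product of the tensors of the generators takes the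
  value of the monomial at \<open>G \<circledast> F\<close>. Any tensor with these values is that
  product, which spares an expansion of powers of tensors.\<close>

lemma monomial_comult_eqI:
  assumes gens: "\<And>g. g \<in> Poly_Mapping.keys M \<Longrightarrow> Poly_Mapping.keys (gen_comult g) \<subseteq> gen_monomials \<times> gen_monomials
      \<and> (\<forall>F\<in>series_pairs. \<forall>G\<in>series_pairs. tensor_value (gen_comult g) F G = gen_value g (G \<circledast> F))"
    and T: "Poly_Mapping.keys T \<subseteq> gen_monomials \<times> gen_monomials"
    and val: "\<And>F G. \<lbrakk>F \<in> series_pairs; G \<in> series_pairs\<rbrakk> \<Longrightarrow> tensor_value T F G = monomial_value M (G \<circledast> F)"
  shows "(\<Prod>g\<in>Poly_Mapping.keys M. gen_comult g ^ Poly_Mapping.lookup M g) = T"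
proof -
  let ?good = "\<lambda>T. Poly_Mapping.keys T \<subseteq> gen_monomials \<times> gen_monomials"
  have pow: "?good (gen_comult g ^ n)
      \<and> (\<forall>F\<in>series_pairs. \<forall>G\<in>series_pairs. tensor_value (gen_comult g ^ n) F G = gen_value g (G \<circledast> F) ^ n)"
    if "g \<in> Poly_Mapping.keys M" for g n
    using gens[OF that] by (induction n) (auto simp: tensor_value_one tensor_value_mult keys_tensor_one[simplified] keys_tensor_mult simp del: keys_one
        intro!: keys_tensor_mult[THEN subsetD] keys_tensor_one[THEN subsetD])
  have "?good (\<Prod>g\<in>A. gen_comult g ^ Poly_Mapping.lookup M g)
      \<and> (\<forall>F\<in>series_pairs. \<forall>G\<in>series_pairs. tensor_value (\<Prod>g\<in>A. gen_comult g ^ Poly_Mapping.lookup M g) F G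
        = (\<Prod>g\<in>A. gen_value g (G \<circledast> F) ^ Poly_Mapping.lookup M g))"
    if "finite A" "A \<subseteq> Poly_Mapping.keys M" for A
    using that
  proof (induction A rule: finite_induct)
    case empty
    show ?case using keys_tensor_one by (simp add: tensor_value_one)
  next
    case (insert g A)
    then show ?case using pow[of g "Poly_Mapping.lookup M g"] keys_tensor_mult by (auto simp: tensor_value_mult)
  qed
  from this[OF finite_keys subset_refl] show ?thesis
    using T val by (intro tensor_value_inject) (auto simp: monomial_value_def)
qed

section \<open>The incidence bialgebra\<close>

lemma is_functor_hofibre_faces:
  assumes "is_functor (face X 2 2) (level X 2) H" "is_functor (face X 2 0) (level X 2) H"
  shows "is_functor (faces20 X) (hofibre F (level X 2) K y) (prod_groupoid H H)"
proof -
  note d = functor_ob[OF assms(1)] functor_ar[OF assms(1)] functor_Comp[OF assms(1)]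
    functor_ob[OF assms(2)] functor_ar[OF assms(2)] functor_Comp[OF assms(2)]
  show ?thesis
    by (intro is_functorI) (auto simp: hofibre_def faces20_def prod_groupoid_def d(1,2,4,5)
        elim!: d(3)[rotated 3] d(6)[rotated 3])
qed

text \<open>An object of the iterated fibre is a 2-simplex \<open>x\<close> with arrows from its
  faces to \<open>f\<close>, \<open>a\<close> and \<open>b\<close>, and it has as many outgoing
  arrows as \<open>x\<close>. The number of arrows from a face to \<open>a\<close> is either 0 or
  the order of the automorphism group of \<open>a\<close>, and likewise for \<open>b\<close>; the
  normalising denominators therefore cancel, and \<open>a\<close> and \<open>b\<close> merely select
  simplices.\<close>

lemma incidence_coeff_eq:
  assumes G1: "is_groupoid (level X 1)" and G2: "is_groupoid (level X 2)"
    and d: "is_functor (face X 2 1) (level X 2) (level X 1)" "is_functor (face X 2 2) (level X 2) (level X 1)"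
      "is_functor (face X 2 0) (level X 2) (level X 1)"
    and obj: "f \<in> Obj (level X 1)" "a \<in> Obj (level X 1)" "b \<in> Obj (level X 1)"
    and fin: "\<And>x y. \<lbrakk>x \<in> Obj (level X 1); y \<in> Obj (level X 1)\<rbrakk> \<Longrightarrow> finite (Hom (level X 1) x y)"
    and E: "finite E" "E \<subseteq> Obj (level X 2)"
      "\<And>x. \<lbrakk>x \<in> Obj (level X 2); Hom (level X 1) (ob (face X 2 1) x) f \<noteq> {}\<rbrakk> \<Longrightarrow> x \<in> E"
  shows "incidence_coeff X f a b = (\<Sum>x\<in>E. if Hom (level X 1) (ob (face X 2 2) x) a \<noteq> {} \<and> Hom (level X 1) (ob (face X 2 0) x) b \<noteq> {}
    then of_nat (card (Hom (level X 1) (ob (face X 2 1) x) f)) / of_nat (card (outs (level X 2) x)) else 0)"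
proof -
  interpret G1: is_groupoid "level X 1" by fact
  let ?H = "Hom (level X 1)"
  let ?K = "hofibre (face X 2 1) (level X 2) (level X 1) f"
  let ?P = "prod_groupoid (level X 1) (level X 1)"
  let ?A = "\<lambda>x. ?H (ob (face X 2 1) x) f \<times> (?H (ob (face X 2 2) x) a \<times> ?H (ob (face X 2 0) x) b)"
  let ?r = "\<lambda>(x, \<phi>, \<alpha>\<beta>). ((x, \<phi>), \<alpha>\<beta>)"
  have K: "is_groupoid ?K" by (rule is_groupoid_hofibre[OF G2 G1 d(1) obj(1)])
  have P: "is_groupoid ?P" by (rule is_groupoid_prod[OF G1 G1])
  have ab: "(a, b) \<in> Obj ?P" using obj by (simp add: prod_groupoid_def)
  have F: "is_functor (faces20 X) ?K ?P" by (rule is_functor_hofibre_faces[OF d(2,3)])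
  have \<Phi>: "is_groupoid (incidence_fibre X f a b)"
    unfolding incidence_fibre_def by (rule is_groupoid_hofibre[OF K P F ab])
  have objs: "Obj (incidence_fibre X f a b) = ?r ` (SIGMA x:E. ?A x)"
  proof (intro subset_antisym subsetI)
    fix u assume "u \<in> Obj (incidence_fibre X f a b)"
    then obtain x \<phi> \<alpha> \<beta> where u: "u = ((x, \<phi>), (\<alpha>, \<beta>))" "x \<in> Obj (level X 2)" "\<phi> \<in> ?H (ob (face X 2 1) x) f"
      "\<alpha> \<in> ?H (ob (face X 2 2) x) a" "\<beta> \<in> ?H (ob (face X 2 0) x) b"
      by (auto simp: incidence_fibre_def hofibre_def faces20_def prod_groupoid_def)
    moreover have "x \<in> E" using E(3) u by blast
    ultimately show "u \<in> ?r ` (SIGMA x:E. ?A x)"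
      by (intro image_eqI[of _ _ "(x, \<phi>, (\<alpha>, \<beta>))"]) auto
  qed (use E(2) in \<open>auto simp: incidence_fibre_def hofibre_def faces20_def prod_groupoid_def\<close>)
  have finH: "finite (?H (ob (face X 2 i) x) c)" if "x \<in> E" "c \<in> Obj (level X 1)" "i \<in> {0, 1, 2}" for x c i
    using that E(2) d functor_ob by (intro fin) fast+
  have finA: "finite (?A x)" if "x \<in> E" for x
    using finH[OF that] obj by auto
  have inj: "inj_on ?r (SIGMA x:E. ?A x)" by (auto simp: inj_on_def)
  have "finite (Obj (incidence_fibre X f a b))"
    unfolding objs using E(1) finA by auto
  then have "hcard (incidence_fibre X f a b) = (\<Sum>u\<in>Obj (incidence_fibre X f a b). 1 / of_nat (card (outs (incidence_fibre X f a b) u)))"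
    by (rule is_groupoid.hcard_eq_sum_objects[OF \<Phi>])
  also have "\<dots> = (\<Sum>u\<in>Obj (incidence_fibre X f a b). 1 / of_nat (card (outs (level X 2) (fst (fst u)))))"
  proof (rule sum.cong[OF refl])
    fix u assume u: "u \<in> Obj (incidence_fibre X f a b)"
    obtain x \<phi> \<alpha>\<beta> where s: "u = ((x, \<phi>), \<alpha>\<beta>)" by (metis surj_pair)
    have 1: "((x, \<phi>), \<alpha>\<beta>) \<in> Obj (hofibre (faces20 X) ?K ?P (a, b))"
      using u s by (simp add: incidence_fibre_def)
    then have 2: "(x, \<phi>) \<in> Obj ?K" by (simp add: hofibre_def)
    show "1 / of_nat (card (outs (incidence_fibre X f a b) u)) = 1 / of_nat (card (outs (level X 2) (fst (fst u))))"
      using card_outs_hofibre[OF K P F ab 1] card_outs_hofibre[OF G2 G1 d(1) obj(1) 2]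
      by (simp add: s incidence_fibre_def)
  qed
  also have "\<dots> = (\<Sum>(x, y)\<in>(SIGMA x:E. ?A x). 1 / of_nat (card (outs (level X 2) x)))"
    unfolding objs sum.reindex[OF inj] by (rule sum.cong) auto
  also have "\<dots> = (\<Sum>x\<in>E. \<Sum>y\<in>?A x. 1 / of_nat (card (outs (level X 2) x)))"
    by (rule sum.Sigma[symmetric]) (use E(1) finA in auto)
  finally have hc: "hcard (incidence_fibre X f a b) = (\<Sum>x\<in>E. of_nat (card (?A x)) / of_nat (card (outs (level X 2) x)))"
    by simp
  have aut: "card (?H y c) = (if ?H y c \<noteq> {} then card (?H c c) else 0)" if "y \<in> Obj (level X 1)" "c \<in> Obj (level X 1)" for y c
    using G1.card_Hom_eq'[of c y c] that by auto
  have pos: "rat_of_nat (card (?H c c)) \<noteq> 0" if "c \<in> Obj (level X 1)" for c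
    using fin[OF that that] G1.Id_in[OF that] by auto
  show ?thesis
    unfolding incidence_coeff_def hc aut_card_def sum_divide_distrib
  proof (rule sum.cong[OF refl])
    fix x assume "x \<in> E"
    then have x: "ob (face X 2 2) x \<in> Obj (level X 1)" "ob (face X 2 0) x \<in> Obj (level X 1)"
      using E(2) d functor_ob by fast+
    show "of_nat (card (?A x)) / of_nat (card (outs (level X 2) x)) / (of_nat (card (?H a a)) * of_nat (card (?H b b)))
      = (if ?H (ob (face X 2 2) x) a \<noteq> {} \<and> ?H (ob (face X 2 0) x) b \<noteq> {}
         then of_nat (card (?H (ob (face X 2 1) x) f)) / of_nat (card (outs (level X 2) x)) else 0 :: rat)"
      using pos[OF obj(2)] pos[OF obj(3)] aut[OF x(1) obj(2)] aut[OF x(2) obj(3)]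
      by (auto simp: card_cartesian_product)
  qed
qed

lemma hcard_hofibre:
  assumes G: "is_groupoid G" and H: "is_groupoid H" and F: "is_functor F G H" and f: "f \<in> Obj H"
    and fin: "\<And>x. x \<in> E \<Longrightarrow> finite (Hom H (ob F x) f)"
    and E: "finite E" "E \<subseteq> Obj G" "\<And>x. \<lbrakk>x \<in> Obj G; Hom H (ob F x) f \<noteq> {}\<rbrakk> \<Longrightarrow> x \<in> E"
  shows "hcard (hofibre F G H f) = (\<Sum>x\<in>E. of_nat (card (Hom H (ob F x) f)) / of_nat (card (outs G x)))"
proof -
  have objs: "Obj (hofibre F G H f) = (SIGMA x:E. Hom H (ob F x) f)"
    using E(2,3) by (auto simp: hofibre_def)
  have "finite (Obj (hofibre F G H f))" unfolding objs using E(1) fin by auto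
  then have "hcard (hofibre F G H f) = (\<Sum>u\<in>Obj (hofibre F G H f). 1 / of_nat (card (outs (hofibre F G H f) u)))"
    by (rule is_groupoid.hcard_eq_sum_objects[OF is_groupoid_hofibre[OF G H F f]])
  also have "\<dots> = (\<Sum>(x, \<phi>)\<in>(SIGMA x:E. Hom H (ob F x) f). 1 / of_nat (card (outs G x)))"
    by (rule sum.cong[OF objs]) (use card_outs_hofibre[OF G H F f] objs in auto)
  also have "\<dots> = (\<Sum>x\<in>E. \<Sum>\<phi>\<in>Hom H (ob F x) f. 1 / of_nat (card (outs G x)))"
    by (rule sum.Sigma[symmetric]) (use E(1) fin in auto)
  finally show ?thesis by simp
qed

section \<open>The bar construction of the operad in low degrees\<close>

declare cell_face.simps [simp del] cell_degen.simps [simp del]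

abbreviation tree_bar where "tree_bar \<equiv> bar sym_operad"
abbreviation "compose_cell \<equiv> ob (cell_face sym_operad (Suc (Suc 0)) (Suc 0))"
abbreviation "root_cell \<equiv> ob (cell_face sym_operad (Suc (Suc 0)) 0)"
abbreviation "top_cells \<equiv> ob (cell_last_face sym_operad 2)"

lemma bar_sel:
  "level tree_bar 0 = Sr (cells sym_operad 0)" "level tree_bar 1 = Sr cells1" "level tree_bar 2 = Sr cells2"
  "face tree_bar 2 0 = mapT (cell_face sym_operad (Suc (Suc 0)) 0)"
  "face tree_bar 2 1 = mapT (cell_face sym_operad (Suc (Suc 0)) (Suc 0))"
  "face tree_bar 2 2 = multT \<odot> mapT (cell_last_face sym_operad 2)"
  by (simp_all add: bar_def numeral_2_eq_2)

text \<open>The generator named by an operation: each letter is recovered from an input list as its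
  common colour and its length. The remaining constructors do not occur in
  \<open>cells1\<close>.\<close>

definition cell_gen :: "(two, (two list \<times> two) list) cell \<Rightarrow> generator" where
  "cell_gen x = (case x of Oper q \<Rightarrow> (snd (hd q), msum (map (\<lambda>(cs, d). (hd cs, length cs)) q)))"

lemma cell_gen_word:
  assumes "w \<in> words" shows "cell_gen (Oper (op_of_word d w)) = (d, msum w)"
proof -
  have "map (\<lambda>(cs, d). (hd cs, length cs)) (op_of_word d w) = w"
    using assms by (auto simp: op_of_word_def words_def hd_replicate Suc_le_eq case_prod_beta intro!: map_idI)
  moreover have "snd (hd (op_of_word d w)) = d"
    using assms by (cases w) (auto simp: op_of_word_def words_def)
  ultimately show ?thesis by (simp add: cell_gen_def)
qed

lemma cell_gen_cells1: "cell_gen ` Obj cells1 = UNIV \<times> exponents"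
proof (intro subset_antisym subsetI)
  fix g assume "g \<in> cell_gen ` Obj cells1"
  then show "g \<in> UNIV \<times> exponents"
    using words_exponents by (auto simp: Obj_cells1 cell_gen_word)
next
  fix g assume g: "g \<in> (UNIV :: two set) \<times> exponents"
  then have "snd g \<in> exponents" by auto
  then obtain w where "w \<in> words" "msum w = snd g" using msum_words by blast
  then show "g \<in> cell_gen ` Obj cells1"
    by (intro image_eqI[of _ _ "Oper (op_of_word (fst g) w)"]) (auto simp: cell_gen_word Obj_cells1)
qed

lemma card_Hom_cells1_gen:
  assumes "x \<in> Obj cells1" "y \<in> Obj cells1"
  shows "of_nat (card (Hom cells1 x y)) = (if cell_gen x = cell_gen y then exp_factorial (snd (cell_gen y)) else 0)"
proof -
  obtain d w d' w' where "x = Oper (op_of_word d w)" "y = Oper (op_of_word d' w')" "w \<in> words" "w' \<in> words"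
    using assms by (auto simp: Obj_cells1)
  then show ?thesis by (simp only: cell_gen_word card_Hom_cells1 card_Hom_op snd_conv)
qed

lemma Hom_cells1_nonempty:
  assumes "x \<in> Obj cells1" "y \<in> Obj cells1"
  shows "Hom cells1 x y \<noteq> {} \<longleftrightarrow> cell_gen x = cell_gen y"
proof -
  have "exp_factorial \<mu> \<noteq> 0" for \<mu> by (simp add: exp_factorial_def)
  then have "card (Hom cells1 x y) \<noteq> 0 \<longleftrightarrow> cell_gen x = cell_gen y"
    using card_Hom_cells1_gen[OF assms] by (metis of_nat_0 of_nat_eq_0_iff)
  then show ?thesis using finite_Hom_cells1[of x y] by auto
qed

section \<open>Monomials as components of the groupoid of 1-simplices\<close>

definition cells_monomial :: "(two, (two list \<times> two) list) cell list \<Rightarrow> gen_monomial" where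
  "cells_monomial xs = msum (map cell_gen xs)"

lemma cells_monomial_append: "cells_monomial (xs @ ys) = cells_monomial xs + cells_monomial ys"
  by (simp add: cells_monomial_def)

lemma Hom_X1_nonempty:
  assumes "xs \<in> Obj (Sr cells1)" "ys \<in> Obj (Sr cells1)"
  shows "Hom (Sr cells1) xs ys \<noteq> {} \<longleftrightarrow> cells_monomial xs = cells_monomial ys"
  unfolding cells_monomial_def msum_eq_iff
  by (rule Hom_Sr_nonempty, rule Hom_cells1_nonempty) (use assms in \<open>auto simp: Obj_Sr\<close>)

lemma finite_Hom_X1: "finite (Hom (Sr cells1) xs ys)"
proof (cases "length xs = length ys")
  case True
  then show ?thesis by (rule card_Hom_Sr(2)) (rule finite_Hom_cells1)
next
  case False
  then have "Hom (Sr cells1) xs ys = {}" by (auto simp: Hom_Sr_iff)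
  then show ?thesis by simp
qed

text \<open>Tuples in \<open>Sr\<close> are nonempty, so the constant monomial, with exponent vector
  0, is not attained; it corresponds to the adjoined unit.\<close>

lemma cells_monomial_X1: "cells_monomial ` Obj (Sr cells1) = gen_monomials - {0}"
proof (intro subset_antisym subsetI)
  fix M assume "M \<in> cells_monomial ` Obj (Sr cells1)"
  then show "M \<in> gen_monomials - {0}"
    using cell_gen_cells1 by (auto simp: cells_monomial_def Obj_Sr gen_monomials_def simp del: UNIV_Times_UNIV) blast+
next
  fix M assume M: "M \<in> gen_monomials - {0}"
  obtain gs where gs: "msum gs = M" using msum_surj by blast
  then have "set gs \<subseteq> cell_gen ` Obj cells1" "gs \<noteq> []"
    using M by (auto simp: cell_gen_cells1 gen_monomials_def)
  have "\<forall>g\<in>set gs. \<exists>x. x \<in> Obj cells1 \<and> cell_gen x = g"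
    using \<open>set gs \<subseteq> cell_gen ` Obj cells1\<close> by blast
  then obtain h where h: "\<forall>g\<in>set gs. h g \<in> Obj cells1 \<and> cell_gen (h g) = g" by metis
  let ?xs = "map h gs"
  have "?xs \<noteq> []" "set ?xs \<subseteq> Obj cells1" "map cell_gen ?xs = gs"
    using h \<open>gs \<noteq> []\<close> by (auto intro!: map_idI)
  then have "?xs \<in> Obj (Sr cells1)" "cells_monomial ?xs = M"
    using gs by (simp add: Obj_Sr, simp only: cells_monomial_def)
  then show "M \<in> cells_monomial ` Obj (Sr cells1)"
    by blast
qed

definition monomial_class :: "gen_monomial \<Rightarrow> (two, (two list \<times> two) list) cell list set" where
  "monomial_class M = {xs \<in> Obj (Sr cells1). cells_monomial xs = M}"

definition basis_map :: "gen_monomial \<Rightarrow> (two, (two list \<times> two) list) cell list set option" where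
  "basis_map M = (if M = 0 then None else Some (monomial_class M))"

lemma component_X1: "xs \<in> Obj (Sr cells1) \<Longrightarrow> component (Sr cells1) xs = monomial_class (cells_monomial xs)"
  unfolding component_def monomial_class_def by (rule Collect_cong) (metis Hom_X1_nonempty)

lemma pi0_X1: "pi0 (Sr cells1) = monomial_class ` (gen_monomials - {0})"
proof -
  have "pi0 (Sr cells1) = (\<lambda>xs. monomial_class (cells_monomial xs)) ` Obj (Sr cells1)"
    unfolding pi0_eq by (rule image_cong[OF refl]) (rule component_X1)
  also have "\<dots> = monomial_class ` cells_monomial ` Obj (Sr cells1)" by (rule image_image[symmetric])
  finally show ?thesis by (simp only: cells_monomial_X1)
qed

lemma repr_monomial_class:
  assumes "M \<in> gen_monomials" "M \<noteq> 0"
  shows "repr (monomial_class M) \<in> Obj (Sr cells1)" "cells_monomial (repr (monomial_class M)) = M"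
proof -
  have "monomial_class M \<in> pi0 (Sr cells1)" using assms by (simp add: pi0_X1)
  then have "repr (monomial_class M) \<in> monomial_class M"
    by (rule is_groupoid.repr_in(1)[OF is_groupoid_Sr[OF is_groupoid_cells1]])
  then show "repr (monomial_class M) \<in> Obj (Sr cells1)" "cells_monomial (repr (monomial_class M)) = M"
    by (auto simp: monomial_class_def)
qed

lemma monomial_class_inj:
  assumes "M \<in> gen_monomials" "M \<noteq> 0" "N \<in> gen_monomials" "N \<noteq> 0" "monomial_class M = monomial_class N"
  shows "M = N"
  using repr_monomial_class(2)[OF assms(1,2)] repr_monomial_class(2)[OF assms(3,4)] assms(5) by metis

lemma bij_basis_map: "bij_betw basis_map gen_monomials (insert None (Some ` pi0 (Sr cells1)))"
proof (rule bij_betw_imageI)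
  show "inj_on basis_map gen_monomials"
    using monomial_class_inj by (auto simp: inj_on_def basis_map_def)
  show "basis_map ` gen_monomials = insert None (Some ` pi0 (Sr cells1))"
    using zero_gen_monomials by (auto simp: basis_map_def pi0_X1 image_iff)
qed

lemma juxtapose_basis_map:
  assumes "M \<in> gen_monomials" "N \<in> gen_monomials"
  shows "juxtapose tree_bar (basis_map M) (basis_map N) = basis_map (M + N)"
proof (cases "M = 0 \<or> N = 0")
  case True
  then show ?thesis by (auto simp: juxtapose_def basis_map_def split: option.split)
next
  case False
  \<comment> \<open>Natural exponents cannot cancel, so a product of nonconstant monomials does not
    fall into the case of the adjoined unit.\<close>
  have ne: "M + N \<noteq> 0"
  proof
    assume "M + N = 0"
    then have "Poly_Mapping.lookup M g = 0" for g by (metis add_eq_0_iff_both_eq_0 lookup_add lookup_zero)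
    then show False using False by (simp add: poly_mapping_eqI)
  qed
  have "{z \<in> Obj (Sr cells1). \<exists>x\<in>monomial_class M. \<exists>y\<in>monomial_class N. Hom (Sr cells1) (x @ y) z \<noteq> {}} = monomial_class (M + N)"
    (is "?L = _")
  proof (intro subset_antisym subsetI)
    fix z assume "z \<in> ?L"
    then obtain x y where "z \<in> Obj (Sr cells1)" "x \<in> monomial_class M" "y \<in> monomial_class N" "Hom (Sr cells1) (x @ y) z \<noteq> {}"
      by blast
    moreover from this have "x @ y \<in> Obj (Sr cells1)" by (auto simp: monomial_class_def Obj_Sr)
    ultimately show "z \<in> monomial_class (M + N)"
      using Hom_X1_nonempty[of "x @ y" z] by (auto simp: monomial_class_def cells_monomial_append)
  next
    fix z assume z: "z \<in> monomial_class (M + N)"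
    let ?x = "repr (monomial_class M)" and ?y = "repr (monomial_class N)"
    have x: "?x \<in> monomial_class M" "?y \<in> monomial_class N"
      using repr_monomial_class assms False by (auto simp: monomial_class_def)
    then have "?x @ ?y \<in> Obj (Sr cells1)" by (auto simp: monomial_class_def Obj_Sr)
    then have "Hom (Sr cells1) (?x @ ?y) z \<noteq> {}"
      using Hom_X1_nonempty[of "?x @ ?y" z] z x by (auto simp: monomial_class_def cells_monomial_append)
    then show "z \<in> ?L" using x z by (auto simp: monomial_class_def)
  qed
  then show ?thesis using False ne
    by (simp add: juxtapose_def basis_map_def bar_sel[unfolded One_nat_def])
qed

section \<open>The comultiplication\<close>

lemma faces_cells2:
  assumes "y \<in> Obj cells2"
  shows "compose_cell y \<in> Obj cells1" "root_cell y \<in> Obj cells1" "top_cells y \<in> Obj (Sr cells1)"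
proof -
  show "compose_cell y \<in> Obj cells1" using functor_ob[OF is_functor_compose_cells assms] .
  show "root_cell y \<in> Obj cells1" using functor_ob[OF is_functor_root_cell assms] .
  \<comment> \<open>On the one-entry tuple \<open>[y]\<close> the flattened last face is just
    \<open>top_cells y\<close>.\<close>
  show "top_cells y \<in> Obj (Sr cells1)"
    using functor_ob[OF is_functor_last_face, of "[y]"] assms by (auto simp: Obj_Sr)
qed

text \<open>A finite stock of cells that serves all entries of a tuple with monomial
  \<open>M\<close> at once, as the common index set \<open>E\<close> in \<open>sum_Sr\<close>
  requires.\<close>

definition cells_over :: "gen_monomial \<Rightarrow> (two, (two list \<times> two) list) cell set" where
  "cells_over M = {y \<in> Obj cells2. cell_gen (compose_cell y) \<in> Poly_Mapping.keys M}"

lemma cells_over_gen: "{y \<in> Obj cells2. cell_gen (compose_cell y) = (d, \<mu>)} = tree_cell d ` trees_over \<mu>"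
  by (auto simp: Obj_cells2 compose_tree_cell cell_gen_word tree_word_words trees_over_def)

lemma finite_cells_over: "finite (cells_over M)"
proof -
  have "cells_over M = (\<Union>(d, \<mu>)\<in>Poly_Mapping.keys M. {y \<in> Obj cells2. cell_gen (compose_cell y) = (d, \<mu>)})"
    by (auto simp: cells_over_def)
  then show ?thesis by (auto simp: cells_over_gen finite_trees_over)
qed

text \<open>The face $d_2$ keeps the tops and gives the left tensor factor, evaluated at
  \<open>F\<close>; the face $d_0$ keeps the root and gives the right one, evaluated at
  \<open>G\<close>.\<close>

definition cell_value :: "series_pair \<Rightarrow> series_pair \<Rightarrow> (two, (two list \<times> two) list) cell \<Rightarrow> rat" where
  "cell_value F G y = prod_list (map (\<lambda>x. gen_value (cell_gen x) F) (top_cells y)) * gen_value (cell_gen (root_cell y)) G"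

text \<open>Only trees composing to the class of \<open>f\<close> contribute, each with \<mu>!
  arrows to \<open>f\<close>. The value of an operation is the weight of its word times the
  factorial of its length, and the product of these factorials over the root and the tops is
  precisely the number of arrows leaving the tree. What remains is \<mu>! times the expansion in
  \<open>mcoeff_plethysm\<close>.\<close>

lemma sum_cell_value:
  assumes F: "F \<in> series_pairs" and G: "G \<in> series_pairs" and f: "f \<in> Obj cells1" "cell_gen f \<in> Poly_Mapping.keys M"
  shows "(\<Sum>y\<in>cells_over M. of_nat (card (Hom cells1 (compose_cell y) f)) / of_nat (card (outs cells2 y)) * cell_value F G y)
    = gen_value (cell_gen f) (G \<circledast> F)"
proof -
  obtain d \<mu> where g: "cell_gen f = (d, \<mu>)" by (cases "cell_gen f")
  let ?t = "\<lambda>y. of_nat (card (Hom cells1 (compose_cell y) f)) / of_nat (card (outs cells2 y)) * cell_value F G y"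
  have "(\<Sum>y\<in>cells_over M. ?t y) = (\<Sum>y\<in>{y \<in> Obj cells2. cell_gen (compose_cell y) = (d, \<mu>)}. ?t y)"
  proof (rule sum.mono_neutral_right[OF finite_cells_over])
    show "{y \<in> Obj cells2. cell_gen (compose_cell y) = (d, \<mu>)} \<subseteq> cells_over M"
      using f(2) g by (auto simp: cells_over_def)
    show "\<forall>y\<in>cells_over M - {y \<in> Obj cells2. cell_gen (compose_cell y) = (d, \<mu>)}. ?t y = 0"
      using card_Hom_cells1_gen[OF faces_cells2(1) f(1)] g by (auto simp: cells_over_def)
  qed
  also have "\<dots> = (\<Sum>z\<in>trees_over \<mu>. ?t (tree_cell d z))"
    unfolding cells_over_gen
    by (rule sum.reindex[unfolded o_def]) (use tree_cell_inj in \<open>auto simp: inj_on_def trees_over_def\<close>)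
  also have "\<dots> = (\<Sum>z\<in>trees_over \<mu>. exp_factorial \<mu> * (word_weight (G d) (map fst z) * tops_weight F z))"
  proof (rule sum.cong[OF refl])
    fix z assume "z \<in> trees_over \<mu>"
    then have z: "z \<in> trees" "msum (tree_word z) = \<mu>" by (auto simp: trees_over_def)
    have y: "tree_cell d z \<in> Obj cells2" using z by (auto simp: Obj_cells2)
    have hom: "of_nat (card (Hom cells1 (compose_cell (tree_cell d z)) f)) = exp_factorial \<mu>"
      using card_Hom_cells1_gen[OF faces_cells2(1)[OF y] f(1)] z g
      by (simp add: compose_tree_cell cell_gen_word tree_word_words)
    have root: "gen_value (cell_gen (root_cell (tree_cell d z))) G = word_weight (G d) (map fst z) * fact (length z)"
      using trees_root[OF z(1)] by (simp add: root_tree_cell cell_gen_word gen_value_def word_weight_def)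
    have tops: "prod_list (map (\<lambda>x. gen_value (cell_gen x) F) (top_cells (tree_cell d z)))
        = tops_weight F z * prod_list (map (\<lambda>(v, us). fact (length us)) z)"
    proof -
      have "map (\<lambda>x. gen_value (cell_gen x) F) (top_cells (tree_cell d z))
          = map (\<lambda>(v, us). word_weight (F (fst v)) us * fact (length us)) z"
        using trees_tops[OF z(1)]
        by (auto simp: last_tree_cell tree_tops_def cell_gen_word gen_value_def word_weight_def)
      moreover have "prod_list (map (\<lambda>(v, us). word_weight (F (fst v)) us * fact (length us)) zs)
          = tops_weight F zs * prod_list (map (\<lambda>(v, us). fact (length us)) zs)" for zs
        by (induction zs) (auto simp: tops_weight_def)
      ultimately show ?thesis by simp
    qed
    have pl: "prod_list (map (\<lambda>(v, us). fact (length us)) zs) = (of_nat (prod_list (map (\<lambda>(v, us). fact (length us)) zs)) :: rat)"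
      for zs :: "(pvar \<times> pvar list) list"
      by (induction zs) auto
    have "prod_list (map (\<lambda>(v, us). fact (length us)) z) \<noteq> (0 :: nat)" by (auto simp: prod_list_zero_iff)
    then show "?t (tree_cell d z) = exp_factorial \<mu> * (word_weight (G d) (map fst z) * tops_weight F z)"
      unfolding hom outs_cells2(1)[OF z(1)] cell_value_def root tops pl by simp
  qed
  also have "\<dots> = gen_value (d, \<mu>) (G \<circledast> F)"
    by (simp add: gen_value_def mcoeff_plethysm[OF F G] sum_distrib_left)
  finally show ?thesis by (simp add: g)
qed

text \<open>The comultiplication of the class of \<open>f\<close>, written with monomials in place
  of components. The sum runs over individual simplices, so several of them may feed the same pair
  of monomials.\<close>

definition bar_comult :: "(two, (two list \<times> two) list) cell list \<Rightarrow> (gen_monomial \<times> gen_monomial \<Rightarrow>\<^sub>0 rat)" where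
  "bar_comult f = (\<Sum>xs\<in>{xs. set xs \<subseteq> cells_over (cells_monomial f) \<and> length xs = length f}.
     Poly_Mapping.single (cells_monomial (concat (map top_cells xs)), cells_monomial (map root_cell xs))
       (of_nat (card (Hom (Sr cells1) (map compose_cell xs) f)) / of_nat (card (outs (Sr cells2) xs))))"

lemma keys_bar_comult:
  assumes "f \<in> Obj (Sr cells1)"
  shows "Poly_Mapping.keys (bar_comult f) \<subseteq> (gen_monomials - {0}) \<times> (gen_monomials - {0})"
proof -
  have "(cells_monomial (concat (map top_cells xs)), cells_monomial (map root_cell xs)) \<in> (gen_monomials - {0}) \<times> (gen_monomials - {0})"
    if "set xs \<subseteq> cells_over (cells_monomial f) \<and> length xs = length f" for xs
  proof -
    have xs: "xs \<in> Obj (Sr cells2)" using that assms by (auto simp: Obj_Sr cells_over_def)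
    have "concat (map top_cells xs) \<in> Obj (Sr cells1)"
      using functor_ob[OF is_functor_last_face xs] by simp
    moreover have "map root_cell xs \<in> Obj (Sr cells1)"
      using functor_ob[OF is_functor_mapT[OF is_functor_root_cell] xs] by simp
    ultimately show ?thesis using cells_monomial_X1 by auto
  qed
  then show ?thesis
    unfolding bar_comult_def
    using keys_sum[of "\<lambda>xs. Poly_Mapping.single (cells_monomial (concat (map top_cells xs)), cells_monomial (map root_cell xs))
       (of_nat (card (Hom (Sr cells1) (map compose_cell xs) f)) / of_nat (card (outs (Sr cells2) xs)) :: rat)"]
    by (fastforce split: if_splits)
qed

lemma finite_outs_cells2: "y \<in> Obj cells2 \<Longrightarrow> finite (outs cells2 y)"
  using outs_cells2(2) by (auto simp: Obj_cells2)

lemma monomial_value_cells: "monomial_value (cells_monomial xs) F = prod_list (map (\<lambda>x. gen_value (cell_gen x) F) xs)"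
  by (simp add: monomial_value_eq cells_monomial_def mono_eval_msum o_def)

text \<open>Flattening the tops does not change their monomial, so the evaluated summand is a
  product over the cells of \<open>xs\<close>. Then \<open>sum_Sr\<close> factors the sum, and each
  entry of \<open>f\<close> is settled by \<open>sum_cell_value\<close>.\<close>

lemma tensor_value_bar_comult:
  assumes F: "F \<in> series_pairs" and G: "G \<in> series_pairs" and f: "f \<in> Obj (Sr cells1)"
  shows "tensor_value (bar_comult f) F G = monomial_value (cells_monomial f) (G \<circledast> F)"
proof -
  let ?M = "cells_monomial f"
  have val: "monomial_value (cells_monomial (concat (map top_cells xs))) F * monomial_value (cells_monomial (map root_cell xs)) G
      = prod_list (map (cell_value F G) xs)" for xs
    unfolding monomial_value_cells by (induction xs) (auto simp: cell_value_def)
  have "tensor_value (bar_comult f) F G = (\<Sum>xs\<in>{xs. set xs \<subseteq> cells_over ?M \<and> length xs = length f}.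
      of_nat (card (Hom (Sr cells1) (map compose_cell xs) f)) / of_nat (card (outs (Sr cells2) xs))
        * prod_list (map (cell_value F G) xs))"
    unfolding tensor_value_eq bar_comult_def lin_val_sum lin_val_single by (simp add: val)
  also have "\<dots> = prod_list (map (\<lambda>f. \<Sum>y\<in>cells_over ?M.
      of_nat (card (Hom cells1 (compose_cell y) f)) / of_nat (card (outs cells2 y)) * cell_value F G y) f)"
    by (rule sum_Sr)
      (use f in \<open>auto simp: cells_over_def Obj_Sr finite_Hom_cells1 finite_outs_cells2 finite_cells_over[unfolded cells_over_def]\<close>)
  also have "\<dots> = prod_list (map (\<lambda>x. gen_value (cell_gen x) (G \<circledast> F)) f)"
    using sum_cell_value[OF F G] f
    by (intro arg_cong[of _ _ prod_list] map_cong) (auto simp: Obj_Sr cells_monomial_def)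
  finally show ?thesis by (simp add: monomial_value_cells)
qed

lemma lookup_bar_comult:
  assumes f: "f \<in> Obj (Sr cells1)" and a: "a \<in> Obj (Sr cells1)" and b: "b \<in> Obj (Sr cells1)"
  shows "Poly_Mapping.lookup (bar_comult f) (cells_monomial a, cells_monomial b) = incidence_coeff tree_bar f a b"
proof -
  let ?E = "{xs. set xs \<subseteq> cells_over (cells_monomial f) \<and> length xs = length f}"
  have E: "?E \<subseteq> Obj (Sr cells2)" using f by (auto simp: Obj_Sr cells_over_def)
  have "incidence_coeff tree_bar f a b = (\<Sum>xs\<in>?E. if Hom (Sr cells1) (ob (face tree_bar 2 2) xs) a \<noteq> {}
      \<and> Hom (Sr cells1) (ob (face tree_bar 2 0) xs) b \<noteq> {}
    then of_nat (card (Hom (Sr cells1) (ob (face tree_bar 2 1) xs) f)) / of_nat (card (outs (Sr cells2) xs)) else 0)"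
    unfolding bar_sel(2)[symmetric] bar_sel(3)[symmetric]
  proof (rule incidence_coeff_eq; (unfold bar_sel)?)
    \<comment> \<open>An isomorphism from the composites to \<open>f\<close> forces equal lengths
      and equal sets of generators, and this is all that membership in the index set asks
      for.\<close>
    fix xs assume xs: "xs \<in> Obj (Sr cells2)" and h: "Hom (Sr cells1) (ob (mapT (cell_face sym_operad (Suc (Suc 0)) (Suc 0))) xs) f \<noteq> {}"
    have "map compose_cell xs \<in> Obj (Sr cells1)"
      using functor_ob[OF is_functor_mapT[OF is_functor_compose_cells] xs] by simp
    then have m: "cells_monomial (map compose_cell xs) = cells_monomial f"
      using h Hom_X1_nonempty[OF _ f] by simp
    have "set (map cell_gen (map compose_cell xs)) = Poly_Mapping.keys (cells_monomial (map compose_cell xs))"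
      by (simp only: cells_monomial_def keys_msum)
    then have "set (map cell_gen (map compose_cell xs)) = Poly_Mapping.keys (cells_monomial f)"
      by (simp only: m)
    moreover have "length xs = length f"
      using h by (auto elim!: Hom_SrE)
    ultimately show "xs \<in> ?E" using xs by (auto simp: cells_over_def Obj_Sr)
  next
    show "finite ?E" using finite_lists_length_eq[OF finite_cells_over] by simp
    show "finite (Hom (Sr cells1) x y)" for x y
      by (rule finite_Hom_X1)
  qed (simp_all add: f a b E is_groupoid_Sr is_groupoid_cells1 is_groupoid_cells2 is_functor_last_face
        is_functor_mapT[OF is_functor_compose_cells] is_functor_mapT[OF is_functor_root_cell])
  also have "\<dots> = (\<Sum>xs\<in>?E. if cells_monomial (concat (map top_cells xs)) = cells_monomial a \<and> cells_monomial (map root_cell xs) = cells_monomial b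
    then of_nat (card (Hom (Sr cells1) (map compose_cell xs) f)) / of_nat (card (outs (Sr cells2) xs)) else 0)"
  proof (rule sum.cong[OF refl])
    fix xs assume "xs \<in> ?E"
    then have xs: "xs \<in> Obj (Sr cells2)" using E by blast
    have "concat (map top_cells xs) \<in> Obj (Sr cells1)"
      using functor_ob[OF is_functor_last_face xs] by simp
    moreover have "map root_cell xs \<in> Obj (Sr cells1)"
      using functor_ob[OF is_functor_mapT[OF is_functor_root_cell] xs] by simp
    ultimately show "(if Hom (Sr cells1) (ob (face tree_bar 2 2) xs) a \<noteq> {} \<and> Hom (Sr cells1) (ob (face tree_bar 2 0) xs) b \<noteq> {}
        then of_nat (card (Hom (Sr cells1) (ob (face tree_bar 2 1) xs) f)) / of_nat (card (outs (Sr cells2) xs)) else 0)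
      = (if cells_monomial (concat (map top_cells xs)) = cells_monomial a \<and> cells_monomial (map root_cell xs) = cells_monomial b
        then of_nat (card (Hom (Sr cells1) (map compose_cell xs) f)) / of_nat (card (outs (Sr cells2) xs)) else 0 :: rat)"
      using Hom_X1_nonempty a b by (simp add: bar_sel bar_sel(5)[unfolded One_nat_def])
  qed
  also have "\<dots> = Poly_Mapping.lookup (bar_comult f) (cells_monomial a, cells_monomial b)"
    unfolding bar_comult_def lookup_sum_poly by (rule sum.cong) (auto simp: lookup_single when_def)
  finally show ?thesis ..
qed

text \<open>Both tensors take the value of the monomial at \<open>G \<circledast> F\<close>. For the
  product this depends on every \<open>gen_comult g\<close> being well described, which the tensor
  of a one-entry tuple \<open>[x]\<close> with \<open>cell_gen x = g\<close> guarantees.\<close>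

lemma monomial_comult:
  assumes f: "f \<in> Obj (Sr cells1)"
  shows "(\<Prod>g\<in>Poly_Mapping.keys (cells_monomial f). gen_comult g ^ Poly_Mapping.lookup (cells_monomial f) g) = bar_comult f"
proof (rule monomial_comult_eqI)
  fix g assume "g \<in> Poly_Mapping.keys (cells_monomial f)"
  then obtain x where x: "x \<in> Obj cells1" "cell_gen x = g"
    using f by (auto simp: cells_monomial_def Obj_Sr)
  then have o: "[x] \<in> Obj (Sr cells1)" by (simp add: Obj_Sr)
  have k: "Poly_Mapping.keys (bar_comult [x]) \<subseteq> gen_monomials \<times> gen_monomials"
    using keys_bar_comult[OF o] by blast
  have v: "tensor_value (bar_comult [x]) F G = gen_value g (G \<circledast> F)"
    if "F \<in> series_pairs" "G \<in> series_pairs" for F G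
    using tensor_value_bar_comult[OF that o] x(2) monomial_value_cells[of "[x]"] by simp
  have "gen_comult g = bar_comult [x]" using k v by (rule gen_comult_eqI)
  then show "Poly_Mapping.keys (gen_comult g) \<subseteq> gen_monomials \<times> gen_monomials
      \<and> (\<forall>F\<in>series_pairs. \<forall>G\<in>series_pairs. tensor_value (gen_comult g) F G = gen_value g (G \<circledast> F))"
    using k v by simp
qed (use keys_bar_comult[OF f] tensor_value_bar_comult[OF _ _ f] in auto)

definition basis_iso :: "(gen_monomial \<Rightarrow>\<^sub>0 rat) \<Rightarrow> ((two, (two list \<times> two) list) cell list set option \<Rightarrow>\<^sub>0 rat)" where
  "basis_iso = lin_ext (\<lambda>M. Poly_Mapping.single (basis_map M) 1)"

lemma tensor_map_basis_iso: "tensor_map basis_iso T = lin_ext (\<lambda>(M, N). Poly_Mapping.single (basis_map M, basis_map N) 1) T"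
  unfolding tensor_map_def basis_iso_def
  by (rule lin_ext_cong) (auto simp: lin_ext_single tensor_single)

lemma lookup_tensor_map:
  "Poly_Mapping.lookup (tensor_map basis_iso T) (u, v)
    = (\<Sum>(M, N)\<in>Poly_Mapping.keys T. if basis_map M = u \<and> basis_map N = v then Poly_Mapping.lookup T (M, N) else 0)"
  unfolding tensor_map_basis_iso lin_ext_def lookup_sum_poly
  by (rule sum.cong) (auto simp: lookup_scale lookup_single when_def)

text \<open>\<open>incidence_comult\<close> is built with \<open>Abs_poly_mapping\<close>, which is
  meaningful only for finite support. Recognising its coefficients as the lookups of an existing
  tensor settles finiteness and equality together.\<close>

lemma incidence_comult_basis_map:
  assumes M: "M \<in> gen_monomials" "M \<noteq> 0"
  shows "incidence_comult tree_bar (basis_map M) = tensor_map basis_iso (bar_comult (repr (monomial_class M)))"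
proof -
  let ?f = "repr (monomial_class M)"
  note f = repr_monomial_class[OF M]
  let ?T = "bar_comult ?f"
  let ?h = "\<lambda>(a, b). case (a, b) of
       (Some a, Some b) \<Rightarrow>
         (if a \<in> pi0 (level tree_bar 1) \<and> b \<in> pi0 (level tree_bar 1)
          then incidence_coeff tree_bar ?f (repr a) (repr b) else 0)
     | _ \<Rightarrow> 0"
  have keys: "L \<in> gen_monomials - {0} \<and> N \<in> gen_monomials - {0}" if "(L, N) \<in> Poly_Mapping.keys ?T" for L N
    using keys_bar_comult[OF f(1)] that by blast
  have lvl: "pi0 (level tree_bar 1) = monomial_class ` (gen_monomials - {0})"
    by (simp only: bar_sel(2) pi0_X1)
  have image: "u \<in> basis_map ` (gen_monomials - {0}) \<longleftrightarrow> (\<exists>a. u = Some a \<and> a \<in> pi0 (level tree_bar 1))" for u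
    unfolding lvl by (auto simp: basis_map_def image_iff)
  have "Poly_Mapping.lookup (tensor_map basis_iso ?T) (u, v) = ?h (u, v)" for u v
  proof (cases "u \<in> basis_map ` (gen_monomials - {0}) \<and> v \<in> basis_map ` (gen_monomials - {0})")
    case True
    then obtain A B where AB: "A \<in> gen_monomials" "A \<noteq> 0" "u = Some (monomial_class A)"
      "B \<in> gen_monomials" "B \<noteq> 0" "v = Some (monomial_class B)"
      by (auto simp: basis_map_def)
    have "basis_map L = u \<and> basis_map N = v \<longleftrightarrow> (L, N) = (A, B)" if "(L, N) \<in> Poly_Mapping.keys ?T" for L N
      using keys[OF that] AB monomial_class_inj by (auto simp: basis_map_def)
    then have "Poly_Mapping.lookup (tensor_map basis_iso ?T) (u, v)
        = (\<Sum>p\<in>Poly_Mapping.keys ?T. if p = (A, B) then Poly_Mapping.lookup ?T p else 0)"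
      unfolding lookup_tensor_map by (intro sum.cong) (auto split: if_splits)
    also have "\<dots> = Poly_Mapping.lookup ?T (A, B)"
      by (simp add: in_keys_iff)
    also have "\<dots> = incidence_coeff tree_bar ?f (repr (monomial_class A)) (repr (monomial_class B))"
      using lookup_bar_comult[OF f(1) repr_monomial_class(1)[OF AB(1,2)] repr_monomial_class(1)[OF AB(4,5)]]
        repr_monomial_class(2)[OF AB(1,2)] repr_monomial_class(2)[OF AB(4,5)] by simp
    also have "\<dots> = ?h (u, v)"
    proof -
      have "monomial_class A \<in> pi0 (level tree_bar 1)" "monomial_class B \<in> pi0 (level tree_bar 1)"
        unfolding lvl using AB by auto
      then show ?thesis unfolding AB(3,6) by (simp del: One_nat_def)
    qed
    finally show ?thesis .
  next
    case False
    have "Poly_Mapping.lookup (tensor_map basis_iso ?T) (u, v) = 0"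
      unfolding lookup_tensor_map by (rule sum.neutral) (use keys False in auto)
    moreover have "?h (u, v) = 0"
      using False unfolding image by (auto split: option.split)
    ultimately show ?thesis by simp
  qed
  then have "?h = Poly_Mapping.lookup (tensor_map basis_iso ?T)" by (intro ext) auto
  then show ?thesis
    unfolding incidence_comult_def using M(2) by (simp add: basis_map_def lookup_inverse)
qed

section \<open>The counit\<close>

lemma Sr_cells0:
  "is_groupoid (cells sym_operad 0)" "Obj (cells sym_operad 0) = {Colour One, Colour Two}"
  "\<And>c. card (outs (cells sym_operad 0) (Colour c)) = 1" "\<And>c. finite (outs (cells sym_operad 0) (Colour c))"
proof -
  have eq: "cells sym_operad 0 = relabel colourF colour_groupoid"
    by (simp add: cells.simps colours_sym_operad)
  show "is_groupoid (cells sym_operad 0)" unfolding eq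
    by (intro is_groupoid_relabel is_groupoid_colour inj_embeddings)
  show "Obj (cells sym_operad 0) = {Colour One, Colour Two}"
    by (simp add: eq relabel_def discrete_def embedding_sel)
  have o: "outs colour_groupoid c = {(c, c)}" for c
    by (auto simp: outs_def discrete_def UNIV_two[symmetric])
  show 1: "card (outs (cells sym_operad 0) (Colour c)) = 1" for c
    using card_outs_relabel[OF inj_embeddings(5,6), of colour_groupoid c] o by (simp add: eq embedding_sel)
  show "finite (outs (cells sym_operad 0) (Colour c))" for c
    using 1[of c] by (intro card_ge_0_finite) simp
qed

lemma degen_tree_bar: "degen tree_bar 0 0 = mapT (cell_degen sym_operad 0 0)"
  by (simp add: bar_def)

lemma unit_cell: "ob (cell_degen sym_operad 0 0) (Colour c) = Oper (op_of_word c [(c, 1)])"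
  by (simp add: cell_degen.simps inv_embeddings embedding_sel T_S_def T_M_def Ass2_def unitT_def pairF_def op_of_word_def)

lemma is_functor_unit_cell: "is_functor (cell_degen sym_operad 0 0) (cells sym_operad 0) cells1"
proof -
  have "is_functor (unitO sym_operad) colour_groupoid op_groupoid"
  proof (rule is_functor_only_identities[OF only_identities_discrete is_groupoid_op])
    fix c
    have u: "ob (unitO sym_operad) c = [([c], c)]" "ar (unitO sym_operad) c = ([0], [(([0], [c]), c)])"
      by (simp_all add: T_S_def T_M_def Ass2_def unitT_def pairF_def)
    show "ob (unitO sym_operad) c \<in> Obj op_groupoid"
      by (auto simp: u op_groupoid_eq Obj_Sr Obj_arrow_groupoid)
    have "Id op_groupoid [([c], c)] = ([0], [(([0], [c]), c)])"
      by (simp add: op_groupoid_eq Id_Sr Id_arrow_groupoid)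
    then show "ar (unitO sym_operad) (Id colour_groupoid c) = Id op_groupoid (ob (unitO sym_operad) c)"
      by (simp add: u discrete_def)
  qed
  then show ?thesis
    unfolding cell_degen.simps cells.simps colours_sym_operad
    by (auto intro!: is_functor_compF is_functor_inv_functor is_functor_relabel inj_embeddings)
qed

text \<open>Again \<open>sum_Sr\<close> factors the fibre over the entries of \<open>f\<close>. An
  entry contributes 1 if it is isomorphic to a unit operation, whose word is
  \<open>[(d, 1)]\<close>, and 0 otherwise; these are the coefficients of the identity for
  plethysm.\<close>

lemma incidence_counit_basis_map:
  assumes M: "M \<in> gen_monomials"
  shows "incidence_counit tree_bar (basis_map M) = monomial_value M unit_pair"
proof (cases "M = 0")
  case True
  then show ?thesis by (simp add: incidence_counit_def basis_map_def monomial_value_def)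
next
  case False
  let ?f = "repr (monomial_class M)"
  note f = repr_monomial_class[OF M False]
  let ?C = "Obj (cells sym_operad 0)"
  let ?E = "{xs. set xs \<subseteq> ?C \<and> length xs = length ?f}"
  let ?u = "cell_degen sym_operad 0 0"
  have finC: "finite ?C" by (simp add: Sr_cells0)
  have outs: "card (outs (cells sym_operad 0) x) = 1" "finite (outs (cells sym_operad 0) x)" if "x \<in> ?C" for x
    using that Sr_cells0(2-4) by auto
  have "incidence_counit tree_bar (basis_map M)
      = hcard (hofibre (mapT ?u) (Sr (cells sym_operad 0)) (Sr cells1) ?f)"
    using False by (simp add: incidence_counit_def basis_map_def degen_tree_bar bar_sel bar_sel(2)[unfolded One_nat_def])
  also have "\<dots> = (\<Sum>xs\<in>?E. of_nat (card (Hom (Sr cells1) (ob (mapT ?u) xs) ?f)) / of_nat (card (outs (Sr (cells sym_operad 0)) xs)))"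
  proof (rule hcard_hofibre)
    show "finite ?E" using finite_lists_length_eq[OF finC] by simp
    show "?E \<subseteq> Obj (Sr (cells sym_operad 0))" using f(1) by (auto simp: Obj_Sr)
    show "xs \<in> ?E" if "xs \<in> Obj (Sr (cells sym_operad 0))" "Hom (Sr cells1) (ob (mapT ?u) xs) ?f \<noteq> {}" for xs
      using that by (auto simp: Obj_Sr elim!: Hom_SrE)
  qed (simp_all add: f finite_Hom_X1 is_groupoid_Sr Sr_cells0(1) is_groupoid_cells1 is_functor_mapT[OF is_functor_unit_cell] del: mapT_sel)
  \<comment> \<open>The weight 1 is inserted to bring the sum into the form of
    \<open>sum_Sr\<close>.\<close>
  also have "\<dots> = (\<Sum>xs\<in>?E. of_nat (card (Hom (Sr cells1) (map (ob ?u) xs) ?f)) / of_nat (card (outs (Sr (cells sym_operad 0)) xs))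
      * prod_list (map (\<lambda>_. 1) xs))"
    by (simp add: map_replicate_const)
  also have "\<dots> = prod_list (map (\<lambda>f. \<Sum>x\<in>?C. of_nat (card (Hom cells1 (ob ?u x) f)) / of_nat (card (outs (cells sym_operad 0) x)) * 1) ?f)"
    by (rule sum_Sr) (use finC outs f(1) in \<open>auto simp: finite_Hom_cells1 Obj_Sr\<close>)
  also have "\<dots> = prod_list (map (\<lambda>x. gen_value (cell_gen x) unit_pair) ?f)"
  proof (intro arg_cong[of _ _ prod_list] map_cong refl)
    fix x assume "x \<in> set ?f"
    then have x: "x \<in> Obj cells1" using f(1) by (auto simp: Obj_Sr)
    obtain d \<mu> where g: "cell_gen x = (d, \<mu>)" by (cases "cell_gen x")
    have w: "[(c, 1)] \<in> words" for c by (simp add: words_def)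
    have hom: "of_nat (card (Hom cells1 (ob ?u (Colour c)) x)) = (if c = d \<and> \<mu> = Poly_Mapping.single (d, 1) 1 then 1 else 0 :: rat)" for c
    proof -
      have "Oper (op_of_word c [(c, 1)]) \<in> Obj cells1" using w by (auto simp: Obj_cells1)
      from card_Hom_cells1_gen[OF this x] show ?thesis
        unfolding unit_cell cell_gen_word[OF w] g by (auto simp: exp_factorial_def)
    qed
    have "(\<Sum>y\<in>?C. of_nat (card (Hom cells1 (ob ?u y) x)) / of_nat (card (outs (cells sym_operad 0) y)) * 1 :: rat)
        = of_nat (card (Hom cells1 (ob ?u (Colour One)) x)) + of_nat (card (Hom cells1 (ob ?u (Colour Two)) x))"
      using outs(1) by (simp add: Sr_cells0(2))
    also have "\<dots> = gen_value (d, \<mu>) unit_pair"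
      unfolding hom by (cases d) (auto simp: gen_value_def unit_pair_def mvar.rep_eq exp_factorial_def)
    finally show "(\<Sum>y\<in>?C. of_nat (card (Hom cells1 (ob ?u y) x)) / of_nat (card (outs (cells sym_operad 0) y)) * 1 :: rat)
        = gen_value (cell_gen x) unit_pair" by (simp only: g)
  qed
  finally show ?thesis using monomial_value_cells[of ?f] f(2) by simp
qed

section \<open>The isomorphism of bialgebras\<close>

theorem theorem5p18:
  shows "bialgebra_isomorphic P2exp (incidence_bialgebra (bar (T_S (T_M Ass2))))"
proof -
  let ?B = "incidence_bialgebra tree_bar"
  have basis: "basis ?B = insert None (Some ` pi0 (Sr cells1))"
    by (simp add: incidence_bialgebra_def bar_sel(2)[unfolded One_nat_def])
  \<comment> \<open>Reading the renaming of the basis backwards gives the inverse linear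
    map.\<close>
  let ?inv = "inv_into gen_monomials basis_map"
  let ?\<psi> = "lin_ext (\<lambda>c. Poly_Mapping.single (?inv c) 1)"
  have vecA: "vectors P2exp = {v. Poly_Mapping.keys v \<subseteq> gen_monomials}"
    by (simp add: vectors_def P2exp_def)
  have vecB: "vectors ?B = {v. Poly_Mapping.keys v \<subseteq> basis_map ` gen_monomials}"
    using bij_basis_map by (simp add: vectors_def basis bij_betw_def)
  have keys_lin: "Poly_Mapping.keys (lin_ext (\<lambda>b. Poly_Mapping.single (g b) 1) v) \<subseteq> g ` Poly_Mapping.keys v"
    for g :: "'x \<Rightarrow> 'y" and v :: "'x \<Rightarrow>\<^sub>0 rat"
    unfolding lin_ext_def scale_single
    using keys_sum[of "\<lambda>b. Poly_Mapping.single (g b) (Poly_Mapping.lookup v b * 1)" "Poly_Mapping.keys v"]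
    by (auto split: if_splits)
  have inj: "inj_on basis_map gen_monomials" using bij_basis_map by (simp add: bij_betw_def)
  have "bij_betw basis_iso (vectors P2exp) (vectors ?B)"
  proof (rule bij_betw_byWitness[of _ ?\<psi>])
    show "\<forall>v\<in>vectors P2exp. ?\<psi> (basis_iso v) = v"
    proof
      fix v assume "v \<in> vectors P2exp"
      then have "?\<psi> (basis_iso v) = lin_ext (\<lambda>M. Poly_Mapping.single M 1) v"
        unfolding basis_iso_def lin_ext_lin_ext vecA
        by (intro lin_ext_cong) (auto simp: lin_ext_single inv_into_f_f[OF inj])
      then show "?\<psi> (basis_iso v) = v" by (simp only: lin_ext_id)
    qed
    show "\<forall>v\<in>vectors ?B. basis_iso (?\<psi> v) = v"
    proof
      fix v assume "v \<in> vectors ?B"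
      then have "basis_iso (?\<psi> v) = lin_ext (\<lambda>c. Poly_Mapping.single c 1) v"
        unfolding basis_iso_def lin_ext_lin_ext vecB
        by (intro lin_ext_cong) (auto simp: lin_ext_single f_inv_into_f)
      then show "basis_iso (?\<psi> v) = v" by (simp only: lin_ext_id)
    qed
    show "basis_iso ` vectors P2exp \<subseteq> vectors ?B"
      unfolding vecA vecB basis_iso_def using keys_lin by fastforce
    show "?\<psi> ` vectors ?B \<subseteq> vectors P2exp"
      unfolding vecA vecB using keys_lin[of ?inv] inv_into_into[of _ basis_map gen_monomials] by fastforce
  qed
  moreover have "basis_iso (multB P2exp u v) = multB ?B (basis_iso u) (basis_iso v)"
    if "u \<in> vectors P2exp" "v \<in> vectors P2exp" for u v
  proof -
    have "basis_iso (multB P2exp u v) = lin_ext (\<lambda>M. lin_ext (\<lambda>N. Poly_Mapping.single (basis_map (M + N)) 1) v) u"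
      by (simp add: P2exp_def basis_iso_def times_eq_sum lin_ext_sum lin_ext_single scale_single)
        (simp add: lin_ext_def scale_single scale_sum)
    also have "\<dots> = lin_ext (\<lambda>M. lin_ext (\<lambda>N. Poly_Mapping.single (juxtapose tree_bar (basis_map M) (basis_map N)) 1) v) u"
      using that by (intro lin_ext_cong) (auto simp: vecA juxtapose_basis_map subset_iff)
    also have "\<dots> = multB ?B (basis_iso u) (basis_iso v)"
      by (simp add: incidence_bialgebra_def tensor_def basis_iso_def lin_ext_lin_ext lin_ext_single)
    finally show ?thesis .
  qed
  moreover have "basis_iso (oneB P2exp) = oneB ?B"
    using lin_ext_single[of "\<lambda>M. Poly_Mapping.single (basis_map M) (1 :: rat)" 0 1]
    by (simp add: P2exp_def incidence_bialgebra_def basis_iso_def basis_map_def)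
  moreover have "comultB ?B (basis_iso v) = tensor_map basis_iso (comultB P2exp v)" if "v \<in> vectors P2exp" for v
  proof -
    let ?c = "\<lambda>M. \<Prod>g\<in>Poly_Mapping.keys M. gen_comult g ^ Poly_Mapping.lookup M g"
    have "comultB ?B (basis_iso v) = lin_ext (\<lambda>M. incidence_comult tree_bar (basis_map M)) v"
      by (simp add: incidence_bialgebra_def basis_iso_def lin_ext_lin_ext lin_ext_single)
    also have "\<dots> = lin_ext (\<lambda>M. tensor_map basis_iso (?c M)) v"
    proof (rule lin_ext_cong)
      fix M assume "M \<in> Poly_Mapping.keys v"
      then have M: "M \<in> gen_monomials" using that by (auto simp: vecA)
      show "incidence_comult tree_bar (basis_map M) = tensor_map basis_iso (?c M)"
      proof (cases "M = 0")
        \<comment> \<open>The constant monomial has an empty product of comultiplications, which is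
          the unit tensor; it matches the rule that the adjoined unit is grouplike.\<close>
        case True
        have "tensor_map basis_iso (1 :: gen_monomial \<times> gen_monomial \<Rightarrow>\<^sub>0 rat) = Poly_Mapping.single (None, None) 1"
        proof -
          have one: "(1 :: gen_monomial \<times> gen_monomial \<Rightarrow>\<^sub>0 rat) = Poly_Mapping.single (0, 0) 1"
            by (metis single_one zero_prod_def)
          show ?thesis unfolding tensor_map_basis_iso one lin_ext_single by (simp add: basis_map_def)
        qed
        then show ?thesis using True by (simp add: incidence_comult_def basis_map_def)
      next
        case False
        show ?thesis
          using incidence_comult_basis_map[OF M False] monomial_comult[OF repr_monomial_class(1)[OF M False]]
          by (simp add: repr_monomial_class(2)[OF M False])
      qed
    qed
    also have "\<dots> = tensor_map basis_iso (comultB P2exp v)"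
      by (simp add: P2exp_def tensor_map_def lin_ext_lin_ext)
    finally show ?thesis .
  qed
  moreover have "counitB ?B (basis_iso v) = counitB P2exp v" if "v \<in> vectors P2exp" for v
  proof -
    have "counitB ?B (basis_iso v) = lin_val (incidence_counit tree_bar) (basis_iso v)"
      by (simp add: incidence_bialgebra_def lin_val_def)
    also have "\<dots> = lin_val (\<lambda>M. incidence_counit tree_bar (basis_map M)) v"
      by (simp add: basis_iso_def lin_val_lin_ext lin_val_single)
    also have "\<dots> = lin_val (\<lambda>M. monomial_value M unit_pair) v"
      using that unfolding vecA lin_val_def
      by (intro sum.cong refl) (auto simp: incidence_counit_basis_map subset_iff)
    also have "\<dots> = counitB P2exp v"
      by (simp add: lin_val_def P2exp_def poly_value_def)
    finally show ?thesis .
  qed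
  ultimately have "bialgebra_iso P2exp ?B basis_iso"
    by (simp add: bialgebra_iso_def basis_iso_def lin_ext_add lin_ext_scale)
  then show ?thesis unfolding bialgebra_isomorphic_def by blast
qed

end
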